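(* Let $T$ be a set of transpositions in the symmetric group $S_n$ such that $G_T$ is a connected cubic (i.e. $3$-regular) graph. Then $\mathrm{Cay}(S_n,T)$ is integral if and only if $G_T$ is isomorphic to one of the graphs $K_4$ or $K_{3,3}$.
   Context: $S_n$ is the symmetric group on $[n]=\{1,\dots,n\}$. For a group $G$ and an inverse-closed subset $S\subseteq G$ not containing the identity, $\mathrm{Cay}(G,S)$ is the graph with vertex set $G$ in which $g_1,g_2$ are adjacent if and only if $g_1g_2^{-1}\in S$. For a set $T$ of transpositions in $S_n$, $G_T$ is the graph with vertex set $[n]$ in which $i,j$ are adjacent if and only if $(i,j)\in T$. A finite simple graph is integral if all eigenvalues of its adjacency matrix are integers. *)

theory Defs
  imports
    "HOL-Combinatorics.Transposition"
    "HOL-Algebra.Sym_Groups"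
    "Jordan_Normal_Form.Char_Poly"
    "Graph_Theory.Graph_Theory"
begin

text \<open>
  A finite simple graph is a finite symmetric loop-free digraph without parallel arcs, i.e. a
  \<^locale>\<open>pair_graph\<close>; the edge between \<open>u\<close> and \<open>v\<close> is represented by the two arcs
  \<open>(u, v)\<close> and \<open>(v, u)\<close>. The degree of a vertex is therefore its out-degree.
\<close>

definition cubic :: "'a pair_pre_digraph \<Rightarrow> bool" where
  "cubic G \<longleftrightarrow> (\<forall>v \<in> pverts G. out_degree (with_proj G) v = 3)"

definition complete_graph :: "nat \<Rightarrow> nat pair_pre_digraph" where
  "complete_graph n = \<lparr> pverts = {..<n}, parcs = {(u, v) \<in> {..<n} \<times> {..<n}. u \<noteq> v} \<rparr>"

definition complete_bipartite_graph :: "nat \<Rightarrow> nat \<Rightarrow> (nat + nat) pair_pre_digraph" where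
  "complete_bipartite_graph m n =
     \<lparr> pverts = Inl ` {..<m} \<union> Inr ` {..<n},
       parcs = Inl ` {..<m} \<times> Inr ` {..<n} \<union> Inr ` {..<n} \<times> Inl ` {..<m} \<rparr>"

lemma complete_digraph_complete_graph: "complete_digraph n (with_proj (complete_graph n))"
  by (auto simp: complete_digraph_pair_def complete_graph_def)

lemma complete_bipartite_digraph_complete_bipartite_graph:
  "complete_bipartite_digraph m n (with_proj (complete_bipartite_graph m n))"
  unfolding complete_bipartite_digraph_pair_def complete_bipartite_graph_def
  by (intro conjI exI[of _ "Inl ` {..<m}"] exI[of _ "Inr ` {..<n}"]) (auto simp: card_image)

definition adjacency_mat :: "'a pair_pre_digraph \<Rightarrow> 'a list \<Rightarrow> complex mat" where
  "adjacency_mat G vs = mat (length vs) (length vs)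
     (\<lambda>(i, j). if (vs ! i, vs ! j) \<in> parcs G then 1 else 0)"

text \<open>
  The adjacency matrix depends on an enumeration of the vertices, its eigenvalues do not: different
  enumerations give matrices that are conjugate by a permutation matrix. The quantification over
  \<open>vs\<close> is not vacuous, since the vertex set of a \<^locale>\<open>pair_graph\<close> is finite.
\<close>

definition integral_graph :: "'a pair_pre_digraph \<Rightarrow> bool" where
  "integral_graph G \<longleftrightarrow> pair_graph G \<and>
     (\<forall>vs. distinct vs \<and> set vs = pverts G \<longrightarrow>
        (\<forall>k. eigenvalue (adjacency_mat G vs) k \<longrightarrow> k \<in> \<int>))"

definition Cay :: "('a, 'b) monoid_scheme \<Rightarrow> 'a set \<Rightarrow> 'a pair_pre_digraph" where
  "Cay G S = \<lparr> pverts = carrier G,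
     parcs = {(g, h) \<in> carrier G \<times> carrier G. g \<otimes>\<^bsub>G\<^esub> inv\<^bsub>G\<^esub> h \<in> S} \<rparr>"

lemma pair_graph_Cay:
  assumes "group G" "finite (carrier G)" "S \<subseteq> carrier G" "\<one>\<^bsub>G\<^esub> \<notin> S"
    and "\<And>s. s \<in> S \<Longrightarrow> inv\<^bsub>G\<^esub> s \<in> S"
  shows "pair_graph (Cay G S)"
proof -
  interpret group G by fact
  have fin: "finite (parcs (Cay G S))"
    by (rule finite_subset[of _ "carrier G \<times> carrier G"]) (auto simp: Cay_def assms)
  have "h \<otimes>\<^bsub>G\<^esub> inv\<^bsub>G\<^esub> g \<in> S"
    if "g \<in> carrier G" "h \<in> carrier G" "g \<otimes>\<^bsub>G\<^esub> inv\<^bsub>G\<^esub> h \<in> S" for g h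
    using assms(5)[OF that(3)] that by (simp add: inv_mult_group)
  with fin assms show ?thesis
    by unfold_locales (auto simp: Cay_def symmetric_def intro!: symI)
qed

definition transpositions :: "nat \<Rightarrow> (nat \<Rightarrow> nat) set" where
  "transpositions n = {transpose i j | i j. i \<in> {1..n} \<and> j \<in> {1..n} \<and> i \<noteq> j}"

definition transposition_graph :: "nat \<Rightarrow> (nat \<Rightarrow> nat) set \<Rightarrow> nat pair_pre_digraph" where
  "transposition_graph n T = \<lparr> pverts = {1..n},
     parcs = {(i, j) \<in> {1..n} \<times> {1..n}. i \<noteq> j \<and> transpose i j \<in> T} \<rparr>"

lemma pair_graph_transposition_graph: "pair_graph (transposition_graph n T)"
proof -
  have "finite (parcs (transposition_graph n T))"
    by (rule finite_subset[of _ "{1..n} \<times> {1..n}"]) (auto simp: transposition_graph_def)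
  then show ?thesis
    by unfold_locales
      (auto simp: transposition_graph_def symmetric_def transpose_commute intro!: symI)
qed

lemma pair_graph_Cay_transpositions:
  assumes "T \<subseteq> transpositions n"
  shows "pair_graph (Cay (sym_group n) T)"
proof (rule pair_graph_Cay)
  have T: "\<exists>i\<in>{1..n}. \<exists>j\<in>{1..n}. i \<noteq> j \<and> t = transpose i j" if "t \<in> T" for t
    using that assms unfolding transpositions_def by blast
  show grp: "group (sym_group n)" by (rule sym_group_is_group)
  show "finite (carrier (sym_group n))"
    by (simp add: sym_group_def finite_permutations)
  show sub: "T \<subseteq> carrier (sym_group n)"
    using T by (force simp: sym_group_def intro: permutes_swap_id)
  show "\<one>\<^bsub>sym_group n\<^esub> \<notin> T"
    using T by (force simp: sym_group_def transpose_eq_id_iff dest: sym)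
  show "inv\<^bsub>sym_group n\<^esub> t \<in> T" if "t \<in> T" for t
  proof -
    have "inv\<^bsub>sym_group n\<^esub> t = t"
      using T[OF that] sub that
      by (intro group.inv_equality[OF grp]) (auto simp: sym_group_def)
    then show ?thesis using that by simp
  qed
qed

end

theory Submission
  imports Defs "HOL-Computational_Algebra.Fundamental_Theorem_Algebra"
begin

text \<open>
  For the direction from left to right, write \<open>A\<close> for the adjacency matrix of \<open>G\<^sub>T\<close>. Functions of one and of two
  points lift to eigenfunctions of the Cayley graph, so \<open>A\<close> is integral and so is the Laplacian \<open>L2\<close> of two
  indistinguishable tokens. Hence \<open>A\<close> is annihilated by the product \<open>mu\<close> of the \<open>x - k\<close> with \<open>-3 \<le> k \<le> 3\<close>. The
  polynomials in \<open>A\<close> that are concentrated on the eigenvalues \<open>3\<close> and \<open>-3\<close> have constant entries on each pair of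
  bipartition classes, and the ones concentrated on \<open>0\<close>, on \<open>\<plusminus>1\<close> or on \<open>\<plusminus>2\<close> are semidefinite up to sign. This bounds the number of vertices and
  controls the short closed walks. In every remaining case other than \<open>K\<^sub>4\<close> and \<open>K\<^sub>3\<^sub>,\<^sub>3\<close> a few functions of two
  points span an invariant space of \<open>L2\<close>, up to constants, on which \<open>L2\<close> has an irrational eigenvalue.

  Conversely, the sum of all transpositions of a set is a sum of commuting Jucys-Murphy elements, which have integral
  eigenvalues. For \<open>K\<^sub>3\<^sub>,\<^sub>3\<close> one subtracts from it the sums for the two sides, which commute with it.
\<close>

section \<open>Polynomials in a linear operator\<close>

text \<open>Integrality of A alone cannot finish the argument: the cube, the Petersen graph and the
  prisms over a triangle and a hexagon are connected, cubic and have integral adjacency spectra.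
  This is why the second spectrum, that of \<open>L2\<close>, is needed. Most of these graphs are
  never identified up to isomorphism; the identities between walk counts that the spectrum forces
  suffice to compute \<open>L2\<close>. Bipartite and other graphs are handled together through the
  sets of vertices reachable by even and by odd walks. All these sets have the same size
  \<open>sz\<close>, and evaluating at 3 the polynomial for the eigenvalues 3 and -3 gives
  \<open>em * sz = 120\<close>. A vertex has at least 15 closed 4-walks, so the semidefinite
  diagonals leave only divisors of 120 between 3 and 15. Irrationality is never shown by solving
  equations. An eigenvalue of \<open>L2\<close> on the invariant space is a root of an explicit
  integer polynomial without roots modulo 3, so it is not an integer. \<open>L2\<close> annihilates
  constants, and working modulo them keeps these spaces small.\<close>

definition polyop :: "(('x \<Rightarrow> 'b::comm_ring_1) \<Rightarrow> 'x \<Rightarrow> 'b) \<Rightarrow> 'b poly \<Rightarrow> ('x \<Rightarrow> 'b) \<Rightarrow> 'x \<Rightarrow> 'b" where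
  "polyop L p f = fold_coeffs (\<lambda>a g x. a * f x + L g x) p (\<lambda>_. 0)"

lemma polyop_0 [simp]: "polyop L 0 f = (\<lambda>_. 0)"
  by (simp add: polyop_def)

locale linear_op =
  fixes L :: "('x \<Rightarrow> 'b::comm_ring_1) \<Rightarrow> 'x \<Rightarrow> 'b"
  assumes op_add: "L (\<lambda>x. f x + g x) = (\<lambda>x. L f x + L g x)"
    and op_scale: "L (\<lambda>x. c * f x) = (\<lambda>x. c * L f x)"
begin

lemma op_zero [simp]: "L (\<lambda>_. 0) = (\<lambda>_. 0)"
  using op_scale[of 0 "\<lambda>_. 0"] by simp

lemma polyop_pCons [simp]:
  "polyop L (pCons a p) f = (\<lambda>x. a * f x + L (polyop L p f) x)"
proof (cases "p = 0 \<and> a = 0")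
  case True
  then show ?thesis by simp
next
  case False
  then consider "a \<noteq> 0" | "p \<noteq> 0" by blast
  then show ?thesis
    by cases (simp_all add: polyop_def fold_coeffs_pCons_coeff_not_0_eq fold_coeffs_pCons_not_0_0_eq)
qed

lemma polyop_add: "polyop L (p + q) f = (\<lambda>x. polyop L p f x + polyop L q f x)"
  by (induction p q rule: poly_induct2) (simp_all add: op_add algebra_simps)

lemma polyop_smult: "polyop L (Polynomial.smult c p) f = (\<lambda>x. c * polyop L p f x)"
  by (induction p) (simp_all add: op_scale algebra_simps)

lemma polyop_mult: "polyop L (p * q) f = polyop L p (polyop L q f)"
  by (induction p) (simp_all add: polyop_add polyop_smult)

lemma polyop_commute: "L (polyop L p f) = polyop L p (L f)"
proof (induction p)
  case (pCons a p)
  then show ?case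
    by (simp add: op_add op_scale fun_eq_iff)
qed simp

lemma polyop_sum: "polyop L (\<Sum>i\<in>I. p i) f = (\<lambda>x. \<Sum>i\<in>I. polyop L (p i) f x)"
  by (induction I rule: infinite_finite_induct) (simp_all add: polyop_add)

lemma polyop_eigen:
  assumes "L g = (\<lambda>x. k * g x)"
  shows "polyop L p g = (\<lambda>x. poly p k * g x)"
proof (induction p)
  case (pCons a p)
  then show ?case
    by (simp only: polyop_pCons op_scale assms poly_pCons) (simp add: algebra_simps)
qed simp

lemma polyop_closed:
  assumes "P f" "P (\<lambda>_. 0)" "\<And>g. P g \<Longrightarrow> P (L g)"
    "\<And>a g. P g \<Longrightarrow> P (\<lambda>x. a * f x + g x)"
  shows "P (polyop L p f)"
  by (induction p) (simp_all add: assms)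

lemma polyop_monom: "polyop L (monom c k) f = (\<lambda>x. c * (L ^^ k) f x)"
  by (induction k) (simp_all add: monom_0 monom_Suc op_scale)

end

lemma (in linear_op) polyop_diff:
  "polyop L (p - q) f = (\<lambda>x. polyop L p f x - polyop L q f x)"
  using polyop_add[of p "Polynomial.smult (-1) q" f] polyop_smult[of "-1" q f] by simp

text \<open>Roots are removed from \<open>p\<close> until the quotient q no longer annihilates
  \<open>f\<close>; then q(L) f is an eigenvector for the root removed last. Because of this form it
  inherits every linear property of \<open>f\<close> that \<open>L\<close> preserves, such as
  support or symmetry.\<close>

lemma eigenvector_of_annihilating_poly:
  fixes L :: "('x \<Rightarrow> complex) \<Rightarrow> 'x \<Rightarrow> complex"
  assumes "linear_op L" "p \<noteq> 0" "polyop L p f = (\<lambda>_. 0)" "f \<noteq> (\<lambda>_. 0)"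
  shows "\<exists>k q. poly p k = 0 \<and> polyop L q f \<noteq> (\<lambda>_. 0) \<and>
    L (polyop L q f) = (\<lambda>x. k * polyop L q f x)"
  using assms(2,3)
proof (induction "degree p" arbitrary: p rule: less_induct)
  case less
  interpret linear_op L by fact
  show ?case
  proof (cases "degree p = 0")
    case True
    then obtain c where "p = [:c:]" by (metis degree_eq_zeroE)
    with less assms(4) show ?thesis by (auto simp: fun_eq_iff)
  next
    case False
    then obtain z where z: "poly p z = 0"
      using fundamental_theorem_of_algebra[of p] constant_degree[of p] by metis
    then obtain q where q: "p = [:- z, 1:] * q"
      by (metis poly_eq_0_iff_dvd dvdE)
    have q0: "q \<noteq> 0" using less.prems q by auto
    have deg: "degree q < degree p"
      using q0 unfolding q by (subst degree_mult_eq) auto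
    show ?thesis
    proof (cases "polyop L q f = (\<lambda>_. 0)")
      case True
      from less.hyps[OF deg q0 this] show ?thesis by (auto simp: q)
    next
      case False
      have "polyop L [:- z, 1:] (polyop L q f) = (\<lambda>_. 0)"
        using less.prems(2) unfolding q polyop_mult .
      then have "L (polyop L q f) = (\<lambda>x. z * polyop L q f x)"
        by (simp add: fun_eq_iff)
      with False z show ?thesis by blast
    qed
  qed
qed

text \<open>The functions supported on n points form an n-dimensional space, so \<open>g\<close> and
  its first n iterates are linearly dependent.\<close>

lemma exists_annihilating_poly:
  fixes L :: "('x \<Rightarrow> complex) \<Rightarrow> 'x \<Rightarrow> complex"
  assumes "linear_op L" "finite S" "\<And>f. (\<forall>x. x \<notin> S \<longrightarrow> f x = 0) \<Longrightarrow> \<forall>x. x \<notin> S \<longrightarrow> L f x = 0"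
    and "\<forall>x. x \<notin> S \<longrightarrow> g x = 0"
  shows "\<exists>p. p \<noteq> 0 \<and> polyop L p g = (\<lambda>_. 0)"
proof -
  interpret linear_op L by fact
  obtain xs where xs: "set xs = S" "distinct xs"
    using finite_distinct_list[OF assms(2)] by blast
  define n where "n = length xs"
  have supp: "\<forall>x. x \<notin> S \<longrightarrow> (L ^^ k) g x = 0" for k
    by (induction k) (use assms(3,4) in simp_all)
  \<comment> \<open>Row n is zero. It makes the matrix square with determinant 0, and a kernel
    vector then provides the coefficients of the dependency.\<close>
  define B where "B = mat (Suc n) (Suc n) (\<lambda>(i, j). if i < n then (L ^^ j) g (xs ! i) else 0)"
  have B: "B \<in> carrier_mat (Suc n) (Suc n)" by (simp add: B_def)
  have "det B = 0"
  proof -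
    have "row B n = 0\<^sub>v (Suc n)" by (rule eq_vecI) (simp_all add: B_def)
    then show ?thesis
      using laplace_expansion_row[OF B, of n] by (simp add: B_def)
  qed
  then obtain v where v: "v \<in> carrier_vec (Suc n)" "v \<noteq> 0\<^sub>v (Suc n)" "B *\<^sub>v v = 0\<^sub>v (Suc n)"
    using det_0_iff_vec_prod_zero[OF B] by blast
  define p where "p = (\<Sum>j<Suc n. monom (v $ j) j)"
  have "polyop L p g x = 0" for x
  proof (cases "x \<in> S")
    case True
    then obtain i where i: "i < n" "x = xs ! i"
      using xs by (metis in_set_conv_nth n_def)
    have "(B *\<^sub>v v) $ i = 0" using v i by simp
    then have "(\<Sum>j<Suc n. (L ^^ j) g x * v $ j) = 0"
      using i v(1) by (simp add: B_def scalar_prod_def atLeast0LessThan)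
    then show ?thesis unfolding p_def polyop_sum polyop_monom by (simp add: mult.commute)
  next
    case False
    then show ?thesis unfolding p_def polyop_sum polyop_monom using supp by simp
  qed
  moreover have "p \<noteq> 0"
  proof
    assume "p = 0"
    have "v $ i = 0" if "i < Suc n" for i
    proof -
      have "coeff p i = v $ i"
        using that unfolding p_def coeff_sum by (simp only: coeff_monom sum.delta' finite_lessThan lessThan_iff if_True)
          (simp add: sum.delta)
      with \<open>p = 0\<close> show ?thesis by simp
    qed
    then have "v = 0\<^sub>v (Suc n)" using v(1) by (intro eq_vecI) auto
    with v show False by simp
  qed
  ultimately show ?thesis by (auto simp: fun_eq_iff)
qed

section \<open>Walks in a cubic graph\<close>

locale cubic_graph =
  fixes V :: "'a set" and N :: "'a \<Rightarrow> 'a set"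
  assumes finite_V: "finite V" and V_nonempty: "V \<noteq> {}"
    and N_subset: "v \<in> V \<Longrightarrow> N v \<subseteq> V"
    and card_N: "v \<in> V \<Longrightarrow> card (N v) = 3"
    and N_sym: "u \<in> V \<Longrightarrow> v \<in> N u \<Longrightarrow> u \<in> N v"
    and N_irrefl: "v \<in> V \<Longrightarrow> v \<notin> N v"
    and connectedness: "S \<subseteq> V \<Longrightarrow> S \<noteq> {} \<Longrightarrow> (\<And>v. v \<in> S \<Longrightarrow> N v \<subseteq> S) \<Longrightarrow> S = V"
begin

lemma finite_N: "v \<in> V \<Longrightarrow> finite (N v)"
  using N_subset finite_V finite_subset by blast

lemma N_in_V: "v \<in> V \<Longrightarrow> w \<in> N v \<Longrightarrow> w \<in> V"
  using N_subset by blast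

lemma N_commute: "u \<in> V \<Longrightarrow> v \<in> V \<Longrightarrow> u \<in> N v \<longleftrightarrow> v \<in> N u"
  using N_sym by blast

text \<open>With the value 0 outside \<open>V\<close>, an eigenfunction for a nonzero eigenvalue
  vanishes there, so functions on the whole type can be used.\<close>

definition adj :: "('a \<Rightarrow> 'b::comm_ring_1) \<Rightarrow> 'a \<Rightarrow> 'b" where
  "adj f v = (if v \<in> V then \<Sum>w\<in>N v. f w else 0)"

definition delta :: "'a \<Rightarrow> 'a \<Rightarrow> 'b::comm_ring_1" where
  "delta v u = (if u = v then 1 else 0)"

text \<open>The entry of p(A) at (u, v). For a monomial this is \<open>W k u v\<close>, the number
  of walks of length k from u to v.\<close>

definition PA :: "int poly \<Rightarrow> 'a \<Rightarrow> 'a \<Rightarrow> int" where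
  "PA p u v = polyop adj p (delta v) u"

definition W :: "nat \<Rightarrow> 'a \<Rightarrow> 'a \<Rightarrow> int" where
  "W k = PA (monom 1 k)"

sublocale adj: linear_op "adj :: ('a \<Rightarrow> 'b::comm_ring_1) \<Rightarrow> 'a \<Rightarrow> 'b"
  by unfold_locales (auto simp: adj_def fun_eq_iff sum.distrib sum_distrib_left)

lemma adj_conv_sum: "v \<in> V \<Longrightarrow> adj f v = (\<Sum>w\<in>V. if w \<in> N v then f w else 0)"
proof -
  assume v: "v \<in> V"
  then have "V \<inter> N v = N v" using N_subset by blast
  then show ?thesis
    using v sum.inter_restrict[OF finite_V, of f "N v"] by (simp add: adj_def)
qed

lemma adj_supp: "v \<notin> V \<Longrightarrow> adj f v = 0"
  by (simp add: adj_def)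

lemma adj_self_adjoint:
  "(\<Sum>v\<in>V. adj f v * g v) = (\<Sum>v\<in>V. f v * (adj g v :: 'b::comm_ring_1))"
proof -
  have "(\<Sum>v\<in>V. adj f v * g v) = (\<Sum>v\<in>V. \<Sum>w\<in>V. (if w \<in> N v then f w * g v else 0))"
    by (intro sum.cong refl) (auto simp: adj_conv_sum sum_distrib_right intro!: sum.cong)
  also have "\<dots> = (\<Sum>w\<in>V. \<Sum>v\<in>V. (if v \<in> N w then f w * g v else 0))"
    by (subst sum.swap) (auto simp: N_commute intro!: sum.cong)
  also have "\<dots> = (\<Sum>v\<in>V. f v * adj g v)"
    by (intro sum.cong refl) (auto simp: adj_conv_sum sum_distrib_left intro!: sum.cong)
  finally show ?thesis .
qed

lemma polyop_self_adjoint: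
  "(\<Sum>v\<in>V. polyop adj p f v * g v) = (\<Sum>v\<in>V. f v * polyop adj p g v)"
proof (induction p arbitrary: f)
  case (pCons a p)
  have "(\<Sum>v\<in>V. polyop adj (pCons a p) f v * g v)
     = (\<Sum>v\<in>V. a * (f v * g v)) + (\<Sum>v\<in>V. polyop adj p (adj f) v * g v)"
    by (simp add: adj.polyop_commute algebra_simps sum.distrib)
  also have "(\<Sum>v\<in>V. polyop adj p (adj f) v * g v) = (\<Sum>v\<in>V. f v * adj (polyop adj p g) v)"
    by (simp add: pCons adj_self_adjoint)
  finally show ?case by (simp add: algebra_simps sum.distrib)
qed simp

lemma sum_delta_left: "v \<in> V \<Longrightarrow> (\<Sum>w\<in>V. delta v w * f w) = f v"
  "v \<in> V \<Longrightarrow> (\<Sum>w\<in>V. f w * delta v w) = f v"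
proof -
  assume v: "v \<in> V"
  have "(\<Sum>w\<in>V. delta v w * f w) = (\<Sum>w\<in>V. if w = v then f w else 0)"
    by (intro sum.cong refl) (simp add: delta_def)
  then show "(\<Sum>w\<in>V. delta v w * f w) = f v" using v finite_V by simp
  then show "(\<Sum>w\<in>V. f w * delta v w) = f v" by (simp add: mult.commute)
qed

lemma PA_sym:
  assumes "u \<in> V" "v \<in> V"
  shows "PA p u v = PA p v u"
  using polyop_self_adjoint[of p "delta v" "delta u"] assms
  by (simp add: PA_def sum_delta_left)

lemma polyop_conv_PA:
  assumes "u \<in> V"
  shows "polyop adj p f u = (\<Sum>w\<in>V. PA p u w * f w)"
proof -
  have "polyop adj p f u = (\<Sum>v\<in>V. delta u v * polyop adj p f v)"
    using assms by (simp add: sum_delta_left)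
  also have "\<dots> = (\<Sum>w\<in>V. PA p w u * f w)"
    by (simp add: PA_def flip: polyop_self_adjoint)
  finally show ?thesis using assms PA_sym by simp
qed

lemma PA_mult:
  assumes "u \<in> V"
  shows "PA (p * q) u v = (\<Sum>w\<in>V. PA p u w * PA q w v)"
  unfolding PA_def[of "p * q"] adj.polyop_mult
  using polyop_conv_PA[OF assms, of p "polyop adj q (delta v)"] by (simp add: PA_def)

lemma PA_0 [simp]: "PA 0 u v = 0"
  by (simp add: PA_def)

lemma PA_pCons:
  "u \<in> V \<Longrightarrow> PA (pCons a p) u v = a * delta v u + (\<Sum>w\<in>N u. PA p w v)"
  by (simp add: PA_def adj_def)

lemma PA_add: "PA (p + q) u v = PA p u v + PA q u v"
  by (simp add: PA_def adj.polyop_add)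

lemma PA_diff: "PA (p - q) u v = PA p u v - PA q u v"
  by (simp add: PA_def adj.polyop_diff)

lemma PA_smult: "PA (Polynomial.smult c p) u v = c * PA p u v"
  by (simp add: PA_def adj.polyop_smult)

text \<open>With \<open>W_expand\<close> the simplifier turns \<^term>\<open>PA p\<close> for an explicit polynomial \<open>p\<close> into walk counts.\<close>

definition PA_from :: "nat \<Rightarrow> int poly \<Rightarrow> 'a \<Rightarrow> 'a \<Rightarrow> int" where
  "PA_from k p = PA (monom 1 k * p)"

lemma PA_from_0: "PA_from k 0 u v = 0"
  by (simp add: PA_from_def)

lemma PA_from_pCons: "PA_from k (pCons a p) u v = a * W k u v + PA_from (Suc k) p u v"
proof -
  have "monom 1 k * pCons a p = Polynomial.smult a (monom 1 k) + monom 1 (Suc k) * p"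
    by (simp add: monom_Suc)
  then show ?thesis
    by (simp add: PA_from_def W_def PA_add PA_smult)
qed

lemma PA_conv_from: "PA p u v = PA_from 0 p u v"
  by (simp add: PA_from_def)

lemmas W_expand = PA_conv_from PA_from_pCons PA_from_0

lemma W_0: "W 0 u v = (if u = v then 1 else 0)"
  by (simp add: W_def PA_def delta_def one_pCons)

lemma W_Suc: "u \<in> V \<Longrightarrow> W (Suc k) u v = (\<Sum>w\<in>N u. W k w v)"
  by (simp add: W_def monom_Suc PA_pCons)

lemma W_add: "u \<in> V \<Longrightarrow> W (j + k) u v = (\<Sum>w\<in>V. W j u w * W k w v)"
  by (simp add: W_def mult_monom flip: PA_mult)

lemma W_sym: "u \<in> V \<Longrightarrow> v \<in> V \<Longrightarrow> W k u v = W k v u"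
  by (simp add: W_def PA_sym)

lemma W_nonneg: "u \<in> V \<Longrightarrow> v \<in> V \<Longrightarrow> W k u v \<ge> 0"
  by (induction k arbitrary: u) (auto simp: W_0 W_Suc intro!: sum_nonneg dest: N_in_V)

lemma W_1: "u \<in> V \<Longrightarrow> W 1 u v = (if v \<in> N u then 1 else 0)"
proof -
  assume "u \<in> V"
  then have "W (Suc 0) u v = (\<Sum>w\<in>N u. if w = v then 1 else 0)"
    by (simp only: W_Suc W_0)
  then show ?thesis using finite_N[OF \<open>u \<in> V\<close>] by simp
qed

lemma W_Suc_right: "u \<in> V \<Longrightarrow> v \<in> V \<Longrightarrow> W (Suc k) u v = (\<Sum>w\<in>N v. W k u w)"
proof -
  assume *: "u \<in> V" "v \<in> V"
  have "W (Suc k) u v = (\<Sum>w\<in>N v. W k w u)"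
    using * W_sym[of u v "Suc k"] W_Suc[of v k u] by simp
  also have "\<dots> = (\<Sum>w\<in>N v. W k u w)"
    using * N_in_V by (intro sum.cong refl) (rule W_sym, auto)
  finally show ?thesis .
qed

lemma W_2: "u \<in> V \<Longrightarrow> v \<in> V \<Longrightarrow> W 2 u v = int (card (N u \<inter> N v))"
proof -
  assume *: "u \<in> V" "v \<in> V"
  have "W 2 u v = (\<Sum>w\<in>N u. W 1 w v)"
    using W_Suc[OF *(1), of 1 v] by (simp only: Suc_1)
  also have "\<dots> = (\<Sum>w\<in>N u. if w \<in> N v then 1 else 0)"
  proof (intro sum.cong refl)
    fix w assume "w \<in> N u"
    then have "w \<in> V" using * N_in_V by blast
    then show "W 1 w v = (if w \<in> N v then 1 else 0)"
      using W_1[of w v] N_commute[of w v] * by (simp only:)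
  qed
  also have "\<dots> = int (card (N u \<inter> N v))"
    using sum.inter_restrict[OF finite_N[OF *(1)], of "\<lambda>_. 1 :: int" "N v"] by simp
  finally show ?thesis .
qed

lemma W_2_refl: "u \<in> V \<Longrightarrow> W 2 u u = 3"
  by (simp add: W_2 card_N)

lemma W_row_sum:
  assumes "u \<in> V"
  shows "(\<Sum>v\<in>V. PA p u v) = poly p 3"
proof -
  have "adj (\<lambda>x. if x \<in> V then 1 else 0) = (\<lambda>x. 3 * (if x \<in> V then 1 else 0 :: int))"
    using N_subset by (auto simp: adj_def fun_eq_iff card_N subset_eq cong: sum.cong)
  from adj.polyop_eigen[OF this, of p]
  have "polyop adj p (\<lambda>x. if x \<in> V then 1 else 0) u = poly p 3"
    using assms by (simp add: fun_eq_iff)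
  then show ?thesis
    using polyop_conv_PA[OF assms, of p "\<lambda>x. if x \<in> V then 1 else 0"] by (simp cong: sum.cong)
qed

text \<open>Maximum principle for two-step walks: where \<open>f\<close> is maximal on
  \<open>C\<close>, the average over the nine two-step walks equals the maximum, so all their ends
  are maximal too. The set of maximal points is therefore closed, and \<open>min\<close> makes it
  all of \<open>C\<close>.\<close>

lemma two_step_harmonic:
  fixes f :: "'a \<Rightarrow> int"
  assumes C: "C \<subseteq> V" and closed: "\<And>u v w. u \<in> C \<Longrightarrow> v \<in> N u \<Longrightarrow> w \<in> N v \<Longrightarrow> w \<in> C"
    and min: "\<And>D. D \<subseteq> C \<Longrightarrow> D \<noteq> {} \<Longrightarrow> (\<And>u v w. u \<in> D \<Longrightarrow> v \<in> N u \<Longrightarrow> w \<in> N v \<Longrightarrow> w \<in> D) \<Longrightarrow> D = C"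
    and harm: "\<And>u. u \<in> C \<Longrightarrow> (\<Sum>v\<in>N u. \<Sum>w\<in>N v. f w) = 9 * f u"
    and "x \<in> C" "y \<in> C"
  shows "f x = f y"
proof -
  have fin: "finite C" using C finite_V finite_subset by blast
  define m where "m = Max (f ` C)"
  have le: "f u \<le> m" if "u \<in> C" for u
    using fin that by (simp add: m_def)
  define D where "D = {u \<in> C. f u = m}"
  have "m \<in> f ` C"
    unfolding m_def using fin \<open>x \<in> C\<close> by (intro Max_in) auto
  then have "D \<noteq> {}" by (auto simp: D_def)
  moreover have step: "w \<in> D" if "u \<in> D" "v \<in> N u" "w \<in> N v" for u v w
  proof -
    have u: "u \<in> C" "f u = m" "u \<in> V" using that C by (auto simp: D_def)
    have nn: "0 \<le> m - f w" if "v \<in> N u" "w \<in> N v" for v w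
      using le closed[OF u(1) that] by simp
    have "(\<Sum>v\<in>N u. \<Sum>w\<in>N v. (m - f w)) = 0"
    proof -
      have "(\<Sum>v\<in>N u. \<Sum>w\<in>N v. (m - f w)) = (\<Sum>v\<in>N u. 3 * m - (\<Sum>w\<in>N v. f w))"
        using u(3) N_in_V card_N by (intro sum.cong refl) (simp add: sum_subtractf)
      also have "\<dots> = 9 * m - 9 * f u"
        using harm[OF u(1)] u(3) card_N by (simp add: sum_subtractf)
      finally show ?thesis using u by simp
    qed
    moreover have "0 \<le> (\<Sum>w\<in>N x. (m - f w))" if "x \<in> N u" for x
      using that nn by (intro sum_nonneg)
    ultimately have "\<forall>v\<in>N u. (\<Sum>w\<in>N v. (m - f w)) = 0"
      by (intro sum_nonneg_eq_0_iff[OF finite_N[OF u(3)], THEN iffD1])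
    then have "(\<Sum>w\<in>N v. (m - f w)) = 0" using that(2) by (rule bspec)
    moreover have "finite (N v)"
      using that(2) by (intro finite_N N_in_V[OF u(3)])
    ultimately have "\<forall>w\<in>N v. m - f w = 0"
      using nn[OF that(2)] by (intro sum_nonneg_eq_0_iff[THEN iffD1])
    then have "m - f w = 0" using that(3) by (rule bspec)
    then show ?thesis using closed[OF u(1) that(2,3)] by (simp add: D_def)
  qed
  moreover have "D \<subseteq> C" by (simp add: D_def)
  ultimately have "D = C" by (intro min)
  then have "x \<in> D" "y \<in> D" using \<open>x \<in> C\<close> \<open>y \<in> C\<close> by simp_all
  then show ?thesis by (simp add: D_def)
qed

end

section \<open>Integral cubic graphs\<close>

context cubic_graph
begin

text \<open>Two tokens on distinct vertices, each moving along an edge to a vertex not held by the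
  other. The transposition of the two occupied vertices exchanges the tokens, which a symmetric
  function does not notice; hence that move is left out.\<close>

definition L2 :: "('a \<Rightarrow> 'a \<Rightarrow> 'b::comm_ring_1) \<Rightarrow> 'a \<Rightarrow> 'a \<Rightarrow> 'b" where
  "L2 f i j = (if i \<in> V \<and> j \<in> V \<and> i \<noteq> j
     then (\<Sum>k\<in>N i - {j}. f i j - f k j) + (\<Sum>k\<in>N j - {i}. f i j - f i k) else 0)"

definition mu :: "int poly" where
  "mu = [:0, -36, 0, 49, 0, -14, 0, 1:]"

lemma polyop_of_int:
  "polyop adj (map_poly of_int p) (\<lambda>x. of_int (f x)) u = (of_int (polyop adj p f u) :: complex)"
proof (induction p arbitrary: u)
  case (pCons a p)
  have "adj (\<lambda>x. of_int (g x)) u = (of_int (adj g u) :: complex)" for g :: "'a \<Rightarrow> int"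
    by (simp add: adj_def)
  moreover have "polyop adj (map_poly of_int p) (\<lambda>x. of_int (f x)) = (\<lambda>u. of_int (polyop adj p f u) :: complex)"
    using pCons.IH by (rule ext)
  ultimately show ?case
    unfolding of_int_hom.map_poly_pCons_hom adj.polyop_pCons by simp
qed simp

lemma polyop_supp:
  assumes "\<forall>x. x \<notin> V \<longrightarrow> f x = 0"
  shows "\<forall>x. x \<notin> V \<longrightarrow> polyop adj p f x = 0"
  by (rule adj.polyop_closed) (use assms in \<open>auto simp: adj_supp\<close>)

text \<open>Compare both sides of the eigenvalue equation at a vertex where the modulus of
  \<open>h\<close> is largest.\<close>

lemma adj_eigenvalue_bound:
  fixes k :: complex
  assumes "adj h = (\<lambda>v. k * h v)" "h \<noteq> (\<lambda>_. 0)" "\<forall>x. x \<notin> V \<longrightarrow> h x = 0"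
  shows "cmod k \<le> 3"
proof -
  obtain v where v: "v \<in> V" "\<And>u. u \<in> V \<Longrightarrow> cmod (h u) \<le> cmod (h v)"
    using finite_V V_nonempty ex_is_arg_min_if_finite[of V "\<lambda>u. - cmod (h u)"]
    unfolding is_arg_min_linorder by auto
  have pos: "cmod (h v) > 0"
  proof (rule ccontr)
    assume "\<not> cmod (h v) > 0"
    then have "h u = 0" for u
      using v(2)[of u] assms(3) by (cases "u \<in> V") auto
    then show False using assms(2) by auto
  qed
  have "cmod k * cmod (h v) = cmod (\<Sum>w\<in>N v. h w)"
    using v(1) fun_cong[OF assms(1), of v] by (simp add: adj_def norm_mult)
  also have "\<dots> \<le> (\<Sum>w\<in>N v. cmod (h v))"
    using v N_in_V by (intro norm_sum[THEN order_trans] sum_mono) auto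
  also have "\<dots> = 3 * cmod (h v)" using v by (simp add: card_N)
  finally show ?thesis using pos by simp
qed

end

locale integral_cubic = cubic_graph +
  assumes adj_integral: "adj f = (\<lambda>v. k * f v) \<Longrightarrow> f \<noteq> (\<lambda>_. 0) \<Longrightarrow> (k :: complex) \<in> \<int>"
    and L2_integral: "(\<And>i j. g i j = g j i) \<Longrightarrow> (\<And>i j. L2 g i j = k * g i j) \<Longrightarrow>
      g \<noteq> (\<lambda>_ _. 0) \<Longrightarrow> (k :: complex) \<in> \<int>"
begin

text \<open>\<open>mu\<close> is squarefree and A symmetric, so A satisfies \<open>mu\<close> once
  every eigenvalue is a root. Diagonalisation is avoided: if mu(A) applied to \<open>e\<close> were
  nonzero, some h = q(A) mu(A) e would be an eigenvector, and moving mu(A) to the other side of the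
  inner product shows that h is orthogonal to itself.\<close>

lemma PA_mu:
  assumes "v \<in> V"
  shows "PA mu u v = 0"
proof (rule ccontr)
  assume nz: "PA mu u v \<noteq> 0"
  define M where "M = (map_poly of_int mu :: complex poly)"
  define e :: "'a \<Rightarrow> complex" where "e = delta v"
  have e: "e = (\<lambda>x. of_int (delta v x))" by (auto simp: e_def delta_def)
  have supp_e: "\<forall>x. x \<notin> V \<longrightarrow> e x = 0" using assms by (auto simp: e_def delta_def)
  define g where "g = polyop adj M e"
  have "g u = of_int (PA mu u v)"
    unfolding g_def M_def e by (simp add: polyop_of_int PA_def)
  then have "g \<noteq> (\<lambda>_. 0)" using nz by (metis of_int_eq_0_iff)
  have supp_g: "\<forall>x. x \<notin> V \<longrightarrow> g x = 0" unfolding g_def by (rule polyop_supp[OF supp_e])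
  have lin: "linear_op (adj :: ('a \<Rightarrow> complex) \<Rightarrow> _)" by (rule adj.linear_op_axioms)
  have sup: "\<forall>x. x \<notin> V \<longrightarrow> adj f x = 0" for f :: "'a \<Rightarrow> complex" by (simp add: adj_supp)
  obtain p where p: "p \<noteq> 0" "polyop adj p g = (\<lambda>_. 0)"
    using exists_annihilating_poly[OF lin finite_V _ supp_g] sup by blast
  obtain k q where kq: "polyop adj q g \<noteq> (\<lambda>_. 0)" "adj (polyop adj q g) = (\<lambda>x. k * polyop adj q g x)"
    using eigenvector_of_annihilating_poly[OF lin p \<open>g \<noteq> (\<lambda>_. 0)\<close>] by blast
  define h where "h = polyop adj q g"
  have h: "h \<noteq> (\<lambda>_. 0)" "adj h = (\<lambda>x. k * h x)" using kq by (simp_all add: h_def)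
  have supp_h: "\<forall>x. x \<notin> V \<longrightarrow> h x = 0" unfolding h_def by (rule polyop_supp[OF supp_g])
  have "k \<in> \<int>" using adj_integral h by blast
  then obtain z where z: "k = of_int z" by (elim Ints_cases)
  have "\<bar>z\<bar> \<le> 3" using adj_eigenvalue_bound[OF h(2,1) supp_h] by (simp add: z)
  then have "z \<in> {-3, -2, -1, 0, 1, 2, 3}" by auto
  then have root: "poly M k = 0"
    unfolding M_def mu_def z by (auto simp: map_poly_pCons)
  \<comment> \<open>\<open>k\<close> is a real number, so the conjugate of \<open>h\<close> belongs
    to the same eigenvalue and is annihilated by mu(A).\<close>
  have cnj: "adj (\<lambda>x. cnj (h x)) = (\<lambda>x. k * cnj (h x))"
  proof
    fix x
    have "adj (\<lambda>x. cnj (h x)) x = cnj (adj h x)" by (simp add: adj_def)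
    also have "\<dots> = k * cnj (h x)" by (simp add: h(2) z)
    finally show "adj (\<lambda>x. cnj (h x)) x = k * cnj (h x)" .
  qed
  have "h = polyop adj M (polyop adj q e)"
    unfolding h_def g_def by (simp add: mult.commute flip: adj.polyop_mult)
  then have "(\<Sum>x\<in>V. h x * cnj (h x)) = (\<Sum>x\<in>V. polyop adj q e x * polyop adj M (\<lambda>x. cnj (h x)) x)"
    by (metis polyop_self_adjoint)
  also have "\<dots> = 0" by (simp add: adj.polyop_eigen[OF cnj] root)
  finally have "of_real (\<Sum>x\<in>V. (cmod (h x))\<^sup>2) = (0 :: complex)"
    unfolding of_real_sum complex_norm_square .
  then have "(\<Sum>x\<in>V. (cmod (h x))\<^sup>2) = 0" by (simp only: of_real_eq_0_iff)
  then have "\<forall>x\<in>V. h x = 0" using finite_V by (simp add: sum_nonneg_eq_0_iff)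
  with supp_h have "h = (\<lambda>_. 0)" by auto
  with h show False by simp
qed

text \<open>Entries of p(A) depend on \<open>p\<close> only modulo \<open>mu\<close>. At each use
  the witness \<open>r\<close> is the quotient in the division by \<open>mu\<close>.\<close>

lemma PA_mod_mu:
  assumes "u \<in> V" "v \<in> V" "p - q = r * mu"
  shows "PA p u v = PA q u v"
proof -
  have "PA (p - q) u v = 0" unfolding assms(3) PA_mult[OF assms(1)] by (simp add: PA_mu assms)
  then show ?thesis by (simp add: PA_diff)
qed

end

section \<open>Even and odd walk classes\<close>

context cubic_graph
begin

definition two_step :: "('a \<times> 'a) set" where
  "two_step = {(x, z). x \<in> V \<and> (\<exists>y\<in>N x. z \<in> N y)}"

text \<open>\<open>Ev v\<close> and \<open>Od v\<close> collect the ends of even and of odd walks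
  from \<open>v\<close>: the two sides of a bipartite graph, and twice the set \<open>V\<close>
  otherwise. Formulas in terms of these classes hold in both cases.\<close>

definition Ev :: "'a \<Rightarrow> 'a set" where
  "Ev v = {u. (v, u) \<in> two_step\<^sup>*}"

definition Od :: "'a \<Rightarrow> 'a set" where
  "Od v = (\<Union>u\<in>Ev v. N u)"

lemma Ev_refl: "v \<in> Ev v"
  by (simp add: Ev_def)

lemma Ev_subset: "v \<in> V \<Longrightarrow> Ev v \<subseteq> V"
proof
  fix u assume "v \<in> V" "u \<in> Ev v"
  from this(2) show "u \<in> V"
    unfolding Ev_def mem_Collect_eq
  proof (induction rule: rtrancl_induct)
    case (step y z)
    then show ?case unfolding two_step_def using N_in_V by blast
  qed (fact \<open>v \<in> V\<close>)
qed

lemma Ev_step: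
  assumes "v \<in> V" "u \<in> Ev v" "x \<in> N u" "w \<in> N x"
  shows "w \<in> Ev v"
proof -
  have "u \<in> V" using Ev_subset assms by blast
  then have "(u, w) \<in> two_step"
    using assms unfolding two_step_def by blast
  with assms(2) show ?thesis
    unfolding Ev_def mem_Collect_eq by (rule rtrancl_into_rtrancl)
qed

lemma Ev_sym: "v \<in> V \<Longrightarrow> u \<in> Ev v \<Longrightarrow> v \<in> Ev u"
proof -
  assume v: "v \<in> V" and "u \<in> Ev v"
  from this(2) show "v \<in> Ev u"
    unfolding Ev_def mem_Collect_eq
  proof (induction rule: rtrancl_induct)
    case (step y z)
    then obtain x where x: "y \<in> V" "x \<in> N y" "z \<in> N x"
      unfolding two_step_def by blast
    then have "x \<in> V" "z \<in> V" using N_in_V by blast+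
    then have "x \<in> N z" "y \<in> N x" using x N_sym by blast+
    then have "(z, y) \<in> two_step"
      using \<open>z \<in> V\<close> unfolding two_step_def by blast
    then show ?case using step.IH by (rule converse_rtrancl_into_rtrancl)
  qed simp
qed

lemma Ev_eq: "v \<in> V \<Longrightarrow> u \<in> Ev v \<Longrightarrow> Ev u = Ev v"
proof -
  assume *: "v \<in> V" "u \<in> Ev v"
  then have "v \<in> Ev u" by (rule Ev_sym)
  with * show ?thesis unfolding Ev_def by (auto intro: rtrancl_trans)
qed

lemma Ev_minimal:
  assumes "v \<in> V" "D \<subseteq> Ev v" "D \<noteq> {}"
    "\<And>u x w. u \<in> D \<Longrightarrow> x \<in> N u \<Longrightarrow> w \<in> N x \<Longrightarrow> w \<in> D"
  shows "D = Ev v"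
proof -
  obtain u where u: "u \<in> D" "u \<in> Ev v" using assms by blast
  have "w \<in> D" if "w \<in> Ev u" for w
    using that unfolding Ev_def mem_Collect_eq
  proof (induction rule: rtrancl_induct)
    case (step y z)
    then show ?case using assms(4) unfolding two_step_def by blast
  qed (fact u(1))
  then show ?thesis using Ev_eq[OF assms(1) u(2)] assms(2) by blast
qed

lemma Od_subset: "v \<in> V \<Longrightarrow> Od v \<subseteq> V"
  unfolding Od_def using Ev_subset N_subset by blast

lemma N_Ev: "u \<in> Ev v \<Longrightarrow> x \<in> N u \<Longrightarrow> x \<in> Od v"
  unfolding Od_def by blast

lemma N_Od: "v \<in> V \<Longrightarrow> u \<in> Od v \<Longrightarrow> x \<in> N u \<Longrightarrow> x \<in> Ev v"
  unfolding Od_def using Ev_step by blast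

lemma N_Ev_iff: "v \<in> V \<Longrightarrow> u \<in> V \<Longrightarrow> x \<in> N u \<Longrightarrow> x \<in> Od v \<longleftrightarrow> u \<in> Ev v"
  using N_Ev N_Od N_sym by blast

lemma N_Od_iff: "v \<in> V \<Longrightarrow> u \<in> V \<Longrightarrow> x \<in> N u \<Longrightarrow> x \<in> Ev v \<longleftrightarrow> u \<in> Od v"
  using N_Ev N_Od N_sym N_in_V by blast

lemma Ev_Un_Od: "v \<in> V \<Longrightarrow> Ev v \<union> Od v = V"
proof (rule connectedness)
  assume v: "v \<in> V"
  show "Ev v \<union> Od v \<subseteq> V" using Ev_subset Od_subset v by blast
  show "Ev v \<union> Od v \<noteq> {}" using Ev_refl by blast
  show "N u \<subseteq> Ev v \<union> Od v" if "u \<in> Ev v \<union> Od v" for u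
    using that v N_Ev N_Od by blast
qed

text \<open>A step exchanges the two classes, so their intersection is closed under neighbours and
  connectedness leaves only the empty set and \<open>V\<close>.\<close>

lemma Ev_Int_Od: "v \<in> V \<Longrightarrow> Ev v \<inter> Od v \<noteq> {} \<Longrightarrow> Ev v = V \<and> Od v = V"
proof -
  assume v: "v \<in> V" and ne: "Ev v \<inter> Od v \<noteq> {}"
  have "Ev v \<inter> Od v = V"
  proof (rule connectedness)
    show "Ev v \<inter> Od v \<subseteq> V" using Ev_subset v by blast
    show "N u \<subseteq> Ev v \<inter> Od v" if "u \<in> Ev v \<inter> Od v" for u
      using that v N_Ev N_Od by blast
  qed (fact ne)
  then show ?thesis using Ev_subset Od_subset v by blast
qed

definition bip :: bool where
  "bip \<longleftrightarrow> (\<forall>v\<in>V. Ev v \<inter> Od v = {})"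

lemma not_bip: "\<not> bip \<Longrightarrow> v \<in> V \<Longrightarrow> Ev v = V \<and> Od v = V"
proof -
  assume "\<not> bip" and v: "v \<in> V"
  then obtain x where x: "x \<in> V" "Ev x = V" using Ev_Int_Od unfolding bip_def by blast
  then have "Ev v = V" using Ev_eq[of x v] v by simp
  moreover have "Od v = V"
  proof -
    have "u \<in> Od v" if "u \<in> V" for u
    proof -
      have "N u \<noteq> {}" using card_N[OF that] by auto
      then obtain w where w: "w \<in> N u" by blast
      then show ?thesis unfolding Od_def \<open>Ev v = V\<close> using that N_sym N_in_V by blast
    qed
    then show ?thesis using Od_subset v by blast
  qed
  ultimately show ?thesis ..
qed

lemma bip_disjoint: "bip \<Longrightarrow> v \<in> V \<Longrightarrow> Ev v \<inter> Od v = {}"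
  unfolding bip_def by blast

lemma W_parity:
  assumes "v \<in> V" "u \<in> V"
  shows "u \<notin> Ev v \<Longrightarrow> W (2 * k) u v = 0" and "u \<notin> Od v \<Longrightarrow> W (Suc (2 * k)) u v = 0"
proof -
  have "(u \<notin> Ev v \<longrightarrow> W (2 * k) u v = 0) \<and> (u \<notin> Od v \<longrightarrow> W (Suc (2 * k)) u v = 0)"
    using assms(2)
  proof (induction k arbitrary: u)
    case 0
    then have "W (Suc 0) u v = 0" if "u \<notin> Od v"
      using that Ev_refl[of v] N_Ev[of v v u] N_sym[of u v] W_1[of u v] by auto
    with 0 show ?case using Ev_refl[of v] by (auto simp: W_0)
  next
    case (Suc k)
    have "W (Suc (Suc m)) u v = (\<Sum>x\<in>N u. \<Sum>w\<in>N x. W m w v)" for m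
      using Suc.prems N_in_V[OF Suc.prems] by (simp add: W_Suc cong: sum.cong)
    moreover have "w \<notin> Ev v" if "u \<notin> Ev v" "x \<in> N u" "w \<in> N x" for x w
      using that Suc.prems N_in_V N_Od_iff[OF assms(1)] N_Ev_iff[OF assms(1)] by blast
    moreover have "w \<notin> Od v" if "u \<notin> Od v" "x \<in> N u" "w \<in> N x" for x w
      using that Suc.prems N_in_V N_Od_iff[OF assms(1)] N_Ev_iff[OF assms(1)] by blast
    moreover have "w \<in> V" if "x \<in> N u" "w \<in> N x" for x w
      using that Suc.prems N_in_V by blast
    ultimately show ?case using Suc.IH by (auto intro!: sum.neutral)
  qed
  then show "u \<notin> Ev v \<Longrightarrow> W (2 * k) u v = 0" "u \<notin> Od v \<Longrightarrow> W (Suc (2 * k)) u v = 0"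
    by blast+
qed

lemma W_even_0: assumes "v \<in> V" "u \<in> V" "u \<notin> Ev v"
  shows "W 0 u v = 0" "W 2 u v = 0" "W 4 u v = 0" "W 6 u v = 0"
  using W_parity(1)[OF assms, of 0] W_parity(1)[OF assms, of 1] W_parity(1)[OF assms, of 2]
    W_parity(1)[OF assms, of 3] by simp_all

lemma W_odd_0: assumes "v \<in> V" "u \<in> V" "u \<notin> Od v"
  shows "W 1 u v = 0" "W 3 u v = 0" "W 5 u v = 0"
  using W_parity(2)[OF assms, of 0] W_parity(2)[OF assms, of 1] W_parity(2)[OF assms, of 2]
  by (simp_all add: eval_nat_numeral)

text \<open>\<open>Od v\<close> is the even class of any neighbour of \<open>v\<close>, so
  minimality carries over.\<close>

lemma Od_minimal:
  assumes "v \<in> V" "D \<subseteq> Od v" "D \<noteq> {}"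
    "\<And>u x w. u \<in> D \<Longrightarrow> x \<in> N u \<Longrightarrow> w \<in> N x \<Longrightarrow> w \<in> D"
  shows "D = Od v"
proof -
  obtain y where y: "y \<in> N v" using card_N[OF assms(1)] by fastforce
  have yV: "y \<in> V" using y assms(1) N_in_V by blast
  have yv: "v \<in> N y" using y assms(1) N_sym by blast
  have "Ev y = Od v"
  proof
    show "Ev y \<subseteq> Od v"
    proof
      fix w assume "w \<in> Ev y"
      then show "w \<in> Od v" unfolding Ev_def mem_Collect_eq
      proof (induction rule: rtrancl_induct)
        case base
        then show ?case using N_Ev[OF Ev_refl y] .
      next
        case (step a b)
        then show ?case using N_Ev N_Od[OF assms(1)] unfolding two_step_def by blast
      qed
    qed
    show "Od v \<subseteq> Ev y"
    proof
      fix w assume "w \<in> Od v"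
      then obtain u where u: "u \<in> Ev v" "w \<in> N u" unfolding Od_def by blast
      have "u \<in> Od y" using u(1) unfolding Ev_def mem_Collect_eq
      proof (induction rule: rtrancl_induct)
        case base
        then show ?case using N_Ev[OF Ev_refl yv] .
      next
        case (step a b)
        then show ?case using N_Ev N_Od[OF yV] unfolding two_step_def by blast
      qed
      then show "w \<in> Ev y" using u N_Od yV by blast
    qed
  qed
  then show ?thesis using Ev_minimal[OF yV, of D] assms by simp
qed

text \<open>x^2 (x^2 - 1)(x^2 - 4) and its quotient by x. The odd companion is there because in a
  bipartite graph an even polynomial says nothing about vertices on opposite sides.\<close>

definition Qp :: "int poly" where "Qp = [:0, 0, 4, 0, -5, 0, 1:]"
definition Mp :: "int poly" where "Mp = [:0, 4, 0, -5, 0, 1:]"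

end

context integral_cubic
begin

lemma PA_two_steps: "u \<in> V \<Longrightarrow> (\<Sum>x\<in>N u. \<Sum>w\<in>N x. PA p w v) = PA ([:0, 0, 1:] * p) u v"
proof -
  assume u: "u \<in> V"
  have "[:0, 0, 1:] * p = pCons 0 (pCons 0 p)" by simp
  then show ?thesis using u N_in_V[OF u] by (simp add: PA_pCons cong: sum.cong)
qed

text \<open>\<open>mu\<close> is (x^2 - 9) times \<open>Mp\<close>, so the columns of Qp(A) and
  Mp(A) are eigenfunctions of A^2 for 9 and hence constant on a walk class. The row sums Qp(3) = 360
  and Mp(3) = 120 tie the constants to the class size, which becomes a divisor of 120.\<close>

lemma walk_classes:
  assumes "v \<in> V"
  obtains m where "m * int (card (Ev v)) = 120" "card (Od v) = card (Ev v)"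
    "\<And>u. u \<in> V \<Longrightarrow> PA Qp u v = (if u \<in> Ev v then 3 * m else 0)"
    "\<And>u. u \<in> V \<Longrightarrow> PA Mp u v = (if u \<in> Od v then m else 0)"
proof -
  have Q9: "PA ([:0, 0, 1:] * Qp) u v = 9 * PA Qp u v" if "u \<in> V" for u
  proof -
    have "PA ([:0, 0, 1:] * Qp) u v = PA (Polynomial.smult 9 Qp) u v"
      by (rule PA_mod_mu[OF that assms, of _ _ "[:0, 1:]"]) (simp add: Qp_def mu_def)
    then show ?thesis by (simp add: PA_smult)
  qed
  have M9: "PA ([:0, 0, 1:] * Mp) u v = 9 * PA Mp u v" if "u \<in> V" for u
  proof -
    have "PA ([:0, 0, 1:] * Mp) u v = PA (Polynomial.smult 9 Mp) u v"
      by (rule PA_mod_mu[OF that assms, of _ _ "1"]) (simp add: Mp_def mu_def)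
    then show ?thesis by (simp add: PA_smult)
  qed
  have Q0: "PA Qp u v = 0" if "u \<in> V" "u \<notin> Ev v" for u
    using W_even_0[OF assms that] unfolding Qp_def by (simp add: W_expand eval_nat_numeral)
  have M0: "PA Mp u v = 0" if "u \<in> V" "u \<notin> Od v" for u
    using W_odd_0[OF assms that] unfolding Mp_def by (simp add: W_expand eval_nat_numeral)
  have Qc: "PA Qp x v = PA Qp y v" if "x \<in> Ev v" "y \<in> Ev v" for x y
  proof (rule two_step_harmonic[OF Ev_subset[OF assms] Ev_step[OF assms] Ev_minimal[OF assms] _ that])
    show "(\<Sum>x\<in>N u. \<Sum>w\<in>N x. PA Qp w v) = 9 * PA Qp u v" if "u \<in> Ev v" for u
    proof -
      have "u \<in> V" using that Ev_subset assms by blast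
      then show ?thesis by (simp only: PA_two_steps Q9)
    qed
  qed
  have Mc: "PA Mp x v = PA Mp y v" if "x \<in> Od v" "y \<in> Od v" for x y
  proof (rule two_step_harmonic[OF Od_subset[OF assms] _ Od_minimal[OF assms] _ that])
    show "(\<Sum>x\<in>N u. \<Sum>w\<in>N x. PA Mp w v) = 9 * PA Mp u v" if "u \<in> Od v" for u
    proof -
      have "u \<in> V" using that Od_subset assms by blast
      then show ?thesis by (simp only: PA_two_steps M9)
    qed
    show "w \<in> Od v" if "u \<in> Od v" "x \<in> N u" "w \<in> N x" for u x w
      using N_Ev N_Od assms that by blast
  qed
  obtain y where y: "y \<in> N v" using card_N[OF assms] by fastforce
  define m where "m = PA Mp y v"
  have yO: "y \<in> Od v" using N_Ev[OF Ev_refl y] .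
  have M: "PA Mp u v = (if u \<in> Od v then m else 0)" if "u \<in> V" for u
    using that M0 Mc[OF _ yO] by (auto simp: m_def)
  have "PA Qp v v = 3 * m"
  proof -
    have "Qp = pCons 0 Mp" by (simp add: Qp_def Mp_def)
    then have "PA Qp v v = (\<Sum>w\<in>N v. PA Mp w v)"
      using PA_pCons[OF assms, of 0 Mp v] by (metis mult_zero_left add_0)
    also have "\<dots> = (\<Sum>w\<in>N v. m)"
      using N_in_V[OF assms] N_Ev[OF Ev_refl] by (intro sum.cong refl) (simp add: M)
    finally show ?thesis using assms by (simp add: card_N)
  qed
  then have Q: "PA Qp u v = (if u \<in> Ev v then 3 * m else 0)" if "u \<in> V" for u
    using that Q0 Qc[OF _ Ev_refl] by auto
  have sQ: "(\<Sum>u\<in>V. PA Qp u v) = 360" and sM: "(\<Sum>u\<in>V. PA Mp u v) = 120"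
    using W_row_sum[OF assms, of Qp] W_row_sum[OF assms, of Mp] PA_sym[OF _ assms]
    by (simp_all add: Qp_def Mp_def cong: sum.cong)
  have "(\<Sum>u\<in>V. PA Qp u v) = (\<Sum>u\<in>Ev v. 3 * m)"
    using Ev_subset[OF assms] finite_V by (intro sum.mono_neutral_cong_right) (auto simp: Q)
  then have e: "m * int (card (Ev v)) = 120" using sQ by (simp add: mult.commute)
  have "(\<Sum>u\<in>V. PA Mp u v) = (\<Sum>u\<in>Od v. m)"
    using Od_subset[OF assms] finite_V by (intro sum.mono_neutral_cong_right) (auto simp: M)
  then have o: "m * int (card (Od v)) = 120" using sM by (simp add: mult.commute)
  then have "card (Od v) = card (Ev v)" using e
    by (metis mult_cancel_left mult_zero_left of_nat_eq_iff zero_neq_numeral)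
  with e Q M that show thesis by blast
qed

end

section \<open>Symmetric functions of two tokens\<close>

lemma (in linear_op) polyop_conv_sum:
  "polyop L p f x = (\<Sum>k\<le>degree p. coeff p k * (L ^^ k) f x)"
proof -
  have "polyop L (\<Sum>k\<le>degree p. monom (coeff p k) k) f x = (\<Sum>k\<le>degree p. coeff p k * (L ^^ k) f x)"
    by (simp only: polyop_sum polyop_monom)
  then show ?thesis by (simp only: poly_as_sum_of_monoms)
qed

context cubic_graph
begin

lemma L2_outside: "i \<notin> V \<or> j \<notin> V \<or> i = j \<Longrightarrow> L2 f i j = 0"
  by (auto simp: L2_def)

text \<open>Only values at pairs of distinct vertices matter, and only up to a common constant. So
  the spaces used below need to be invariant only modulo constants, and values on the diagonal are
  immaterial.\<close>

lemma L2_cong: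
  assumes eq: "\<And>i j. i \<in> V \<Longrightarrow> j \<in> V \<Longrightarrow> i \<noteq> j \<Longrightarrow> f i j = g i j + c"
  shows "L2 f = L2 g"
proof (intro ext)
  fix i j
  have "(\<Sum>k\<in>N i - {j}. f i j - f k j) = (\<Sum>k\<in>N i - {j}. g i j - g k j)"
    and "(\<Sum>k\<in>N j - {i}. f i j - f i k) = (\<Sum>k\<in>N j - {i}. g i j - g i k)"
    if ij: "i \<in> V" "j \<in> V" "i \<noteq> j"
  proof -
    show "(\<Sum>k\<in>N i - {j}. f i j - f k j) = (\<Sum>k\<in>N i - {j}. g i j - g k j)"
    proof (rule sum.cong[OF refl])
      fix k assume "k \<in> N i - {j}"
      then have "k \<in> V" "k \<noteq> j" using ij N_in_V by blast+
      then show "f i j - f k j = g i j - g k j" using eq[OF ij] eq[of k j] ij by simp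
    qed
    show "(\<Sum>k\<in>N j - {i}. f i j - f i k) = (\<Sum>k\<in>N j - {i}. g i j - g i k)"
    proof (rule sum.cong[OF refl])
      fix k assume "k \<in> N j - {i}"
      then have "k \<in> V" "i \<noteq> k" using ij N_in_V by blast+
      then show "f i j - f i k = g i j - g i k" using eq[OF ij] eq[of i k] ij by simp
    qed
  qed
  then show "L2 f i j = L2 g i j" by (simp add: L2_def)
qed

lemma L2_symmetric:
  assumes "\<And>i j. i \<in> V \<Longrightarrow> j \<in> V \<Longrightarrow> f i j = f j i"
  shows "L2 f i j = L2 f j i"
proof (cases "i \<in> V \<and> j \<in> V \<and> i \<noteq> j")
  case True
  have "(\<Sum>k\<in>N i - {j}. f i j - f k j) = (\<Sum>k\<in>N i - {j}. f j i - f j k)"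
  proof (rule sum.cong[OF refl])
    fix k assume "k \<in> N i - {j}"
    then have "k \<in> V" using True N_in_V by blast
    then show "f i j - f k j = f j i - f j k"
      using assms[of i j] assms[of k j] True by simp
  qed
  moreover have "(\<Sum>k\<in>N j - {i}. f i j - f i k) = (\<Sum>k\<in>N j - {i}. f j i - f k i)"
  proof (rule sum.cong[OF refl])
    fix k assume "k \<in> N j - {i}"
    then have "k \<in> V" using True N_in_V by blast
    then show "f i j - f i k = f j i - f k i"
      using assms[of i j] assms[of i k] True by simp
  qed
  ultimately show ?thesis using True by (auto simp: L2_def)
next
  case False
  then show ?thesis by (auto simp: L2_def)
qed

text \<open>Full neighbour sums are easier to evaluate than sums with a vertex removed. For an edge
  the surplus terms are compensated, which brings in the diagonal values of
  \<open>K\<close>.\<close>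

lemma L2_formula:
  fixes K :: "'a \<Rightarrow> 'a \<Rightarrow> 'b::comm_ring_1"
  assumes "i \<in> V" "j \<in> V" "i \<noteq> j"
  shows "L2 K i j = 6 * K i j - (\<Sum>k\<in>N i. K k j) - (\<Sum>k\<in>N j. K i k)
    + (if j \<in> N i then K i i + K j j - 2 * K i j else 0)"
proof -
  have e1: "(\<Sum>k\<in>N i - {j}. K i j - K k j) = 3 * K i j - (\<Sum>k\<in>N i. K k j)
      - (if j \<in> N i then K i j - K j j else 0)"
    using finite_N[OF assms(1)] card_N[OF assms(1)]
    by (simp add: sum_diff1 sum_subtractf)
  have e2: "(\<Sum>k\<in>N j - {i}. K i j - K i k) = 3 * K i j - (\<Sum>k\<in>N j. K i k)
      - (if i \<in> N j then K i j - K i i else 0)"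
    using finite_N[OF assms(2)] card_N[OF assms(2)]
    by (simp add: sum_diff1 sum_subtractf)
  have "L2 K i j = (\<Sum>k\<in>N i - {j}. K i j - K k j) + (\<Sum>k\<in>N j - {i}. K i j - K i k)"
    using assms by (simp add: L2_def)
  then show ?thesis
    unfolding e1 e2 N_commute[OF assms(1,2)] by (cases "j \<in> N i") (simp_all add: algebra_simps)
qed

text \<open>Taking pairs as arguments makes \<open>L2\<close> an operator on functions of one
  variable, so that \<open>polyop\<close> applies.\<close>

lemma linear_op_L2:
  "linear_op (\<lambda>F (i, j). L2 (\<lambda>i j. F (i, j) :: 'b::comm_ring_1) i j)"
proof
  fix f g :: "'a \<times> 'a \<Rightarrow> 'b" and c
  have sub: "a + b - (a' + b') = (a - a') + (b - b')" "c * a - c * a' = c * (a - a')" for a b a' b' :: 'b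
    by (simp_all add: algebra_simps)
  show "(\<lambda>(i, j). L2 (\<lambda>i j. f (i, j) + g (i, j)) i j)
    = (\<lambda>x. (case x of (i, j) \<Rightarrow> L2 (\<lambda>i j. f (i, j)) i j) + (case x of (i, j) \<Rightarrow> L2 (\<lambda>i j. g (i, j)) i j))"
    unfolding L2_def sub sum.distrib by (auto simp: fun_eq_iff)
  show "(\<lambda>(i, j). L2 (\<lambda>i j. c * f (i, j)) i j) = (\<lambda>x. c * (case x of (i, j) \<Rightarrow> L2 (\<lambda>i j. f (i, j)) i j))"
    unfolding L2_def sub sum_distrib_left[symmetric] by (auto simp: fun_eq_iff algebra_simps)
qed

lemma L2_of_int: "L2 (\<lambda>i j. of_int (f i j)) i j = (of_int (L2 f i j) :: complex)"
  by (simp add: L2_def)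

end

text \<open>An integer root would also be a root modulo \<open>p\<close>, and only finitely many
  residues have to be tested.\<close>

lemma no_int_root_mod:
  fixes r :: "int poly" and p :: nat
  assumes "p > 0" "\<forall>a\<in>set [0..<p]. poly r (int a) mod int p \<noteq> 0"
  shows "poly r z \<noteq> 0"
proof
  assume z: "poly r z = 0"
  define a where "a = nat (z mod int p)"
  have a: "int a = z mod int p" "a < p"
    using assms(1) by (simp_all add: a_def nat_less_iff)
  have "int p dvd poly r z - poly r (int a)"
  proof (rule dvd_trans)
    show "int p dvd z - int a" using a(1) by (simp add: mod_eq_dvd_iff[symmetric])
    show "z - int a dvd poly r z - poly r (int a)"
    proof (induction r)
      case (pCons c r)
      have "poly (pCons c r) z - poly (pCons c r) (int a) = z * (poly r z - poly r (int a)) + (z - int a) * poly r (int a)"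
        by (simp add: algebra_simps)
      then show ?case using pCons by simp
    qed simp
  qed
  then have "poly r (int a) mod int p = 0" using z by simp
  with assms(2) a(2) show False by simp
qed

context integral_cubic
begin

text \<open>The start vector is \<open>L2 f\<close>: it vanishes outside the pairs of distinct
  vertices and does not see additive constants in \<open>f\<close>. As r(L2) annihilates it, a
  polynomial in \<open>L2\<close> turns it into a symmetric eigenfunction whose eigenvalue is a root
  of \<open>r\<close>, and \<open>L2_integral\<close> makes that root an integer.\<close>

lemma L2_no_integer_root:
  fixes f :: "'a \<Rightarrow> 'a \<Rightarrow> int"
  assumes sym: "\<And>i j. i \<in> V \<Longrightarrow> j \<in> V \<Longrightarrow> f i j = f j i"
    and nz: "L2 f a b \<noteq> 0"
    and ann: "\<And>i j. i \<in> V \<Longrightarrow> j \<in> V \<Longrightarrow> i \<noteq> j \<Longrightarrow> (\<Sum>k\<le>degree r. coeff r k * (L2 ^^ Suc k) f i j) = 0"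
    and noroot: "\<And>z. poly r z \<noteq> 0"
  shows False
proof -
  define Lc where "Lc = (\<lambda>F (i, j). L2 (\<lambda>i j. F (i, j) :: complex) i j)"
  interpret Lc: linear_op Lc unfolding Lc_def by (rule linear_op_L2)
  define G where "G = (\<lambda>(i, j). of_int (L2 f i j) :: complex)"
  define rc :: "complex poly" where "rc = map_poly of_int r"
  have pw: "(Lc ^^ k) G = (\<lambda>(i, j). of_int ((L2 ^^ Suc k) f i j))" for k
    by (induction k) (auto simp: G_def Lc_def L2_of_int)
  have ann': "(\<Sum>k\<le>degree r. coeff r k * (L2 ^^ Suc k) f i j) = 0" for i j
    using ann[of i j] by (cases "i \<in> V \<and> j \<in> V \<and> i \<noteq> j") (auto simp: L2_outside)
  have "polyop Lc rc G (i, j) = of_int (\<Sum>k\<le>degree r. coeff r k * (L2 ^^ Suc k) f i j)" for i j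
    unfolding Lc.polyop_conv_sum pw rc_def by simp
  then have "polyop Lc rc G = (\<lambda>_. 0)" by (auto simp: ann' fun_eq_iff simp del: funpow.simps)
  moreover have "G \<noteq> (\<lambda>_. 0)" using nz unfolding G_def by (metis case_prod_conv of_int_eq_0_iff)
  moreover have "rc \<noteq> 0"
  proof -
    have "r \<noteq> 0" using noroot[of 0] by auto
    then show ?thesis by (simp add: rc_def)
  qed
  ultimately obtain k q where k: "poly rc k = 0" "polyop Lc q G \<noteq> (\<lambda>_. 0)"
      "Lc (polyop Lc q G) = (\<lambda>x. k * polyop Lc q G x)"
    using eigenvector_of_annihilating_poly[OF Lc.linear_op_axioms] by blast
  define H where "H = polyop Lc q G"
  have "\<forall>i j. H (i, j) = H (j, i)"
    unfolding H_def
  proof (rule Lc.polyop_closed)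
    show "\<forall>i j. G (i, j) = G (j, i)"
      unfolding G_def using L2_symmetric[of f, OF sym] by auto
    show "\<forall>i j. Lc F (i, j) = Lc F (j, i)" if "\<forall>i j. F (i, j) = F (j, i)" for F
      unfolding Lc_def using L2_symmetric[of "\<lambda>i j. F (i, j)"] that by simp
    show "\<forall>i j. a * G (i, j) + F (i, j) = a * G (j, i) + F (j, i)"
      if "\<forall>i j. F (i, j) = F (j, i)" for a F
      using that \<open>\<forall>i j. G (i, j) = G (j, i)\<close> by metis
  qed simp
  moreover have "L2 (\<lambda>i j. H (i, j)) i j = k * H (i, j)" for i j
    using fun_cong[OF k(3), of "(i, j)"] unfolding H_def[symmetric] by (simp add: Lc_def)
  moreover have "(\<lambda>i j. H (i, j)) \<noteq> (\<lambda>_ _. 0)"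
    using k(2) unfolding H_def[symmetric] by (auto simp: fun_eq_iff)
  ultimately have "k \<in> \<int>" using L2_integral[of "\<lambda>i j. H (i, j)" k] by blast
  then obtain z where "k = of_int z" by (elim Ints_cases)
  then have "of_int (poly r z) = (0 :: complex)" using k(1) unfolding rc_def by simp
  with noroot show False by simp
qed

text \<open>Modulo constants \<open>f\<close> and \<open>g\<close> span an invariant space on which
  \<open>L2\<close> satisfies x^2 - p x + q. The constants \<open>c\<close> and \<open>d\<close>
  disappear at the next application of \<open>L2\<close>.\<close>

lemma L2_no_irrational_pair:
  fixes f g :: "'a \<Rightarrow> 'a \<Rightarrow> int"
  assumes sym: "\<And>i j. i \<in> V \<Longrightarrow> j \<in> V \<Longrightarrow> f i j = f j i"
    and nz: "a \<in> V" "b \<in> V" "a \<noteq> b" "g a b + c \<noteq> 0"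
    and f: "\<And>i j. i \<in> V \<Longrightarrow> j \<in> V \<Longrightarrow> i \<noteq> j \<Longrightarrow> L2 f i j = g i j + c"
    and g: "\<And>i j. i \<in> V \<Longrightarrow> j \<in> V \<Longrightarrow> i \<noteq> j \<Longrightarrow> L2 g i j = p * g i j - q * f i j + d"
    and noroot: "\<And>z. poly [:q, - p, 1:] z \<noteq> 0"
  shows False
proof (rule L2_no_integer_root[OF sym _ _ noroot])
  show "L2 f a b \<noteq> 0" using nz f by simp
  interpret Lc: linear_op "\<lambda>F (i, j). L2 (\<lambda>i j. F (i, j) :: int) i j" by (rule linear_op_L2)
  have eq2: "L2 (L2 f) = L2 g" by (rule L2_cong[OF f])
  have "L2 (L2 (L2 f)) i j = p * L2 g i j - q * L2 f i j" for i j
  proof -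
    have "L2 (L2 (L2 f)) = L2 (\<lambda>i j. p * g i j + (- q) * f i j)"
      unfolding eq2 by (rule L2_cong[of _ _ d]) (simp add: g)
    then show ?thesis
      using fun_cong[OF Lc.op_add[of "\<lambda>(i, j). p * g i j" "\<lambda>(i, j). (- q) * f i j"], of "(i, j)"]
        fun_cong[OF Lc.op_scale[of p "\<lambda>(i, j). g i j"], of "(i, j)"]
        fun_cong[OF Lc.op_scale[of "- q" "\<lambda>(i, j). f i j"], of "(i, j)"]
      by (simp only: case_prod_conv)
  qed
  then show "(\<Sum>k\<le>degree [:q, - p, 1:]. coeff [:q, - p, 1:] k * (L2 ^^ Suc k) f i j) = 0" for i j
    by (simp add: eq2 numeral_2_eq_2)
qed

end

section \<open>Bounds on the size\<close>

context cubic_graph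
begin

text \<open>The common size of all walk classes, by \<open>class_card\<close>; \<open>em\<close> is
  then the nonzero entry of Mp(A).\<close>

definition sz :: nat where
  "sz = (if bip then card V div 2 else card V)"

definition em :: int where
  "em = 120 div int sz"

text \<open>Once A satisfies \<open>mu\<close>, the polynomials \<open>Zp\<close>, \<open>Yp\<close>
  and \<open>Xp\<close> at A are 24, -60 and -36 times the projections to the eigenvalues 1 and -1,
  to 2 and -2, and to 0; the factors are their values there. \<open>Z1p\<close> and
  \<open>Y1p\<close> are the quotients of \<open>Zp\<close> and \<open>Yp\<close> by x, which
  compare the two signs.\<close>

definition Zp :: "int poly" where "Zp = [:0, 0, 36, 0, -13, 0, 1:]"
definition Z1p :: "int poly" where "Z1p = [:0, 36, 0, -13, 0, 1:]"
definition Yp :: "int poly" where "Yp = [:0, 0, 9, 0, -10, 0, 1:]"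
definition Y1p :: "int poly" where "Y1p = [:0, 9, 0, -10, 0, 1:]"
definition Xp :: "int poly" where "Xp = [:-36, 0, 49, 0, -14, 0, 1:]"

text \<open>A squared length expressed by walk counts: row u of p(A) plus e times row v of r(A).
  That it is nonnegative is the source of the semidefinite bounds.\<close>

lemma gram:
  assumes "u \<in> V" "v \<in> V"
  shows "(\<Sum>w\<in>V. (PA p u w + e * PA r v w)\<^sup>2)
    = PA (p * p) u u + 2 * e * PA (p * r) u v + e\<^sup>2 * PA (r * r) v v"
proof -
  have "(\<Sum>w\<in>V. (PA p u w + e * PA r v w)\<^sup>2)
     = (\<Sum>w\<in>V. PA p u w * PA p w u + 2 * e * (PA p u w * PA r w v) + e\<^sup>2 * (PA r v w * PA r w v))"
  proof (rule sum.cong[OF refl])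
    fix w assume "w \<in> V"
    then show "(PA p u w + e * PA r v w)\<^sup>2
      = PA p u w * PA p w u + 2 * e * (PA p u w * PA r w v) + e\<^sup>2 * (PA r v w * PA r w v)"
      using PA_sym[of w u p] PA_sym[of w v r] assms by (simp add: power2_eq_square algebra_simps)
  qed
  then show ?thesis
    using assms by (simp add: PA_mult sum.distrib sum_distrib_left mult.assoc)
qed

text \<open>The hypothesis says that row \<open>u\<close> has squared distance 0 from the constant
  row \<open>c\<close>. With it, diagonal walk counts alone suffice to show that \<open>p\<close> is
  a Hoffman polynomial, p(A) = c J with J the all-ones matrix.\<close>

lemma constant_row:
  assumes "u \<in> V" "PA (p * p) u u = 2 * c * poly p 3 - c\<^sup>2 * int (card V)" "w \<in> V"
  shows "PA p u w = c"
proof -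
  have "(\<Sum>w\<in>V. (PA p u w - c)\<^sup>2) = (\<Sum>w\<in>V. PA p u w * PA p w u - 2 * c * PA p u w + c\<^sup>2)"
    using PA_sym[OF _ assms(1), of _ p]
    by (intro sum.cong refl) (simp add: power2_eq_square algebra_simps)
  also have "\<dots> = PA (p * p) u u - 2 * c * (\<Sum>w\<in>V. PA p u w) + c\<^sup>2 * int (card V)"
    using assms(1) by (simp add: PA_mult sum.distrib sum_subtractf sum_distrib_left)
  also have "\<dots> = 0"
    by (simp add: W_row_sum[OF assms(1)] assms(2))
  finally have "\<forall>w\<in>V. (PA p u w - c)\<^sup>2 = 0"
    using finite_V by (intro sum_nonneg_eq_0_iff[THEN iffD1]) auto
  then show ?thesis using assms(3) by simp
qed

lemma sum_N_W: "u \<in> V \<Longrightarrow> v \<in> V \<Longrightarrow> (\<Sum>w\<in>N u. W k v w) = W (Suc k) v u"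
  by (simp add: W_Suc_right)

lemma four_le_card_V: "v \<in> V \<Longrightarrow> 4 \<le> card V"
proof -
  assume v: "v \<in> V"
  have "card (insert v (N v)) = 4" using card_N[OF v] finite_N[OF v] N_irrefl[OF v] by simp
  moreover have "insert v (N v) \<subseteq> V" using v N_subset by blast
  ultimately show ?thesis using card_mono[OF finite_V] by metis
qed

text \<open>Every edge has three walks u-v-x-v and three walks u-x-u-v, with u-v-u-v counted twice.
  Any further walk comes from a 4-cycle through the edge.\<close>

lemma W_3_edge_ge:
  assumes "u \<in> V" "v \<in> N u"
  shows "5 \<le> W 3 u v"
proof -
  have v: "v \<in> V" "u \<in> N v" using assms N_in_V N_sym by blast+
  have "W 3 u v = (\<Sum>a\<in>N u. W 2 a v)"
    using W_Suc[OF assms(1), of 2 v] by simp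
  also have "\<dots> = W 2 v v + (\<Sum>a\<in>N u - {v}. W 2 a v)"
    using assms finite_N by (subst sum.remove[of _ v]) auto
  also have "(\<Sum>a\<in>N u - {v}. W 2 a v) \<ge> (\<Sum>a\<in>N u - {v}. 1)"
  proof (rule sum_mono)
    fix a assume a: "a \<in> N u - {v}"
    then have "a \<in> V" "u \<in> N a \<inter> N v" using assms N_in_V N_sym v by blast+
    then have "card (N a \<inter> N v) > 0" using finite_N[of a] by (auto simp: card_gt_0_iff)
    then show "1 \<le> W 2 a v" using W_2[OF \<open>a \<in> V\<close> v(1)] by simp
  qed
  moreover have "card (N u - {v}) = 2" using assms card_N finite_N by simp
  ultimately show ?thesis using W_2_refl[OF v(1)] by simp
qed

text \<open>Each of the three edges contributes at least five. For the parity, the squares of the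
  entries of A^2 are congruent to the entries modulo 2, and these have row sum 9.\<close>

lemma W_4_diag:
  assumes "v \<in> V"
  shows "15 \<le> W 4 v v \<and> odd (W 4 v v)"
proof
  have "W 4 v v = (\<Sum>w\<in>N v. W 3 v w)" using sum_N_W[OF assms assms, of 3] by simp
  also have "\<dots> \<ge> (\<Sum>w\<in>N v. 5)" using assms W_3_edge_ge by (intro sum_mono)
  finally show "15 \<le> W 4 v v" using card_N[OF assms] by simp
  have "W 4 v v = (\<Sum>w\<in>V. W 2 v w * W 2 w v)" using W_add[OF assms, of 2 2 v] by simp
  also have "\<dots> = (\<Sum>w\<in>V. W 2 v w * W 2 v w)"
    using assms by (intro sum.cong refl) (simp add: W_sym)
  also have "\<dots> = (\<Sum>w\<in>V. W 2 v w * (W 2 v w - 1)) + (\<Sum>w\<in>V. W 2 v w)"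
    by (simp add: algebra_simps flip: sum.distrib)
  also have "(\<Sum>w\<in>V. W 2 v w) = 9"
    using W_row_sum[OF assms, of "monom 1 2"] by (simp add: W_def poly_monom)
  finally have "W 4 v v = (\<Sum>w\<in>V. W 2 v w * (W 2 v w - 1)) + 9" .
  moreover have "even (\<Sum>w\<in>V. W 2 v w * (W 2 v w - 1))" by (rule dvd_sum) simp
  ultimately show "odd (W 4 v v)" by simp
qed

end

context integral_cubic
begin

lemma class_card:
  assumes "v \<in> V"
  shows "card (Ev v) = sz" "card (Od v) = sz"
proof -
  have eq: "card (Od v) = card (Ev v)" using walk_classes[OF assms] by metis
  have "card (Ev v) = sz"
  proof (cases bip)
    case True
    have "card V = card (Ev v) + card (Od v)"
      using Ev_Un_Od[OF assms] bip_disjoint[OF True assms] finite_V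
      by (metis card_Un_disjoint finite_Un)
    then show ?thesis using True eq by (simp add: sz_def)
  next
    case False
    then show ?thesis using not_bip[OF False assms] by (simp add: sz_def)
  qed
  then show "card (Ev v) = sz" "card (Od v) = sz" using eq by simp_all
qed

lemma em_sz: "em * int sz = 120"
  and W_6: "u \<in> V \<Longrightarrow> v \<in> V \<Longrightarrow> W 6 u v = 5 * W 4 u v - 4 * W 2 u v + (if u \<in> Ev v then 3 * em else 0)"
  and W_5: "u \<in> V \<Longrightarrow> v \<in> V \<Longrightarrow> W 5 u v = 5 * W 3 u v - 4 * W 1 u v + (if u \<in> Od v then em else 0)"
proof -
  have *: "em * int sz = 120 \<and> (\<forall>u\<in>V. PA Qp u v = (if u \<in> Ev v then 3 * em else 0))
    \<and> (\<forall>u\<in>V. PA Mp u v = (if u \<in> Od v then em else 0))" if v: "v \<in> V" for v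
  proof -
    obtain m where m: "m * int (card (Ev v)) = 120"
      "\<And>u. u \<in> V \<Longrightarrow> PA Qp u v = (if u \<in> Ev v then 3 * m else 0)"
      "\<And>u. u \<in> V \<Longrightarrow> PA Mp u v = (if u \<in> Od v then m else 0)"
      using walk_classes[OF v] by metis
    have "m * int sz = 120" using m(1) class_card[OF v] by simp
    moreover from this have "em = m" unfolding em_def
      by (metis mult_eq_0_iff nonzero_mult_div_cancel_right zero_neq_numeral)
    ultimately show ?thesis using m by simp
  qed
  show "em * int sz = 120" using * V_nonempty by blast
  show "W 6 u v = 5 * W 4 u v - 4 * W 2 u v + (if u \<in> Ev v then 3 * em else 0)" if "u \<in> V" "v \<in> V"
  proof -
    have "PA Qp u v = (if u \<in> Ev v then 3 * em else 0)" using *[OF that(2)] that(1) by blast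
    then show ?thesis unfolding Qp_def by (simp add: W_expand eval_nat_numeral)
  qed
  show "W 5 u v = 5 * W 3 u v - 4 * W 1 u v + (if u \<in> Od v then em else 0)" if "u \<in> V" "v \<in> V"
  proof -
    have "PA Mp u v = (if u \<in> Od v then em else 0)" using *[OF that(2)] that(1) by blast
    then show ?thesis unfolding Mp_def by (simp add: W_expand eval_nat_numeral)
  qed
qed

lemma PA_Zp: "u \<in> V \<Longrightarrow> v \<in> V \<Longrightarrow> PA Zp u v = (if u \<in> Ev v then 3 * em else 0) - 8 * W 4 u v + 32 * W 2 u v"
  using W_6[of u v] unfolding Zp_def by (simp add: W_expand eval_nat_numeral)

lemma PA_Yp: "u \<in> V \<Longrightarrow> v \<in> V \<Longrightarrow> PA Yp u v = (if u \<in> Ev v then 3 * em else 0) - 5 * W 4 u v + 5 * W 2 u v"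
  using W_6[of u v] unfolding Yp_def by (simp add: W_expand eval_nat_numeral)

lemma PA_Xp: "u \<in> V \<Longrightarrow> v \<in> V \<Longrightarrow>
    PA Xp u v = (if u \<in> Ev v then 3 * em else 0) - 9 * W 4 u v + 45 * W 2 u v - 36 * W 0 u v"
  using W_6[of u v] unfolding Xp_def by (simp add: W_expand eval_nat_numeral)

lemma PA_Z1p: "u \<in> V \<Longrightarrow> v \<in> V \<Longrightarrow> PA Z1p u v = (if u \<in> Od v then em else 0) - 8 * W 3 u v + 32 * W 1 u v"
  using W_5[of u v] unfolding Z1p_def by (simp add: W_expand eval_nat_numeral)

lemma PA_Y1p: "u \<in> V \<Longrightarrow> v \<in> V \<Longrightarrow> PA Y1p u v = (if u \<in> Od v then em else 0) - 5 * W 3 u v + 5 * W 1 u v"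
  using W_5[of u v] unfolding Y1p_def by (simp add: W_expand eval_nat_numeral)

text \<open>Modulo \<open>mu\<close> the products reduce: \<open>Zp * Zp\<close> and
  \<open>Z1p * Z1p\<close> to 24 \<open>Zp\<close>, and \<open>Zp * Z1p\<close> to 24
  \<open>Z1p\<close>, as for the sum and the difference of two orthogonal projections.\<close>

lemma Z_gram:
  assumes "u \<in> V" "v \<in> V" "e\<^sup>2 = 1"
  shows "(\<Sum>w\<in>V. (PA Zp u w + e * PA Z1p v w)\<^sup>2) = 24 * (PA Zp u u + PA Zp v v + 2 * e * PA Z1p u v)"
proof -
  have "PA (Zp * Zp) u u = PA (Polynomial.smult 24 Zp) u u"
    by (rule PA_mod_mu[OF assms(1,1), of _ _ "[:0, 24, 0, -12, 0, 1:]"])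
      (simp add: Zp_def mu_def)
  moreover have "PA (Zp * Z1p) u v = PA (Polynomial.smult 24 Z1p) u v"
    by (rule PA_mod_mu[OF assms(1,2), of _ _ "[:24, 0, -12, 0, 1:]"]) (simp add: Zp_def Z1p_def mu_def)
  moreover have "PA (Z1p * Z1p) v v = PA (Polynomial.smult 24 Zp) v v"
    by (rule PA_mod_mu[OF assms(2,2), of _ _ "[:0, -12, 0, 1:]"]) (simp add: Zp_def Z1p_def mu_def)
  ultimately show ?thesis unfolding gram[OF assms(1,2)] assms(3) by (simp add: PA_smult algebra_simps)
qed
end

text \<open>Handshake argument: an injection into the natural numbers orients every edge, so the
  number 3 |V| of arcs is even.\<close>

lemma (in cubic_graph) even_card_V: "even (card V)"
proof -
  obtain f :: "'a \<Rightarrow> nat" where f: "inj_on f V"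
    using finite_imp_inj_to_nat_seg[OF finite_V] by blast
  define A where "A = {(u, v). u \<in> V \<and> v \<in> N u \<and> f u < f v}"
  define B where "B = {(u, v). u \<in> V \<and> v \<in> N u \<and> f v < f u}"
  have fin: "finite (Sigma V N)" using finite_V finite_N by auto
  have "f u \<noteq> f v" if "u \<in> V" "v \<in> N u" for u v
    using that inj_onD[OF f, of u v] N_in_V N_irrefl by blast
  then have "Sigma V N = A \<union> B" unfolding A_def B_def by (fastforce simp: nat_neq_iff)
  moreover have "A \<inter> B = {}" unfolding A_def B_def by auto
  moreover have "B = A\<inverse>" unfolding A_def B_def using N_sym N_in_V by blast
  ultimately have "card (Sigma V N) = 2 * card A"
    using fin by (metis card_Un_disjoint card_inverse finite_Un mult_2)
  moreover have "card (Sigma V N) = 3 * card V"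
    using finite_V finite_N card_N by simp
  ultimately show ?thesis by (metis dvd_triv_left even_mult_iff odd_numeral)
qed

lemma (in cubic_graph) PA_minus: "PA (- p) u v = - PA p u v"
  using PA_diff[of 0 p u v] by simp

context integral_cubic
begin

text \<open>The factor 2 normalises \<open>Y1p\<close>, whose value at 2 is half that of
  \<open>Yp\<close>: twice Y1p(A) is -60 times the difference of the projections to 2 and
  -2.\<close>

lemma Y_gram:
  assumes "u \<in> V" "v \<in> V" "e\<^sup>2 = 1"
  shows "(\<Sum>w\<in>V. (PA Yp u w + 2 * e * PA Y1p v w)\<^sup>2) = - 60 * (PA Yp u u + PA Yp v v + 4 * e * PA Y1p u v)"
proof -
  have "PA (Yp * Yp) u u = PA (Polynomial.smult (-60) Yp) u u"
    by (rule PA_mod_mu[OF assms(1,1), of _ _ "[:0, -15, 0, -6, 0, 1:]"]) (simp add: Yp_def mu_def)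
  moreover have "PA (Yp * Y1p) u v = PA (Polynomial.smult (-60) Y1p) u v"
    by (rule PA_mod_mu[OF assms(1,2), of _ _ "[:-15, 0, -6, 0, 1:]"]) (simp add: Yp_def Y1p_def mu_def)
  moreover have "PA (Y1p * Y1p) v v = PA (Polynomial.smult (-15) Yp) v v"
    by (rule PA_mod_mu[OF assms(2,2), of _ _ "[:0, -6, 0, 1:]"]) (simp add: Yp_def Y1p_def mu_def)
  moreover have "(2 * e)\<^sup>2 = 4" using assms(3) by (simp add: power_mult_distrib)
  ultimately show ?thesis unfolding gram[OF assms(1,2)] by (simp add: PA_smult PA_minus algebra_simps)
qed

lemma X_gram:
  assumes "u \<in> V"
  shows "(\<Sum>w\<in>V. (PA Xp u w)\<^sup>2) = - 36 * PA Xp u u"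
proof -
  have "PA (Xp * Xp) u u = PA (Polynomial.smult (-36) Xp) u u"
    by (rule PA_mod_mu[OF assms assms, of _ _ "[:0, 49, 0, -14, 0, 1:]"]) (simp add: Xp_def mu_def)
  then show ?thesis using gram[OF assms assms, of Xp 0 0] by (simp add: PA_smult PA_minus)
qed

lemma Z_nonneg: "u \<in> V \<Longrightarrow> v \<in> V \<Longrightarrow> e\<^sup>2 = 1 \<Longrightarrow> 0 \<le> PA Zp u u + PA Zp v v + 2 * e * PA Z1p u v"
  using Z_gram[of u v e] sum_nonneg[of V "\<lambda>w. (PA Zp u w + e * PA Z1p v w)\<^sup>2"] by simp

lemma Y_nonpos: "u \<in> V \<Longrightarrow> v \<in> V \<Longrightarrow> e\<^sup>2 = 1 \<Longrightarrow> PA Yp u u + PA Yp v v + 4 * e * PA Y1p u v \<le> 0"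
  using Y_gram[of u v e] sum_nonneg[of V "\<lambda>w. (PA Yp u w + 2 * e * PA Y1p v w)\<^sup>2"] by simp

text \<open>Both signs of \<open>e\<close> together bound an entry of the odd companion by diagonal
  entries, as for the two-by-two minors of a semidefinite matrix.\<close>

lemma Z_abs: "u \<in> V \<Longrightarrow> v \<in> V \<Longrightarrow> 2 * \<bar>PA Z1p u v\<bar> \<le> PA Zp u u + PA Zp v v"
  using Z_nonneg[of u v 1] Z_nonneg[of u v "-1"] by simp

lemma Y_abs: "u \<in> V \<Longrightarrow> v \<in> V \<Longrightarrow> 4 * \<bar>PA Y1p u v\<bar> \<le> - PA Yp u u - PA Yp v v"
  using Y_nonpos[of u v 1] Y_nonpos[of u v "-1"] by simp

lemma diag_values:
  assumes "v \<in> V"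
  shows "PA Zp v v = 3 * em - 8 * W 4 v v + 96" "PA Yp v v = 3 * em - 5 * W 4 v v + 15"
    "PA Xp v v = 3 * em - 9 * W 4 v v + 99"
  using PA_Zp[OF assms assms] PA_Yp[OF assms assms] PA_Xp[OF assms assms] W_2_refl[OF assms]
  by (simp_all add: Ev_refl W_0)

text \<open>The diagonal entries of the three scaled projections have known signs, and each is
  linear in \<open>em\<close> and in the number of closed 4-walks.\<close>

lemma diag_bounds:
  assumes "v \<in> V"
  shows "8 * W 4 v v \<le> 3 * em + 96" "3 * em + 15 \<le> 5 * W 4 v v" "3 * em + 99 \<le> 9 * W 4 v v"
proof -
  have "0 \<le> PA Zp v v" using Z_abs[OF assms assms] by simp
  then show "8 * W 4 v v \<le> 3 * em + 96" by (simp add: diag_values[OF assms])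
  have "PA Yp v v \<le> 0" using Y_abs[OF assms assms] by simp
  then show "3 * em + 15 \<le> 5 * W 4 v v" by (simp add: diag_values[OF assms])
  have "0 \<le> - 36 * PA Xp v v" using X_gram[OF assms] sum_nonneg[of V "\<lambda>w. (PA Xp v w)\<^sup>2"] by simp
  then show "3 * em + 99 \<le> 9 * W 4 v v" by (simp add: diag_values[OF assms])
qed

text \<open>With at least 15 closed 4-walks the first diagonal bound gives em >= 8, hence sz <= 15;
  sz >= 3 because a neighbourhood lies in one class. For each divisor of 120 above 4 in this range,
  parity and the bounds from both sides leave the listed counts.\<close>

lemma sz_cases:
  assumes "v \<in> V"
  shows "sz = 15 \<and> em = 8 \<and> W 4 v v = 15 \<or> sz = 12 \<and> em = 10 \<and> W 4 v v = 15 \<or>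
    sz = 10 \<and> em = 12 \<and> W 4 v v = 15 \<or> sz = 8 \<and> em = 15 \<and> W 4 v v = 17 \<or>
    sz = 6 \<and> em = 20 \<and> W 4 v v = 19 \<or> sz = 5 \<and> em = 24 \<and> (W 4 v v = 19 \<or> W 4 v v = 21) \<or>
    sz = 4 \<and> em = 30 \<or> sz = 3 \<and> em = 40"
proof -
  have "N v \<subseteq> Od v" using N_Ev[OF Ev_refl] by blast
  moreover have "finite (Od v)" using Od_subset[OF assms] finite_V finite_subset by blast
  ultimately have "3 \<le> sz" using card_mono[of "Od v" "N v"] card_N class_card assms by simp
  define k where "k = W 4 v v"
  have k: "15 \<le> k" "odd k" "8 * k \<le> 3 * em + 96" "3 * em + 15 \<le> 5 * k" "3 * em + 99 \<le> 9 * k"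
    using diag_bounds[OF assms] W_4_diag[OF assms] by (simp_all add: k_def)
  have em8: "8 \<le> em" using k by linarith
  have "8 * int sz \<le> em * int sz" using em8 by (intro mult_right_mono) simp_all
  then have "sz \<le> 15" using em_sz by simp
  have upt: "set [3..<16] = {3, 4, 5, 6, 7, 8, 9, 10, 11, 12, 13, 14, 15 :: nat}"
    by code_simp
  have "sz \<in> set [3..<16]"
    unfolding set_upt atLeastLessThan_iff using \<open>3 \<le> sz\<close> \<open>sz \<le> 15\<close> by linarith
  then have "sz \<in> {3, 4, 5, 6, 7, 8, 9, 10, 11, 12, 13, 14, 15}" unfolding upt .
  then have "sz = 15 \<and> em = 8 \<or> sz = 12 \<and> em = 10 \<or> sz = 10 \<and> em = 12 \<or> sz = 8 \<and> em = 15 \<or>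
    sz = 6 \<and> em = 20 \<or> sz = 5 \<and> em = 24 \<or> sz = 4 \<and> em = 30 \<or> sz = 3 \<and> em = 40"
    using em_sz by (elim insertE) (simp_all, presburger+)
  then show ?thesis unfolding k_def[symmetric] using k by (elim disjE conjE) (simp_all, presburger+)
qed

lemma em_unique:
  "sz = 15 \<Longrightarrow> em = 8" "sz = 12 \<Longrightarrow> em = 10" "sz = 10 \<Longrightarrow> em = 12"
  "sz = 6 \<Longrightarrow> em = 20" "sz = 5 \<Longrightarrow> em = 24"
  by (simp_all add: em_def)

lemma edge_sum: "u \<in> V \<Longrightarrow> (\<Sum>v\<in>N u. W 3 u v) = W 4 u u"
  using sum_N_W[of u u 3] by simp

lemma Z1_edge: "u \<in> V \<Longrightarrow> v \<in> N u \<Longrightarrow> PA Z1p u v = em - 8 * W 3 u v + 32"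
  using PA_Z1p[of u v] N_in_V[of u v] N_Ev[OF Ev_refl, of u v] N_sym[of u v] W_1[of u v]
  by (simp add: N_Ev[OF Ev_refl])

lemma Y1_edge: "u \<in> V \<Longrightarrow> v \<in> N u \<Longrightarrow> PA Y1p u v = em - 5 * W 3 u v + 5"
  using PA_Y1p[of u v] N_in_V[of u v] N_sym[of u v] W_1[of u v]
  by (simp add: N_Ev[OF Ev_refl])

text \<open>The entry bound forces six 3-walks along every edge, so a vertex would have 18 closed
  4-walks instead of 17.\<close>

lemma sz_not_8: "sz \<noteq> 8"
proof
  assume "sz = 8"
  then have k: "W 4 v v = 17" "em = 15" if "v \<in> V" for v using sz_cases[OF that] by auto
  obtain u where u: "u \<in> V" using V_nonempty by blast
  have "W 3 u v = 6" if "v \<in> N u" for v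
  proof -
    have v: "v \<in> V" using u that N_in_V by blast
    show ?thesis
      using Z_abs[OF u v] unfolding Z1_edge[OF u that] diag_values(1)[OF u] diag_values(1)[OF v] k[OF u] k[OF v]
      by presburger
  qed
  then have "W 4 u u = 18" using edge_sum[OF u] card_N[OF u] by simp
  then show False using k[OF u] by simp
qed

text \<open>Two neighbourhoods of size 3 lie in a common class of size \<open>sz\<close>, so for
  small \<open>sz\<close> they must overlap.\<close>

lemma W_2_lower_bound:
  assumes "u \<in> V" "w \<in> Ev u"
  shows "6 - int sz \<le> W 2 u w"
proof -
  have w: "w \<in> V" using assms Ev_subset by blast
  have sub: "N u \<union> N w \<subseteq> Od u" using assms N_Ev Ev_refl by blast
  have fin: "finite (Od u)" using Od_subset[OF assms(1)] finite_V finite_subset by blast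
  have "card (N u \<union> N w) \<le> sz" using card_mono[OF fin sub] class_card[OF assms(1)] by simp
  moreover have "card (N u \<union> N w) + card (N u \<inter> N w) = 6"
    using card_Un_Int[OF finite_N[OF assms(1)] finite_N[OF w]] card_N assms(1) w by simp
  ultimately show ?thesis using W_2[OF assms(1) w] by simp
qed

lemma sum_W_2_even_class:
  assumes "u \<in> V"
  shows "(\<Sum>w\<in>Ev u - {u}. W 2 u w) = 6" "(\<Sum>w\<in>Ev u - {u}. (W 2 u w)\<^sup>2) = W 4 u u - 9"
    "card (Ev u - {u}) = sz - 1"
proof -
  have fin: "finite (Ev u)" using Ev_subset[OF assms] finite_V finite_subset by blast
  have 0: "W 2 u w = 0" if "w \<in> V" "w \<notin> Ev u" for w
    using W_even_0(2)[OF assms that] W_sym[OF assms that(1), of 2] by simp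
  have "(\<Sum>w\<in>V. W 2 u w) = 9"
    using W_row_sum[OF assms, of "monom 1 2"] by (simp add: W_def poly_monom)
  also have "(\<Sum>w\<in>V. W 2 u w) = (\<Sum>w\<in>Ev u. W 2 u w)"
    using Ev_subset[OF assms] finite_V 0 by (intro sum.mono_neutral_right) auto
  finally show "(\<Sum>w\<in>Ev u - {u}. W 2 u w) = 6"
    using fin Ev_refl by (simp add: sum_diff1 W_2_refl[OF assms])
  have "W 4 u u = (\<Sum>w\<in>V. W 2 u w * W 2 w u)" using W_add[OF assms, of 2 2 u] by simp
  also have "\<dots> = (\<Sum>w\<in>V. (W 2 u w)\<^sup>2)"
    using assms by (intro sum.cong refl) (simp add: W_sym power2_eq_square)
  also have "\<dots> = (\<Sum>w\<in>Ev u. (W 2 u w)\<^sup>2)"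
    using Ev_subset[OF assms] finite_V 0 by (intro sum.mono_neutral_right) auto
  finally show "(\<Sum>w\<in>Ev u - {u}. (W 2 u w)\<^sup>2) = W 4 u u - 9"
    using fin Ev_refl by (simp add: sum_diff1 W_2_refl[OF assms])
  show "card (Ev u - {u}) = sz - 1"
    using fin Ev_refl class_card[OF assms] by simp
qed

end

section \<open>Excluding the remaining sizes\<close>

context cubic_graph
begin

lemma L2_add: "L2 (\<lambda>i j. f i j + g i j) i j = L2 f i j + (L2 g i j :: 'b::comm_ring_1)"
proof -
  interpret Lc: linear_op "\<lambda>F (i, j). L2 (\<lambda>i j. F (i, j) :: 'b) i j" by (rule linear_op_L2)
  show ?thesis
    using fun_cong[OF Lc.op_add[of "\<lambda>(i, j). f i j" "\<lambda>(i, j). g i j"], of "(i, j)"]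
    by (simp only: case_prod_conv)
qed

lemma L2_scale: "L2 (\<lambda>i j. c * f i j) i j = c * (L2 f i j :: 'b::comm_ring_1)"
proof -
  interpret Lc: linear_op "\<lambda>F (i, j). L2 (\<lambda>i j. F (i, j) :: 'b) i j" by (rule linear_op_L2)
  show ?thesis
    using fun_cong[OF Lc.op_scale[of c "\<lambda>(i, j). f i j"], of "(i, j)"]
    by (simp only: case_prod_conv)
qed

lemma L2_diff: "L2 (\<lambda>i j. f i j - g i j) i j = L2 f i j - (L2 g i j :: 'b::comm_ring_1)"
  using L2_add[of f "\<lambda>i j. - 1 * g i j" i j] L2_scale[of "- 1" g i j] by simp

lemma L2_W:
  assumes "i \<in> V" "j \<in> V" "i \<noteq> j"
  shows "L2 (W k) i j = 6 * W k i j - 2 * W (Suc k) i j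
    + (if j \<in> N i then W k i i + W k j j - 2 * W k i j else 0)"
  using L2_formula[OF assms, of "W k"] W_Suc[OF assms(1), of k j] W_Suc_right[OF assms(1,2), of k] by simp

definition same :: "'a \<Rightarrow> 'a \<Rightarrow> int" where
  "same i j = (if j \<in> Ev i then 1 else 0)"

text \<open>A basis function of its own in the bipartite cases, where the reductions of W 2 and W 5
  involve it.\<close>

definition opp :: "'a \<Rightarrow> 'a \<Rightarrow> int" where
  "opp i j = (if j \<in> Od i then 1 else 0)"

lemma Ev_commute: "i \<in> V \<Longrightarrow> j \<in> V \<Longrightarrow> j \<in> Ev i \<longleftrightarrow> i \<in> Ev j"
  using Ev_sym by blast

lemma Od_commute: "i \<in> V \<Longrightarrow> j \<in> V \<Longrightarrow> j \<in> Od i \<longleftrightarrow> i \<in> Od j"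
proof -
  have "i \<in> Od j" if ij: "i \<in> V" "j \<in> V" "j \<in> Od i" for i j
  proof -
    obtain u where u: "u \<in> Ev i" "j \<in> N u" using ij(3) unfolding Od_def by blast
    then have "u \<in> V" using Ev_subset ij by blast
    then have "u \<in> Od j" using u N_sym N_Ev[OF Ev_refl] by blast
    moreover have "i \<in> Ev u" using Ev_sym ij(1) u(1) by blast
    ultimately show ?thesis
    proof -
      have "u \<in> Od j \<Longrightarrow> i \<in> Od j" if "(u, i) \<in> two_step\<^sup>*"
        using that
      proof (induction rule: rtrancl_induct)
        case (step y z)
        then show ?case using N_Od[OF ij(2)] N_Ev unfolding two_step_def by blast
      qed
      then show ?thesis using \<open>u \<in> Od j\<close> \<open>i \<in> Ev u\<close> unfolding Ev_def by blast
    qed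
  qed
  then show "i \<in> V \<Longrightarrow> j \<in> V \<Longrightarrow> ?thesis" by blast
qed

lemma sum_opp:
  assumes "i \<in> V" "j \<in> V"
  shows "(\<Sum>k\<in>N i. opp k j) = 3 * same i j" "(\<Sum>k\<in>N j. opp i k) = 3 * same i j"
proof -
  have *: "(\<Sum>k\<in>N j. opp i k) = 3 * same i j" if "i \<in> V" "j \<in> V" for i j
  proof -
    have "(\<Sum>k\<in>N j. opp i k) = (\<Sum>k\<in>N j. same i j)"
      by (rule sum.cong[OF refl]) (simp add: opp_def same_def N_Ev_iff[OF that])
    then show ?thesis using card_N[OF that(2)] by simp
  qed
  show "(\<Sum>k\<in>N j. opp i k) = 3 * same i j" by (rule *[OF assms])
  have "(\<Sum>k\<in>N i. opp k j) = (\<Sum>k\<in>N i. opp j k)"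
    using N_in_V[OF assms(1)] Od_commute[OF _ assms(2)] by (intro sum.cong refl) (auto simp: opp_def)
  also have "\<dots> = 3 * same i j" using *[OF assms(2,1)] Ev_commute[OF assms] by (simp add: same_def)
  finally show "(\<Sum>k\<in>N i. opp k j) = 3 * same i j" .
qed

lemma L2_opp:
  assumes "bip" "i \<in> V" "j \<in> V" "i \<noteq> j"
  shows "L2 opp i j = 12 * opp i j - 6 - 2 * W 1 i j"
proof -
  have "opp v v = 0" if "v \<in> V" for v
    using bip_disjoint[OF assms(1) that] Ev_refl by (auto simp: opp_def)
  moreover have "same i j = 1 - opp i j"
    using bip_disjoint[OF assms(1,2)] Ev_Un_Od[OF assms(2)] assms(3) by (auto simp: same_def opp_def)
  moreover have "opp i j = 1" if "j \<in> N i" using N_Ev[OF Ev_refl that] by (simp add: opp_def)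
  ultimately show ?thesis
    unfolding L2_formula[OF assms(2-4)] sum_opp[OF assms(2,3)] W_1[OF assms(2)] using assms(2,3) by simp
qed

lemma L2_W_1:
  assumes "i \<in> V" "j \<in> V" "i \<noteq> j"
  shows "L2 (W 1) i j = 4 * W 1 i j - 2 * W 2 i j"
  using L2_W[OF assms, of 1] W_1[OF assms(1), of i] W_1[OF assms(1), of j] W_1[OF assms(2), of j]
    N_irrefl[OF assms(1)] N_irrefl[OF assms(2)] by (simp add: numeral_2_eq_2)

lemma obtain_edge:
  obtains u v where "u \<in> V" "v \<in> N u" "v \<in> V" "u \<noteq> v"
proof -
  obtain u where u: "u \<in> V" using V_nonempty by blast
  then obtain v where "v \<in> N u" using card_N[OF u] by fastforce
  with u that show thesis using N_in_V N_irrefl by metis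
qed

end

lemma all_eq_of_sum:
  fixes f :: "'a \<Rightarrow> int"
  assumes "finite A" "\<And>x. x \<in> A \<Longrightarrow> c \<le> f x" "sum f A = c * int (card A)" "x \<in> A"
  shows "f x = c"
proof -
  have "(\<Sum>x\<in>A. f x - c) = 0" using assms(3) by (simp add: sum_subtractf)
  then have "\<forall>x\<in>A. f x - c = 0"
    using assms(1,2) by (intro sum_nonneg_eq_0_iff[THEN iffD1]) auto
  then show ?thesis using assms(4) by simp
qed

section \<open>The cube and the triangular prism\<close>

context integral_cubic
begin

text \<open>Any two vertices of a class of four share exactly two neighbours, since the lower bound
  2 already exhausts the sum 6. So W 2 is 2 - 2 \<open>opp\<close> off the diagonal, and W 1
  generates a two-dimensional space modulo constants, with eigenvalues 8 plus or minus 2 sqrt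
  2.\<close>

lemma no_cube:
  assumes bip "sz = 4"
  shows False
proof -
  let ?g = "\<lambda>i j. 4 * W 1 i j + 4 * opp i j"
  have W2: "W 2 i j = 2 - 2 * opp i j" if ij: "i \<in> V" "j \<in> V" "i \<noteq> j" for i j
  proof (cases "j \<in> Ev i")
    case True
    have "W 2 i j = 2"
    proof (rule all_eq_of_sum[of "Ev i - {i}"])
      show "finite (Ev i - {i})" using Ev_subset[OF ij(1)] finite_V finite_subset by blast
      show "(\<Sum>w\<in>Ev i - {i}. W 2 i w) = 2 * int (card (Ev i - {i}))"
        using sum_W_2_even_class[OF ij(1)] assms(2) by simp
      show "2 \<le> W 2 i w" if "w \<in> Ev i - {i}" for w
        using W_2_lower_bound[OF ij(1), of w] that assms(2) by simp
    qed (use True ij in auto)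
    moreover have "j \<notin> Od i" using True bip_disjoint[OF assms(1) ij(1)] by blast
    ultimately show ?thesis by (simp add: opp_def)
  next
    case False
    then have "j \<in> Od i" using Ev_Un_Od[OF ij(1)] ij(2) by blast
    moreover have "W 2 i j = 0"
      using W_even_0(2)[OF ij(1,2) False] W_sym[OF ij(1,2), of 2] by simp
    ultimately show ?thesis by (simp add: opp_def)
  qed
  obtain u v where uv: "u \<in> V" "v \<in> N u" "v \<in> V" "u \<noteq> v" by (rule obtain_edge)
  show False
  proof (rule L2_no_irrational_pair)
    show "u \<in> V" "v \<in> V" "u \<noteq> v" by fact+
    show "?g u v + (- 4) \<noteq> 0"
      using W_1[OF uv(1), of v] uv(2) by (simp add: opp_def N_Ev[OF Ev_refl])
    show "W 1 i j = W 1 j i" if "i \<in> V" "j \<in> V" for i j by (rule W_sym[OF that])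
    show L1: "L2 (W 1) i j = ?g i j + (- 4)" if "i \<in> V" "j \<in> V" "i \<noteq> j" for i j
      using L2_W_1[OF that] W2[OF that] by simp
    show "L2 ?g i j = 16 * ?g i j - 56 * W 1 i j + (- 40)" if "i \<in> V" "j \<in> V" "i \<noteq> j" for i j
      unfolding L2_add L2_scale L1[OF that] L2_opp[OF assms(1) that] by simp
    show "poly [:56, - 16, 1:] z \<noteq> 0" for z :: int
      by (rule no_int_root_mod[of 3]) code_simp+
  qed
qed

text \<open>Every triangle is walked in two directions.\<close>

lemma even_W_3_diag:
  assumes "u \<in> V"
  shows "even (W 3 u u)"
proof -
  obtain a b c where abc: "N u = {a, b, c}" "a \<noteq> b" "a \<noteq> c" "b \<noteq> c"
    using card_N[OF assms] by (auto simp: card_3_iff)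
  then have V: "a \<in> V" "b \<in> V" "c \<in> V" using N_in_V[OF assms] by auto
  have 2: "W 2 x u = W 1 x a + W 1 x b + W 1 x c" if "x \<in> V" for x
    using W_Suc_right[OF that assms, of 1] abc by (simp add: numeral_2_eq_2)
  have "W 3 u u = W 2 a u + W 2 b u + W 2 c u"
    using W_Suc[OF assms, of 2 u] abc by simp
  moreover have "W 1 a a = 0" "W 1 b b = 0" "W 1 c c = 0"
    using V W_1 N_irrefl by simp_all
  ultimately have "W 3 u u = 2 * (W 1 a b + W 1 a c + W 1 b c)"
    using V by (simp add: 2 W_sym[of b a] W_sym[of c a] W_sym[of c b])
  then show ?thesis by simp
qed

lemma W_3_diag_of_nonbip:
  assumes "\<not> bip" "u \<in> V"
  shows "\<bar>em - 8 * W 3 u u\<bar> \<le> PA Zp u u"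
  using Z_abs[OF assms(2,2)] PA_Z1p[OF assms(2,2)] not_bip[OF assms] assms(2) W_1[OF assms(2)] N_irrefl[OF assms(2)]
  by simp

text \<open>The entry bound and parity put every vertex on exactly one triangle. Then x (x - 1)(x +
  2), which vanishes at the eigenvalues of the prism other than 3, has constant rows with entry 30 /
  6 = 5. This removes W 3, and \<open>L2\<close> acts on the span of W 1 and W 2 modulo constants
  with eigenvalues 5 plus or minus sqrt 5.\<close>

lemma no_prism:
  assumes "\<not> bip" "sz = 6"
  shows False
proof -
  have em: "em = 20" using em_unique assms by simp
  have k4: "W 4 v v = 19" if "v \<in> V" for v using sz_cases[OF that] assms by simp
  have nV: "card V = 6" using assms by (simp add: sz_def)
  have t: "W 3 v v = 2" if "v \<in> V" for v
    using W_3_diag_of_nonbip[OF assms(1) that] even_W_3_diag[OF that]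
    unfolding diag_values(1)[OF that] k4[OF that] em by presburger
  define p :: "int poly" where "p = [:0, -2, 1, 1:]"
  have Ev: "u \<in> Ev v" "u \<in> Od v" if "u \<in> V" "v \<in> V" for u v using not_bip[OF assms(1) that(2)] that by auto
  have W3: "W 3 u w = 5 - W 2 u w + 2 * W 1 u w" if uw: "u \<in> V" "w \<in> V" for u w
  proof -
    have "p * p = [:0, 0, 4, -4, -3, 2, 1:]" by (simp add: p_def)
    then have "PA (p * p) u u = 4 * W 2 u u - 4 * W 3 u u - 3 * W 4 u u + 2 * W 5 u u + W 6 u u"
      by (simp add: W_expand eval_nat_numeral)
    then have "PA (p * p) u u = 150"
      using W_5[OF uw(1,1)] W_6[OF uw(1,1)] Ev[OF uw(1,1)] t[OF uw(1)] k4[OF uw(1)] W_2_refl[OF uw(1)]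
        W_1[OF uw(1), of u] N_irrefl[OF uw(1)] em by simp
    then have "PA p u w = 5"
      using nV by (intro constant_row[OF uw(1) _ uw(2)]) (simp add: p_def)
    then show ?thesis unfolding p_def by (simp add: W_expand eval_nat_numeral)
  qed
  have W2: "W 2 u w = 2" if uw: "u \<in> V" "w \<in> V" "w \<notin> N u" "u \<noteq> w" for u w
  proof (rule all_eq_of_sum[of "V - insert u (N u)"])
    show "finite (V - insert u (N u))" using finite_V by blast
    have fN: "finite (insert u (N u))" using finite_N[OF uw(1)] by simp
    have sub: "insert u (N u) \<subseteq> V" using N_subset uw(1) by blast
    have "card (insert u (N u)) = 4" using card_N[OF uw(1)] fN N_irrefl[OF uw(1)] by simp
    then have c: "card (V - insert u (N u)) = 2" using card_Diff_subset[OF fN sub] nV by simp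
    have "(\<Sum>w\<in>V. W 2 u w) = 9"
      using W_row_sum[OF uw(1), of "monom 1 2"] by (simp add: W_def poly_monom)
    moreover have "(\<Sum>w\<in>V - insert u (N u). W 2 u w) = (\<Sum>w\<in>V. W 2 u w) - (\<Sum>w\<in>insert u (N u). W 2 u w)"
      by (rule sum_diff[OF finite_V sub])
    moreover have "(\<Sum>w\<in>insert u (N u). W 2 u w) = 3 + W 3 u u"
      using N_irrefl[OF uw(1)] fN W_2_refl[OF uw(1)] sum_N_W[OF uw(1,1), of 2] by simp
    ultimately show "(\<Sum>w\<in>V - insert u (N u). W 2 u w) = 2 * int (card (V - insert u (N u)))"
      using t[OF uw(1)] c by simp
    show "2 \<le> W 2 u x" if "x \<in> V - insert u (N u)" for x
    proof -
      have x: "x \<in> V" "x \<noteq> u" "x \<notin> N u" using that by auto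
      then have "u \<notin> N x" using N_sym by blast
      then have s: "N u \<union> N x \<subseteq> V - {u, x}" using x N_irrefl uw(1) N_subset by blast
      have "card (V - {u, x}) = 4" using x uw(1) nV finite_V by (subst card_Diff_subset) auto
      then have "card (N u \<union> N x) \<le> 4" using card_mono[OF _ s] finite_V by simp
      moreover have "card (N u \<union> N x) + card (N u \<inter> N x) = 6"
        using card_Un_Int[OF finite_N[OF uw(1)] finite_N[OF x(1)]] card_N uw(1) x by simp
      ultimately show ?thesis using W_2[OF uw(1) x(1)] by simp
    qed
  qed (use uw in auto)
  let ?g = "\<lambda>i j. 4 * W 1 i j - 2 * W 2 i j"
  obtain u v where uv: "u \<in> V" "v \<in> N u" "v \<in> V" "u \<noteq> v" by (rule obtain_edge)
  \<comment> \<open>Makes \<open>?g\<close> nonzero at an edge, where 4 - 2 W 2 would vanish for W 2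
    = 2.\<close>
  have "W 2 u v \<le> 1"
  proof -
    have "W 3 u v = 5 - W 2 u v + 2" using W3[OF uv(1,3)] W_1[OF uv(1)] uv(2) by simp
    moreover have "5 \<le> W 3 u v" using W_3_edge_ge uv by blast
    moreover have "W 2 u v \<le> 3"
      using W_2[OF uv(1,3)] card_mono[OF finite_N[OF uv(1)], of "N u \<inter> N v"] card_N[OF uv(1)] by simp
    ultimately show ?thesis
      using Z_abs[OF uv(1,3)] unfolding Z1_edge[OF uv(1,2)] diag_values(1)[OF uv(1)] diag_values(1)[OF uv(3)]
        k4[OF uv(1)] k4[OF uv(3)] em by simp
  qed
  then have nz: "?g u v + 0 \<noteq> 0" using W_1[OF uv(1), of v] uv(2) by simp
  show False
  proof (rule L2_no_irrational_pair)
    show "?g u v + 0 \<noteq> 0" by (rule nz)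
    show "u \<in> V" "v \<in> V" "u \<noteq> v" by fact+
    show "W 1 i j = W 1 j i" if "i \<in> V" "j \<in> V" for i j by (rule W_sym[OF that])
    show L1: "L2 (W 1) i j = ?g i j + 0" if "i \<in> V" "j \<in> V" "i \<noteq> j" for i j
      using L2_W_1[OF that] by simp
    show "L2 ?g i j = 10 * ?g i j - 20 * W 1 i j + 12" if ij: "i \<in> V" "j \<in> V" "i \<noteq> j" for i j
    proof -
      have "L2 (W 2) i j = 6 * W 2 i j - 2 * W 3 i j + (if j \<in> N i then 6 - 2 * W 2 i j else 0)"
        using L2_W[OF ij, of 2] W_2_refl ij by simp
      then show ?thesis
        unfolding L2_diff L2_scale L1[OF ij]
        using W3[OF ij(1,2)] W2[of i j] W_1[OF ij(1), of j] ij by (cases "j \<in> N i") auto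
  qed
  show "poly [:20, - 10, 1:] z \<noteq> 0" for z :: int
    by (rule no_int_root_mod[of 3]) code_simp+
  qed
qed

end

section \<open>Bipartite graphs without 4-cycles\<close>

context integral_cubic
begin

text \<open>\<open>F x\<close> is meant as the combination of basis functions with coefficient
  vector \<open>x\<close>, \<open>step\<close> as the matrix of \<open>L2\<close> on coefficients,
  and \<open>c\<close> as the constant that splits off. The annihilation hypothesis then becomes
  arithmetic with coefficients.\<close>

lemma L2_no_integer_root_family:
  fixes F :: "'v \<Rightarrow> 'a \<Rightarrow> 'a \<Rightarrow> int" and step :: "'v \<Rightarrow> 'v" and c :: "'v \<Rightarrow> int"
  assumes L2F: "\<And>x i j. i \<in> V \<Longrightarrow> j \<in> V \<Longrightarrow> i \<noteq> j \<Longrightarrow> L2 (F x) i j = F (step x) i j + c x"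
    and sym: "\<And>i j. i \<in> V \<Longrightarrow> j \<in> V \<Longrightarrow> F x i j = F x j i"
    and nz: "a \<in> V" "b \<in> V" "a \<noteq> b" "F (step x) a b + c x \<noteq> 0"
    and ann: "\<And>i j. (\<Sum>k\<le>degree r. coeff r k * (F ((step ^^ Suc k) x) i j + c ((step ^^ k) x))) = 0"
    and noroot: "\<And>z. poly r z \<noteq> 0"
  shows False
proof (rule L2_no_integer_root[OF sym _ _ noroot])
  have eq: "(L2 ^^ Suc k) (F x) = L2 (F ((step ^^ k) x))" for k
  proof (induction k)
    case (Suc k)
    have "L2 ((L2 ^^ Suc k) (F x)) = L2 (F ((step ^^ Suc k) x))"
    proof (rule L2_cong[of _ _ "c ((step ^^ k) x)"])
      show "(L2 ^^ Suc k) (F x) i j = F ((step ^^ Suc k) x) i j + c ((step ^^ k) x)"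
        if "i \<in> V" "j \<in> V" "i \<noteq> j" for i j
        using Suc.IH L2F[OF that, of "(step ^^ k) x"] by simp
    qed
    then show ?case by (simp only: funpow.simps o_apply)
  qed simp
  show "L2 (F x) a b \<noteq> 0" using L2F[OF nz(1-3)] nz(4) by simp
  show "(\<Sum>k\<le>degree r. coeff r k * (L2 ^^ Suc k) (F x) i j) = 0"
    if "i \<in> V" "j \<in> V" "i \<noteq> j" for i j
    using ann[of i j] unfolding eq L2F[OF that] by simp
qed

lemma W_3_edge_of_W_4:
  assumes "u \<in> V" "v \<in> N u" "W 4 u u = 15"
  shows "W 3 u v = 5"
  by (rule all_eq_of_sum[of "N u"])
    (use assms finite_N card_N W_3_edge_ge edge_sum in simp_all)

text \<open>With 15 closed 4-walks the values x of W 2 u on the rest of the even class have squares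
  summing to 6, and their own sum is 6 as well. So x^2 - x, never negative, is always 0.\<close>

lemma W_2_le_1_of_W_4:
  assumes "u \<in> V" "w \<in> V" "u \<noteq> w" "W 4 u u = 15"
  shows "W 2 u w \<le> 1"
proof (cases "w \<in> Ev u")
  case True
  have nn: "0 \<le> (W 2 u x)\<^sup>2 - W 2 u x" if "x \<in> V" for x
    using W_nonneg[OF assms(1) that, of 2] self_le_power[of "W 2 u x" 2]
    by (cases "W 2 u x = 0") simp_all
  have "(W 2 u w)\<^sup>2 - W 2 u w = 0"
  proof (rule all_eq_of_sum[of "Ev u - {u}"])
    show "finite (Ev u - {u})" using Ev_subset[OF assms(1)] finite_V finite_subset by blast
    show "0 \<le> (W 2 u x)\<^sup>2 - W 2 u x" if "x \<in> Ev u - {u}" for x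
      using nn that Ev_subset[OF assms(1)] by blast
    show "(\<Sum>x\<in>Ev u - {u}. (W 2 u x)\<^sup>2 - W 2 u x) = 0 * int (card (Ev u - {u}))"
      unfolding sum_subtractf sum_W_2_even_class[OF assms(1)] using assms(4) by simp
  qed (use True assms in auto)
  then have "W 2 u w * (W 2 u w - 1) = 0" by (simp add: power2_eq_square algebra_simps)
  then show ?thesis by auto
next
  case False
  then show ?thesis using W_even_0(2)[OF assms(1,2) False] W_sym[OF assms(1,2), of 2] by simp
qed

text \<open>These are the sizes 10, 12 and 15. Without 4-cycles and odd cycles all local counts are
  known, so W 1 to W 4 and \<open>opp\<close> span a space that \<open>L2\<close> preserves modulo
  constants, W 5 being reducible. The matrix \<open>step\<close> depends on the graph only through
  \<open>em\<close>.\<close>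

lemma no_bip_without_4_cycles:
  assumes bip "\<And>v. v \<in> V \<Longrightarrow> W 4 v v = 15"
    and "em = 12 \<or> em = 10 \<or> em = 8"
  shows False
proof -
  define F :: "int \<times> int \<times> int \<times> int \<times> int \<Rightarrow> 'a \<Rightarrow> 'a \<Rightarrow> int" where
    "F = (\<lambda>(a, b, c, d, e) i j. a * W 1 i j + b * W 2 i j + c * W 3 i j + d * W 4 i j + e * opp i j)"
  define step :: "int \<times> int \<times> int \<times> int \<times> int \<Rightarrow> int \<times> int \<times> int \<times> int \<times> int" where
    "step = (\<lambda>(a, b, c, d, e). (4 * a + 6 * b - 10 * c + 38 * d - 2 * e, - 2 * a + 6 * b,
       - 2 * b + 6 * c - 10 * d, - 2 * c + 6 * d, - 2 * em * d + 12 * e))"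
  define k :: "int \<times> int \<times> int \<times> int \<times> int \<Rightarrow> int" where "k = (\<lambda>(a, b, c, d, e). - 6 * e)"
  have notEv: "j \<notin> Ev i" "i \<notin> Ev j" if "i \<in> V" "j \<in> N i" for i j
    using N_Ev[OF Ev_refl that(2)] bip_disjoint[OF assms(1)] Ev_commute that N_in_V by blast+
  have edge: "W 1 i j = 1" "W 2 i j = 0" "W 3 i j = 5" "W 4 i j = 0" if "i \<in> V" "j \<in> N i" for i j
    using W_1[OF that(1)] W_3_edge_of_W_4[OF that assms(2)] that
      W_even_0[OF N_in_V[OF that] that(1) notEv(2)[OF that]] by simp_all
  have diag: "W 2 i i = 3" "W 3 i i = 0" "W 4 i i = 15" if "i \<in> V" for i
    using W_2_refl[OF that] assms(2)[OF that] W_odd_0(2)[OF that that] bip_disjoint[OF assms(1) that] Ev_refl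
    by blast+
  have L2F: "L2 (F x) i j = F (step x) i j + k x" if ij: "i \<in> V" "j \<in> V" "i \<noteq> j" for x i j
  proof -
    obtain a b c d e where x: "x = (a, b, c, d, e)" by (cases x)
    have "opp j i = opp i j" using Od_commute[OF ij(1,2)] by (simp add: opp_def)
    then have 5: "W 5 i j = 5 * W 3 i j - 4 * W 1 i j + em * opp i j"
      using W_5[OF ij(1,2)] by (auto simp: opp_def)
    have 2: "L2 (W 2) i j = 6 * W 2 i j - 2 * W 3 i j + 6 * W 1 i j"
      using L2_W[OF ij, of 2] edge[OF ij(1), of j] diag ij W_1[OF ij(1), of j] by simp
    have 3: "L2 (W 3) i j = 6 * W 3 i j - 2 * W 4 i j - 10 * W 1 i j"
      using L2_W[OF ij, of 3] edge[OF ij(1), of j] diag ij W_1[OF ij(1), of j] by simp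
    have 4: "L2 (W 4) i j = 6 * W 4 i j - 2 * W 5 i j + 30 * W 1 i j"
      using L2_W[OF ij, of 4] edge[OF ij(1), of j] diag ij W_1[OF ij(1), of j] by simp
    show ?thesis
      unfolding F_def x case_prod_conv L2_add L2_scale L2_W_1[OF ij] 2 3 4 5 L2_opp[OF assms(1) ij]
      by (simp add: step_def k_def algebra_simps)
  qed
  have sym: "F x i j = F x j i" if "i \<in> V" "j \<in> V" for x i j
    using W_sym[OF that] Od_commute[OF that] by (cases x) (simp add: F_def opp_def)
  obtain u v where uv: "u \<in> V" "v \<in> N u" "v \<in> V" "u \<noteq> v" by (rule obtain_edge)
  have nzE: "F x u v = a + 5 * c + e" if "x = (a, b, c, d, e)" for x a b c d e
    using edge[OF uv(1,2)] N_Ev[OF Ev_refl uv(2)] by (simp add: F_def that opp_def)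
  \<comment> \<open>A pair at distance two serves the case em = 12, where \<open>L2\<close> of the
    start function has the value -20 + 5 * 4 = 0 on every edge.\<close>
  obtain w where w: "w \<in> N v" "w \<noteq> u"
  proof -
    have "N v \<noteq> {u}" using card_N[OF uv(3)] by auto
    moreover have "u \<in> N v" using N_sym uv by blast
    ultimately show thesis using that by blast
  qed
  have wV: "w \<in> V" using w uv N_in_V by blast
  have wE: "w \<in> Ev u" using Ev_step[OF uv(1) Ev_refl uv(2) w(1)] .
  then have wO: "w \<notin> Od u" using bip_disjoint[OF assms(1) uv(1)] by blast
  have "W 2 u w \<noteq> 0"
  proof -
    have "v \<in> N u \<inter> N w" using uv w N_sym by blast
    then have "card (N u \<inter> N w) \<noteq> 0" using finite_N[OF uv(1)] by auto
    then show ?thesis using W_2[OF uv(1) wV] by simp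
  qed
  moreover have "W 1 u w = 0" "W 3 u w = 0"
    using W_odd_0[OF uv(1) wV wO] W_sym[OF uv(1) wV] by simp_all
  ultimately have nzD: "F x u w \<noteq> 0" if "x = (a, b, c, 0, e)" "b \<noteq> 0" for x a b c e
    using that wO by (simp add: F_def opp_def)
  from assms(3) show False
  proof (elim disjE)
    assume em: "em = 12"
    \<comment> \<open>The start vector is (L2 - 6) W 1: it splits off the integer root 6 of the
      characteristic polynomial of \<open>step\<close> and leaves the quartic.\<close>
    show False
    proof (rule L2_no_integer_root_family[of F step k "(-2, -2, 0, 0, 0)" u w "[:1216, -1008, 268, -28, 1:]", OF L2F sym])
      show "F (step (-2, -2, 0, 0, 0)) u w + k (-2, -2, 0, 0, 0) \<noteq> 0"
        using nzD by (simp add: step_def k_def)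
      show "poly [:1216, -1008, 268, -28, 1:] z \<noteq> 0" for z :: int
        by (rule no_int_root_mod[of 3]) code_simp+
    qed (use uv wV w in \<open>simp_all add: eval_nat_numeral step_def k_def em F_def algebra_simps\<close>)
  next
    assume em: "em = 10"
    show False
    proof (rule L2_no_integer_root_family[of F step k "(1, 0, 0, 0, 0)" u v "[:-7360, 7264, -2616, 436, -34, 1:]", OF L2F sym])
      show "F (step (1, 0, 0, 0, 0)) u v + k (1, 0, 0, 0, 0) \<noteq> 0"
        using nzE by (simp add: step_def k_def)
      show "poly [:-7360, 7264, -2616, 436, -34, 1:] z \<noteq> 0" for z :: int
        by (rule no_int_root_mod[of 3]) code_simp+
    qed (use uv in \<open>simp_all add: eval_nat_numeral step_def k_def em F_def algebra_simps\<close>)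
  next
    assume em: "em = 8"
    \<comment> \<open>The start vector is (L2 - 4)(L2 - 8) W 1, which splits off the integer roots 4
      and 8 and leaves the cubic.\<close>
    show False
    proof (rule L2_no_integer_root_family[of F step k "(-12, 4, 4, 0, 0)" u v "[:-232, 140, -22, 1:]", OF L2F sym])
      show "F (step (-12, 4, 4, 0, 0)) u v + k (-12, 4, 4, 0, 0) \<noteq> 0"
        using nzE by (simp add: step_def k_def)
      show "poly [:-232, 140, -22, 1:] z \<noteq> 0" for z :: int
        by (rule no_int_root_mod[of 3]) code_simp+
    qed (use uv in \<open>simp_all add: eval_nat_numeral step_def k_def em F_def algebra_simps\<close>)
  qed
qed

end

section \<open>The truncated tetrahedron\<close>

context integral_cubic
begin

text \<open>Every vertex lies on one triangle and there are no 4-cycles. The polynomial x (x + 1)(x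
  - 2)(x + 2) has constant rows with entry 60 / 12 = 5 and removes W 4. The space closes up only
  after edges on triangles are told apart from the others.\<close>

lemma no_truncated_tetrahedron:
  assumes "\<not> bip" "sz = 12"
  shows False
proof -
  have em: "em = 10" using em_unique assms by simp
  have k4: "W 4 v v = 15" if "v \<in> V" for v using sz_cases[OF that] assms by simp
  have nV: "card V = 12" using assms by (simp add: sz_def)
  have t: "W 3 v v = 2" if "v \<in> V" for v
    using W_3_diag_of_nonbip[OF assms(1) that] even_W_3_diag[OF that]
    unfolding diag_values(1)[OF that] k4[OF that] em by presburger
  have Ev: "u \<in> Ev v" "u \<in> Od v" if "u \<in> V" "v \<in> V" for u v using not_bip[OF assms(1) that(2)] that by auto
  note edge3 = W_3_edge_of_W_4[OF _ _ k4]
  note le1 = W_2_le_1_of_W_4[OF _ _ _ k4]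
  define p :: "int poly" where "p = [:0, -4, -4, 1, 1:]"
  have W4: "W 4 u w = 5 - W 3 u w + 4 * W 2 u w + 4 * W 1 u w" if uw: "u \<in> V" "w \<in> V" for u w
  proof -
    define p2 :: "int poly" where "p2 = [:0, 72, 52, -66, -41, 12, 7:]"
    have "PA (p * p) u u = PA p2 u u"
      by (rule PA_mod_mu[OF uw(1,1), of _ _ "[:2, 1:]"]) (simp add: p_def p2_def mu_def)
    also have "\<dots> = 72 * W 1 u u + 52 * W 2 u u - 66 * W 3 u u - 41 * W 4 u u + 12 * W 5 u u + 7 * W 6 u u"
      unfolding p2_def by (simp add: W_expand eval_nat_numeral)
    finally have "PA (p * p) u u = 300"
      using W_5[OF uw(1,1)] W_6[OF uw(1,1)] Ev[OF uw(1,1)] t[OF uw(1)] k4[OF uw(1)] W_2_refl[OF uw(1)]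
        W_1[OF uw(1), of u] N_irrefl[OF uw(1)] em by simp
    then have "PA p u w = 5"
      using nV by (intro constant_row[OF uw(1) _ uw(2)]) (simp add: p_def)
    then show ?thesis unfolding p_def by (simp add: W_expand eval_nat_numeral)
  qed
  \<comment> \<open>The indicator of the edges on a triangle: by \<open>le1\<close>, W 2 is 0 or 1
    on an edge.\<close>
  define T where "T = (\<lambda>i j. W 1 i j * W 2 i j)"
  have T_restrict: "(\<Sum>k\<in>N i. T k j) = (\<Sum>k\<in>N i \<inter> N j. W 2 k j)" if "i \<in> V" "j \<in> V" for i j
  proof -
    have "(\<Sum>k\<in>N i. T k j) = (\<Sum>k\<in>N i. if k \<in> N j then W 2 k j else 0)"
    proof (rule sum.cong[OF refl])
      fix k assume "k \<in> N i"
      then have "k \<in> V" using N_in_V that by blast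
      then show "T k j = (if k \<in> N j then W 2 k j else 0)"
        using W_1[of k j] N_commute[OF _ that(2), of k] by (auto simp: T_def)
    qed
    then show ?thesis using sum.inter_restrict[OF finite_N[OF that(1)], of "\<lambda>k. W 2 k j" "N j"] by simp
  qed
  have T_sym: "T i j = T j i" if "i \<in> V" "j \<in> V" for i j
    using W_sym[OF that, of 1] W_sym[OF that, of 2] by (simp add: T_def)
  have adjacent_common: "1 \<le> W 2 x y" if "z \<in> N x" "z \<in> N y" "x \<in> V" "y \<in> V" for x y z
  proof -
    have "card (N x \<inter> N y) \<noteq> 0" using that finite_N[OF that(3)] by auto
    then show ?thesis using W_2[OF that(3,4)] by simp
  qed
  \<comment> \<open>All terms come from the common neighbour k of i and j, unique if it exists. Of
    the three edges at k exactly two lie on its triangle: ki and kj if i and j are adjacent, and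
    otherwise the third edge together with one of ki and kj.\<close>
  have AT: "(\<Sum>k\<in>N i. T k j) + (\<Sum>k\<in>N j. T i k) = T i j + W 2 i j"
    if ij: "i \<in> V" "j \<in> V" "i \<noteq> j" for i j
  proof -
    have "(\<Sum>k\<in>N j. T i k) = (\<Sum>k\<in>N j. T k i)"
      using N_in_V[OF ij(2)] by (intro sum.cong refl T_sym[OF ij(1)])
    then have sums: "(\<Sum>k\<in>N i. T k j) + (\<Sum>k\<in>N j. T i k)
      = (\<Sum>k\<in>N i \<inter> N j. W 2 k j) + (\<Sum>k\<in>N i \<inter> N j. W 2 k i)"
      using T_restrict[OF ij(1,2)] T_restrict[OF ij(2,1)] by (simp add: Int_commute)
    have card: "int (card (N i \<inter> N j)) = W 2 i j" using W_2[OF ij(1,2)] by simp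
    consider "N i \<inter> N j = {}" | k where "N i \<inter> N j = {k}"
    proof -
      have "card (N i \<inter> N j) \<le> 1" using le1[OF ij ij(1)] card by simp
      then have "card (N i \<inter> N j) = 0 \<or> card (N i \<inter> N j) = 1" by linarith
      then show thesis using that finite_N[OF ij(1)] by (auto simp: card_1_singleton_iff)
    qed
    then show ?thesis
    proof cases
      case 1
      then show ?thesis unfolding sums using card by (simp add: T_def)
    next
      case 2
      then have k: "k \<in> N i" "k \<in> N j" by blast+
      have kV: "k \<in> V" using N_in_V[OF ij(1) k(1)] .
      have ik: "i \<in> N k" "j \<in> N k" using k ij N_sym by blast+
      have ne: "k \<noteq> i" "k \<noteq> j" using N_irrefl k ij by blast+
      have W2: "W 2 i j = 1" using card 2 by simp
      have le: "W 2 k i \<le> 1" "W 2 k j \<le> 1" using le1[OF kV ij(1) ne(1) kV] le1[OF kV ij(2) ne(2) kV] .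
      have "W 2 k j + W 2 k i = W 1 i j + 1"
      proof (cases "j \<in> N i")
        case True
        then have "i \<in> N j" using ij N_sym by blast
        then have "1 \<le> W 2 k j" "1 \<le> W 2 k i"
          using adjacent_common[OF ik(1) _ kV ij(2)] adjacent_common[OF ik(2) _ kV ij(1)] True by blast+
        then show ?thesis using le True W_1[OF ij(1), of j] by simp
      next
        case False
        obtain l where l: "N k = {i, j, l}" "l \<noteq> i" "l \<noteq> j"
        proof -
          have "card (N k - {i, j}) = 1" using ik ij(3) card_N[OF kV] finite_N[OF kV] by simp
          then obtain l where "N k - {i, j} = {l}" by (auto simp: card_1_singleton_iff)
          then show thesis using that[of l] ik by blast
        qed
        have lV: "l \<in> V" using l N_in_V[OF kV] by blast
        have lk: "l \<noteq> k" using l N_irrefl[OF kV] by blast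
        have kl: "k \<in> N l" using l N_sym[OF kV] by blast
        have s: "W 2 k i + W 2 k j + W 2 k l = 2"
          using sum_N_W[OF kV kV, of 2] t[OF kV] l ij(3) by simp
        have "W 2 k l \<le> 1" using le1[OF kV lV lk[symmetric] kV] .
        moreover have "W 2 k l \<noteq> 0"
        proof
          assume 0: "W 2 k l = 0"
          then have "W 2 k i = 1" using s le by simp
          then have "card (N k \<inter> N i) \<noteq> 0" using W_2[OF kV ij(1)] by simp
          then have "N k \<inter> N i \<noteq> {}" by (metis card.empty)
          then obtain c where c: "c \<in> N k" "c \<in> N i" by blast
          have "c \<in> {i, j, l}" using c(1) unfolding l(1) .
          moreover have "c \<noteq> i" "c \<noteq> j" using c(2) False N_irrefl[OF ij(1)] by metis+
          ultimately have "c = l" by simp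
          then have "i \<in> N l" using N_sym[OF ij(1) c(2)] by simp
          then have "1 \<le> W 2 k l" by (rule adjacent_common[OF ik(1) _ kV lV])
          with 0 show False by simp
        qed
        moreover have "0 \<le> W 2 k l" using W_nonneg[OF kV lV] .
        ultimately show ?thesis using s W_1[OF ij(1), of j] False by simp
      qed
      then show ?thesis unfolding sums 2 using W2 by (simp add: T_def)
    qed
  qed
  define F :: "int \<times> int \<times> int \<times> int \<Rightarrow> 'a \<Rightarrow> 'a \<Rightarrow> int" where
    "F = (\<lambda>(a, b, c, e) i j. a * W 1 i j + b * W 2 i j + c * W 3 i j + e * T i j)"
  define step :: "int \<times> int \<times> int \<times> int \<Rightarrow> int \<times> int \<times> int \<times> int" where
    "step = (\<lambda>(a, b, c, e). (4 * a + 6 * b - 14 * c, - 2 * a + 6 * b - 8 * c - e, - 2 * b + 8 * c, - 2 * b + 3 * e))"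
  define k :: "int \<times> int \<times> int \<times> int \<Rightarrow> int" where "k = (\<lambda>(a, b, c, e). - 10 * c)"
  have L2F: "L2 (F x) i j = F (step x) i j + k x" if ij: "i \<in> V" "j \<in> V" "i \<noteq> j" for x i j
  proof -
    obtain a b c e where x: "x = (a, b, c, e)" by (cases x)
    have 2: "L2 (W 2) i j = 6 * W 2 i j - 2 * W 3 i j + 6 * W 1 i j - 2 * T i j"
      using L2_W[OF ij, of 2] W_2_refl ij W_1[OF ij(1), of j] by (simp add: T_def)
    have 3: "L2 (W 3) i j = 8 * W 3 i j - 8 * W 2 i j - 14 * W 1 i j - 10"
      using L2_W[OF ij, of 3] edge3[OF ij(1), of j] t ij W_1[OF ij(1), of j] W4[OF ij(1,2)] by simp
    have "T v v = 0" if "v \<in> V" for v using W_1[OF that] N_irrefl[OF that] by (simp add: T_def)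
    moreover have "T i j = 0" if "j \<notin> N i" using that W_1[OF ij(1), of j] by (simp add: T_def)
    ultimately have 4: "L2 T i j = 3 * T i j - W 2 i j"
      using L2_formula[OF ij, of T] AT[OF ij] ij by (cases "j \<in> N i") simp_all
    show ?thesis
      unfolding F_def x case_prod_conv L2_add L2_scale L2_W_1[OF ij] 2 3 4
      by (simp add: step_def k_def algebra_simps)
  qed
  have sym: "F x i j = F x j i" if "i \<in> V" "j \<in> V" for x i j
    using W_sym[OF that] T_sym[OF that] by (cases x) (simp add: F_def)
  obtain u v where uv: "u \<in> V" "v \<in> N u" "v \<in> V" "u \<noteq> v" by (rule obtain_edge)
  \<comment> \<open>The quartic is the characteristic polynomial of \<open>step\<close>.\<close>
  show False
  proof (rule L2_no_integer_root_family[of F step k "(1, 0, 0, 0)" u v "[:440, -444, 152, -21, 1:]", OF L2F sym])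
    show "F (step (1, 0, 0, 0)) u v + k (1, 0, 0, 0) \<noteq> 0"
      using le1[OF uv(1,3,4,1)] W_1[OF uv(1), of v] uv(2) by (simp add: step_def k_def F_def)
    show "poly [:440, -444, 152, -21, 1:] z \<noteq> 0" for z :: int
      by (rule no_int_root_mod[of 3]) code_simp+
  qed (use uv in \<open>simp_all add: eval_nat_numeral step_def k_def F_def algebra_simps\<close>)
qed

end

section \<open>Class size 5: ten vertices, bipartite\<close>

context cubic_graph
begin

text \<open>On products of one-token functions the tokens move independently. The condition
  \<open>ab\<close> removes the diagonal terms of \<open>L2_formula\<close>, so only a correction on
  edges remains.\<close>

lemma L2_tensor:
  fixes a b :: "'a \<Rightarrow> int"
  assumes ij: "i \<in> V" "j \<in> V" "i \<noteq> j" and ab: "a i * b i = 0" "a j * b j = 0"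
  shows "L2 (\<lambda>i j. a i * b j + b i * a j) i j = 6 * (a i * b j + b i * a j)
    - (adj a i * b j + b i * adj a j) - (a i * adj b j + adj b i * a j)
    - (if j \<in> N i then 2 * (a i * b j + b i * a j) else 0)"
proof -
  have "(\<Sum>k\<in>N i. a k * b j + b k * a j) = adj a i * b j + adj b i * a j"
    using ij by (simp add: adj_def sum.distrib sum_distrib_right)
  moreover have "(\<Sum>k\<in>N j. a i * b k + b i * a k) = a i * adj b j + b i * adj a j"
    using ij by (simp add: adj_def sum.distrib sum_distrib_left)
  ultimately show ?thesis
    unfolding L2_formula[OF ij] using ab by (auto simp: algebra_simps)
qed

lemma adj_delta: "x \<in> V \<Longrightarrow> adj (delta x) i = (if i \<in> N x then 1 else 0 :: int)"
proof -
  assume x: "x \<in> V"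
  have "(\<Sum>k\<in>N i. delta x k) = (if x \<in> N i then 1 else 0 :: int)" if "i \<in> V"
    using finite_N[OF that] by (simp add: delta_def)
  then show ?thesis using x N_commute[of i x] N_in_V[OF x, of i] by (auto simp: adj_def)
qed

lemma adj_delta_diff:
  assumes "x \<in> V" "y \<in> V"
  shows "adj (\<lambda>k. delta x k - delta y k) i = (if i \<in> N x then 1 else 0) - (if i \<in> N y then 1 else 0 :: int)"
proof -
  have eq: "(\<lambda>k. delta x k - delta y k) = (\<lambda>k. delta x k + (- 1) * delta y k :: int)" by simp
  show ?thesis
    unfolding eq adj.op_add adj.op_scale adj_delta[OF assms(1)] adj_delta[OF assms(2)] by simp
qed

end

context integral_cubic
begin

text \<open>Some vertex u has a twin w with the same neighbourhood, so the difference of their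
  indicators is annihilated by A. The remaining structure yields two further differences exchanged
  by A; their tensor products with the first one give the eigenvalues 5 plus or minus sqrt
  2.\<close>

lemma no_sz_5: "sz \<noteq> 5"
proof
  assume sz: "sz = 5"
  have bip: bip
  proof (rule ccontr)
    assume "\<not> bip"
    then have "card V = 5" using sz by (simp add: sz_def)
    then show False using even_card_V by simp
  qed
  have em: "em = 24" using em_unique sz by simp
  have k4: "W 4 v v = 19 \<or> W 4 v v = 21" if "v \<in> V" for v using sz_cases[OF that] sz by auto
  \<comment> \<open>The value 19 everywhere would need an edge with at least seven 3-walks, which
    the bound from the eigenvalues 2 and -2 forbids.\<close>
  have "\<exists>u\<in>V. W 4 u u = 21"
  proof (rule ccontr)
    assume "\<not> ?thesis"
    then have k: "W 4 v v = 19" if "v \<in> V" for v using k4[OF that] that by blast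
    obtain u where u: "u \<in> V" using V_nonempty by blast
    have "W 3 u v \<le> 6" if "v \<in> N u" for v
    proof -
      have v: "v \<in> V" using u that N_in_V by blast
      show ?thesis
        using Y_abs[OF u v] unfolding Y1_edge[OF u that] diag_values(2)[OF u] diag_values(2)[OF v] k[OF u] k[OF v] em
        by presburger
    qed
    then have "(\<Sum>v\<in>N u. W 3 u v) \<le> (\<Sum>v\<in>N u. 6)" by (rule sum_mono)
    then show False using edge_sum[OF u] k[OF u] card_N[OF u] by simp
  qed
  then obtain u where u: "u \<in> V" "W 4 u u = 21" by blast
  have finE: "finite (Ev u)" using Ev_subset[OF u(1)] finite_V finite_subset by blast
  have "\<exists>w\<in>Ev u - {u}. W 2 u w = 3"
  proof (rule ccontr)
    assume no: "\<not> ?thesis"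
    \<comment> \<open>Without the value 3 all four entries are roots of (x - 1)(x - 2), but the sum
      of this polynomial over them is 12 - 18 + 8 = 2.\<close>
    have "(W 2 u w)\<^sup>2 - 3 * W 2 u w + 2 = 0" if w: "w \<in> Ev u - {u}" for w
    proof -
      have wV: "w \<in> V" using w Ev_subset[OF u(1)] by blast
      have "1 \<le> W 2 u w" using W_2_lower_bound[OF u(1), of w] w sz by simp
      moreover have "W 2 u w \<le> 3"
        using W_2[OF u(1) wV] card_mono[OF finite_N[OF u(1)], of "N u \<inter> N w"] card_N[OF u(1)] by simp
      moreover have "W 2 u w \<noteq> 3" using no w by blast
      ultimately have "W 2 u w = 1 \<or> W 2 u w = 2" by linarith
      then show ?thesis by auto
    qed
    then have "(\<Sum>w\<in>Ev u - {u}. (W 2 u w)\<^sup>2 - 3 * W 2 u w + 2) = 0" by (intro sum.neutral) simp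
    then show False
      using sum_W_2_even_class[OF u(1)] u(2) sz by (simp add: sum.distrib sum_subtractf flip: sum_distrib_left)
  qed
  then obtain w where w: "w \<in> Ev u" "w \<noteq> u" "W 2 u w = 3" by blast
  have wV: "w \<in> V" using w Ev_subset[OF u(1)] by blast
  have Nw: "N w = N u"
  proof -
    have "card (N u \<inter> N w) = 3" using w(3) W_2[OF u(1) wV] by simp
    then have "N u \<inter> N w = N u"
      using card_subset_eq[OF finite_N[OF u(1)], of "N u \<inter> N w"] card_N[OF u(1)] by simp
    then have "N u \<subseteq> N w" by blast
    then show ?thesis
      using card_subset_eq[OF finite_N[OF wV], of "N u"] card_N[OF u(1)] card_N[OF wV] by simp
  qed
  have disj: "Ev u \<inter> Od u = {}" by (rule bip_disjoint[OF bip u(1)])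
  have NO: "N u \<subseteq> Od u" using N_Ev[OF Ev_refl] by blast
  have finO: "finite (Od u)" using Od_subset[OF u(1)] finite_V finite_subset by blast
  have "card (Od u - N u) = 2"
    using card_Diff_subset[OF finite_N[OF u(1)] NO] class_card[OF u(1)] sz card_N[OF u(1)] by simp
  then obtain x1 x2 where x: "Od u - N u = {x1, x2}" "x1 \<noteq> x2" by (auto simp: card_2_iff)
  have cE: "card (Ev u - {u, w}) = 3"
    using w Ev_refl[of u] finE class_card[OF u(1)] sz by (subst card_Diff_subset) auto
  have Nx: "N y = Ev u - {u, w}" if "y \<in> {x1, x2}" for y
  proof -
    have y: "y \<in> Od u" "y \<notin> N u" using that x(1) by blast+
    have yV: "y \<in> V" using y Od_subset[OF u(1)] by blast
    have "u \<notin> N y" "w \<notin> N y" using y(2) N_sym[OF yV] Nw by blast+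
    then have "N y \<subseteq> Ev u - {u, w}" using N_Od[OF u(1) y(1)] by blast
    then show ?thesis
      using card_subset_eq[of "Ev u - {u, w}" "N y"] finE cE card_N[OF yV] by simp
  qed
  obtain y1 y2 where y: "y1 \<in> N u" "y2 \<in> N u" "y1 \<noteq> y2"
    using card_N[OF u(1)] by (auto simp: card_3_iff)
  have xV: "x1 \<in> V" "x2 \<in> V" using x(1) Od_subset[OF u(1)] by blast+
  \<comment> \<open>The vertices x1 and x2 are adjacent to all even vertices except u and w. So a
    neighbour y of u has one further neighbour z, whose neighbours are x1, x2 and y.\<close>
  have third: "\<exists>z. N y = {u, w, z} \<and> N z = {x1, x2, y} \<and> z \<in> Ev u \<and> z \<noteq> u \<and> z \<noteq> w"
    if yu: "y \<in> N u" for y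
  proof -
    have yV: "y \<in> V" by (rule N_in_V[OF u(1) yu])
    have "u \<in> N y" "w \<in> N y" using yu N_sym[OF u(1)] N_sym[OF wV] Nw by simp_all
    then have uw: "{u, w} \<subseteq> N y" by simp
    have "card (N y - {u, w}) = 1"
      using card_Diff_subset[OF _ uw] card_N[OF yV] w(2) by simp
    then obtain z where z: "N y - {u, w} = {z}" by (auto simp: card_1_singleton_iff)
    have "N y = {u, w} \<union> (N y - {u, w})" using uw by auto
    then have Ny: "N y = {u, w, z}" unfolding z by (simp add: insert_commute)
    have "z \<in> N y - {u, w}" unfolding z by simp
    then have zN: "z \<in> N y" "z \<noteq> u" "z \<noteq> w" by simp_all
    have zE: "z \<in> Ev u" by (rule Ev_step[OF u(1) Ev_refl yu zN(1)])
    have zV: "z \<in> V" using zE Ev_subset[OF u(1)] by (rule rev_subsetD)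
    have "y \<in> N z" by (rule N_sym[OF yV zN(1)])
    moreover have "x1 \<in> N z" "x2 \<in> N z"
      using N_sym[OF xV(1), of z] N_sym[OF xV(2), of z] Nx[of x1] Nx[of x2] zE zN by simp_all
    moreover have "y \<noteq> x1" "y \<noteq> x2" using x(1) yu by blast+
    ultimately have "N z = {x1, x2, y}"
      using card_subset_eq[OF finite_N[OF zV], of "{x1, x2, y}"] card_N[OF zV] x(2) by simp
    then show ?thesis using Ny zE zN by (intro exI[of _ z]) simp
  qed
  obtain z1 where z1: "N y1 = {u, w, z1}" "N z1 = {x1, x2, y1}" "z1 \<in> Ev u" "z1 \<noteq> u" "z1 \<noteq> w"
    using third[OF y(1)] by (elim exE conjE)
  obtain z2 where z2: "N y2 = {u, w, z2}" "N z2 = {x1, x2, y2}" "z2 \<in> Ev u" "z2 \<noteq> u" "z2 \<noteq> w"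
    using third[OF y(2)] by (elim exE conjE)
  have yx: "y1 \<noteq> x1" "y1 \<noteq> x2" "y2 \<noteq> x1" "y2 \<noteq> x2" using x(1) y by blast+
  have V: "y1 \<in> V" "y2 \<in> V" "z1 \<in> V" "z2 \<in> V"
    using y N_in_V[OF u(1)] z1(3) z2(3) Ev_subset[OF u(1)] by blast+
  have ne: "y1 \<noteq> u" "y1 \<noteq> w" "y2 \<noteq> u" "y2 \<noteq> w" "z1 \<noteq> y1" "z1 \<noteq> y2" "z2 \<noteq> y1" "z2 \<noteq> y2"
    using y N_irrefl u(1) wV Nw z1(3) z2(3) disj NO by blast+
  have zu: "z1 \<notin> N u" "z2 \<notin> N u" using z1(3) z2(3) disj NO by blast+
  \<comment> \<open>The neighbourhoods of u and w agree, those of y1 and y2 differ only in z1 and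
    z2, and those of z1 and z2 only in y1 and y2. So A annihilates \<open>a\<close> and exchanges
    \<open>b\<close> and \<open>c\<close>.\<close>
  define a where "a = (\<lambda>k. delta u k - delta w k :: int)"
  define b where "b = (\<lambda>k. delta y1 k - delta y2 k :: int)"
  define c where "c = (\<lambda>k. delta z1 k - delta z2 k :: int)"
  have adja: "adj a i = 0" for i
    unfolding a_def adj_delta_diff[OF u(1) wV] Nw by simp
  have adjb: "adj b i = c i" for i
    unfolding b_def c_def adj_delta_diff[OF V(1,2)] z1(1) z2(1) using z1 z2 by (auto simp: delta_def)
  have adjc: "adj c i = b i" for i
    unfolding b_def c_def adj_delta_diff[OF V(3,4)] z1(2) z2(2) using yx by (auto simp: delta_def)
  have a0: "a k = 0" if "k \<noteq> u" "k \<noteq> w" for k using that by (simp add: a_def delta_def)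
  have b0: "b k = 0" if "k \<noteq> y1" "k \<noteq> y2" for k using that by (simp add: b_def delta_def)
  have c0: "c k = 0" if "k \<noteq> z1" "k \<noteq> z2" for k using that by (simp add: c_def delta_def)
  have ab: "a k * b k = 0" for k using a0[of k] b0[of k] ne by (cases "k = u \<or> k = w") auto
  have ac: "a k * c k = 0" for k using a0[of k] c0[of k] z1(4,5) z2(4,5) by (cases "k = u \<or> k = w") auto
  let ?f = "\<lambda>i j. a i * b j + b i * a j" and ?s = "\<lambda>i j. a i * c j + c i * a j"
  have in_N: "j \<in> N i" if "i = u \<or> i = w" "j = y1 \<or> j = y2" for i j using that y Nw by auto
  have notin_N: "j \<notin> N i" if "i = u \<or> i = w" "j = z1 \<or> j = z2" for i j using that zu Nw by auto
  have f_edge: "?f i j = 0" if "j \<notin> N i" "i \<in> V" "j \<in> V" for i j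
  proof -
    have "i \<notin> N j" using that N_sym by blast
    then have "a i * b j = 0" "b i * a j = 0"
      using in_N[of i j] in_N[of j i] a0[of i] b0[of j] a0[of j] b0[of i] that(1) by auto
    then show ?thesis by (simp only: add_0)
  qed
  have s_edge: "?s i j = 0" if "j \<in> N i" "i \<in> V" "j \<in> V" for i j
  proof -
    have "i \<in> N j" using that N_sym by blast
    then have "a i * c j = 0" "c i * a j = 0"
      using notin_N[of i j] notin_N[of j i] a0[of i] c0[of j] a0[of j] c0[of i] that(1) by auto
    then show ?thesis by (simp only: add_0)
  qed
  have Lf: "L2 ?f i j = 4 * ?f i j - ?s i j" if ij: "i \<in> V" "j \<in> V" "i \<noteq> j" for i j
    unfolding L2_tensor[OF ij ab ab] adja adjb using f_edge[OF _ ij(1,2)] by (cases "j \<in> N i") simp_all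
  have Ls: "L2 ?s i j = 6 * ?s i j - ?f i j" if ij: "i \<in> V" "j \<in> V" "i \<noteq> j" for i j
    unfolding L2_tensor[OF ij ac ac] adja adjc using s_edge[OF _ ij(1,2)] by (cases "j \<in> N i") simp_all
  let ?g = "\<lambda>i j. 4 * ?f i j - ?s i j"
  show False
  proof (rule L2_no_irrational_pair[of ?f u y1 ?g 0 10 23 0])
    show "?g u y1 + 0 \<noteq> 0"
      using w(2) y(3) ne by (simp add: a_def b_def c_def delta_def)
    show "L2 ?g i j = 10 * ?g i j - 23 * ?f i j + 0" if "i \<in> V" "j \<in> V" "i \<noteq> j" for i j
      unfolding L2_diff L2_scale Lf[OF that] Ls[OF that] by simp
    show "poly [:23, - 10, 1:] z \<noteq> 0" for z :: int
      by (rule no_int_root_mod[of 3]) code_simp+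
  qed (use Lf u V ne in \<open>simp_all add: algebra_simps\<close>)
qed

end

section \<open>The hexagonal prism\<close>

context integral_cubic
begin

text \<open>
  The projection to the eigenvalue 1, applied to a vertex, is up to scaling a signing of the vertices that
  distinguishes the two hexagons; \<open>R u\<close> and \<open>rg u\<close> are the neighbours of \<open>u\<close> on the same and on
  the other hexagon.
\<close>

lemma hexagonal_prism_signing:
  assumes bip "sz = 6"
  obtains e :: "'a \<Rightarrow> int" where "\<forall>x\<in>V. e x = 1 \<or> e x = - 1"
    "\<forall>u\<in>V. \<forall>v\<in>N u. W 3 u v = 6 \<and> e v = e u \<or> W 3 u v = 7 \<and> e v = - e u"
    "\<forall>i\<in>V. card {x \<in> Ev i. e x = e i} = 3"
proof -
  have em: "em = 20" using em_unique assms by simp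
  have k4: "W 4 v v = 19" if "v \<in> V" for v using sz_cases[OF that] assms by simp
  have Zd: "PA Zp v v = 4" if "v \<in> V" for v unfolding diag_values[OF that] k4[OF that] em by simp
  obtain z where z: "z \<in> V" using V_nonempty by blast
  define d where "d = (\<lambda>x. PA Zp x z + PA Z1p x z)"
  have step: "W 3 u v = 6 \<and> d v = d u \<or> W 3 u v = 7 \<and> d v = - d u" if u: "u \<in> V" and uv: "v \<in> N u" for u v
  proof -
    have v: "v \<in> V" "u \<in> N v" using u uv N_in_V N_sym by blast+
    have Z1: "PA Z1p u v = 52 - 8 * W 3 u v" "PA Z1p v u = 52 - 8 * W 3 u v"
      using Z1_edge[OF u uv] Z1_edge[OF v] em W_sym[OF u v(1), of 3] by simp_all
    have "\<bar>52 - 8 * W 3 u v\<bar> \<le> 4"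
      using Z_abs[OF u v(1)] unfolding Zd[OF u] Zd[OF v(1)] Z1 by simp
    then have "W 3 u v = 6 \<or> W 3 u v = 7" by presburger
    \<comment> \<open>The case of equality in the entry bound: the squared length is 0, so the two
      rows agree up to sign.\<close>
    moreover have gram0: "PA Zp a w + s * PA Z1p b w = 0"
      if "a \<in> V" "b \<in> V" "s\<^sup>2 = 1" "PA Z1p a b = - 4 * s" "w \<in> V" for a b w s
    proof -
      have "s * s = 1" using that(3) by (simp add: power2_eq_square)
      then have "(\<Sum>w\<in>V. (PA Zp a w + s * PA Z1p b w)\<^sup>2) = 0"
        unfolding Z_gram[OF that(1-3)] Zd[OF that(1)] Zd[OF that(2)] that(4) by simp
      then have "\<forall>w\<in>V. (PA Zp a w + s * PA Z1p b w)\<^sup>2 = 0"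
        using finite_V by (intro sum_nonneg_eq_0_iff[THEN iffD1]) auto
      then show ?thesis using that(5) by simp
    qed
    moreover have "d v = d u" if "W 3 u v = 6"
      using gram0[OF u v(1), of "- 1" z] gram0[OF v(1) u, of "- 1" z] that Z1 z by (simp add: d_def)
    moreover have "d v = - d u" if "W 3 u v = 7"
      using gram0[OF u v(1), of 1 z] gram0[OF v(1) u, of 1 z] that Z1 z by (simp add: d_def)
    ultimately show ?thesis by blast
  qed
  have notOd: "x \<notin> Od z" if "x \<in> Ev z" for x using bip_disjoint[OF assms(1) z] that by blast
  have notEv: "x \<notin> Ev z" if "x \<in> Od z" for x using bip_disjoint[OF assms(1) z] that by blast
  have Z0: "PA Zp x z = 0" if "x \<in> V" "x \<notin> Ev z" for x
    using PA_Zp[OF that(1) z] W_even_0[OF z that] that by simp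
  have Z10: "PA Z1p x z = 0" if "x \<in> V" "x \<notin> Od z" for x
    using PA_Z1p[OF that(1) z] W_odd_0[OF z that] that by simp
  have "d z = 4" using Zd[OF z] Z10[OF z notOd[OF Ev_refl]] by (simp add: d_def)
  then have "z \<in> {x \<in> V. d x = 4 \<or> d x = - 4}" using z by simp
  then have "{x \<in> V. d x = 4 \<or> d x = - 4} \<noteq> {}" by blast
  moreover have "N x \<subseteq> {x \<in> V. d x = 4 \<or> d x = - 4}" if "x \<in> {x \<in> V. d x = 4 \<or> d x = - 4}" for x
  proof
    fix y assume y: "y \<in> N x"
    have x: "x \<in> V" "d x = 4 \<or> d x = - 4" using that by simp_all
    then show "y \<in> {x \<in> V. d x = 4 \<or> d x = - 4}"
      using step[OF x(1) y] N_in_V[OF x(1) y] by auto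
  qed
  ultimately have all: "{x \<in> V. d x = 4 \<or> d x = - 4} = V" by (intro connectedness) auto
  define e where "e = (\<lambda>x. d x div 4)"
  have de: "d x = 4 * e x" "e x = 1 \<or> e x = - 1" if "x \<in> V" for x
  proof -
    have "d x = 4 \<or> d x = - 4" using all that by blast
    then show "d x = 4 * e x" "e x = 1 \<or> e x = - 1" by (auto simp: e_def)
  qed
  \<comment> \<open>\<open>Zp\<close> and \<open>Z1p\<close> vanish at 3, so \<open>d\<close> sums
    to 0 over each class, and six signs with sum 0 split three to three.\<close>
  have balanced: "card {x \<in> C. e x = s} = 3"
    if C: "C \<subseteq> V" "card C = 6" "(\<Sum>x\<in>C. d x) = 0" and s: "s = 1 \<or> s = - 1" for C s
  proof -
    have fin: "finite C" using C(1) finite_V finite_subset by blast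
    have "(\<Sum>x\<in>C. d x) = (\<Sum>x\<in>C. 4 * e x)" using C(1) de by (intro sum.cong refl) blast
    then have "(\<Sum>x\<in>C. e x) = 0" using C(3) by (simp flip: sum_distrib_left)
    moreover have "(\<Sum>x\<in>C. s * e x + 1) = (\<Sum>x\<in>C. if e x = s then 2 else 0)"
    proof (rule sum.cong[OF refl])
      fix x assume "x \<in> C"
      then have "e x = 1 \<or> e x = - 1" using C(1) de by blast
      then show "s * e x + 1 = (if e x = s then 2 else 0)" using s by auto
    qed
    moreover have "(\<Sum>x\<in>C. if e x = s then 2 else 0) = 2 * int (card {x \<in> C. e x = s})"
      using fin by (simp add: sum.If_cases Int_def conj_commute)
    ultimately have "2 * int (card {x \<in> C. e x = s}) = 6"
      using C(2) by (simp add: sum.distrib flip: sum_distrib_left)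
    then show ?thesis by simp
  qed
  have sumEv: "(\<Sum>x\<in>Ev z. d x) = 0"
  proof -
    have "(\<Sum>x\<in>V. PA Zp x z) = 0"
      using W_row_sum[OF z, of Zp] PA_sym[OF z, of _ Zp] by (simp add: Zp_def)
    moreover have "(\<Sum>x\<in>V. PA Zp x z) = (\<Sum>x\<in>Ev z. d x)"
      using Ev_subset[OF z] finite_V Z0 Z10 notOd
      by (intro sum.mono_neutral_cong_right) (auto simp: d_def)
    ultimately show ?thesis by simp
  qed
  have sumOd: "(\<Sum>x\<in>Od z. d x) = 0"
  proof -
    have "(\<Sum>x\<in>V. PA Z1p x z) = 0"
      using W_row_sum[OF z, of Z1p] PA_sym[OF z, of _ Z1p] by (simp add: Z1p_def)
    moreover have "(\<Sum>x\<in>V. PA Z1p x z) = (\<Sum>x\<in>Od z. d x)"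
      using Od_subset[OF z] finite_V Z0 Z10 notEv
      by (intro sum.mono_neutral_cong_right) (auto simp: d_def)
    ultimately show ?thesis by simp
  qed
  have "card {x \<in> Ev i. e x = e i} = 3" if i: "i \<in> V" for i
  proof -
    have "Ev i = Ev z \<or> Ev i = Od z"
    proof (cases "i \<in> Ev z")
      case True
      then show ?thesis using Ev_eq[OF z] by blast
    next
      case False
      then have iO: "i \<in> Od z" using Ev_Un_Od[OF z] i by blast
      have "Ev i = Od z"
      proof (rule Od_minimal[OF z])
        show "Ev i \<subseteq> Od z"
        proof
          fix y assume y: "y \<in> Ev i"
          show "y \<in> Od z"
          proof (rule ccontr)
            assume "y \<notin> Od z"
            then have "y \<in> Ev z" using Ev_Un_Od[OF z] Ev_subset[OF i] y by blast
            moreover have "i \<in> Ev y" using Ev_sym[OF i y] .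
            ultimately show False using Ev_eq[OF z] False by blast
          qed
        qed
        show "Ev i \<noteq> {}" using Ev_refl by blast
        show "w \<in> Ev i" if "u \<in> Ev i" "x \<in> N u" "w \<in> N x" for u x w using Ev_step[OF i that] .
      qed
      then show ?thesis ..
    qed
    then show ?thesis
      using balanced[OF Ev_subset[OF i] _ _ de(2)[OF i]] class_card[OF i] assms(2) sumEv sumOd by auto
  qed
  moreover have "W 3 u v = 6 \<and> e v = e u \<or> W 3 u v = 7 \<and> e v = - e u" if "u \<in> V" "v \<in> N u" for u v
    using step[OF that] de[OF that(1)] de[OF N_in_V[OF that]] by auto
  ultimately show thesis using de(2) by (intro that[of e]) blast+
qed

text \<open>The signing, multiplied by a function of the distance on a hexagon, gives two-token
  functions that vanish at pairs from different hexagons. \<open>L2\<close> preserves them, because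
  at such pairs the contributions of the two rungs have opposite signs and cancel.\<close>

lemma no_hexagonal_prism:
  assumes bip "sz = 6"
  shows False
proof -
  have k4: "W 4 v v = 19" if "v \<in> V" for v using sz_cases[OF that] assms by simp
  obtain e :: "'a \<Rightarrow> int" where e_props: "\<forall>x\<in>V. e x = 1 \<or> e x = - 1"
    "\<forall>u\<in>V. \<forall>v\<in>N u. W 3 u v = 6 \<and> e v = e u \<or> W 3 u v = 7 \<and> e v = - e u"
    "\<forall>i\<in>V. card {x \<in> Ev i. e x = e i} = 3"
    by (rule hexagonal_prism_signing[OF assms])
  have e: "e x = 1 \<or> e x = - 1" if "x \<in> V" for x using e_props(1) that by blast
  have edge: "W 3 u v = 6 \<and> e v = e u \<or> W 3 u v = 7 \<and> e v = - e u" if "u \<in> V" "v \<in> N u" for u v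
    using e_props(2) that by blast
  have card3: "card {x \<in> Ev i. e x = e i} = 3" if "i \<in> V" for i using e_props(3) that by blast
  define R where "R = (\<lambda>u. {k \<in> N u. e k = e u})"
  have R_N: "k \<in> N u" and R_e: "e k = e u" if "k \<in> R u" for k u
    using that by (simp_all add: R_def)
  \<comment> \<open>The three values 6 or 7 sum to 19, so exactly one of them is 7.\<close>
  have ex_rung: "\<exists>r. r \<in> N u \<and> e r = - e u \<and> (\<exists>a b. a \<noteq> b \<and> a \<noteq> r \<and> b \<noteq> r \<and> R u = {a, b} \<and> N u = {a, b, r})"
    if u: "u \<in> V" for u
  proof -
    obtain x y w where xyw: "N u = {x, y, w}" "x \<noteq> y" "x \<noteq> w" "y \<noteq> w"
      using card_N[OF u] by (auto simp: card_3_iff)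
    have s: "W 3 u x + W 3 u y + W 3 u w = 19" using edge_sum[OF u] k4[OF u] xyw by simp
    have c: "W 3 u x = 6 \<and> e x = e u \<or> W 3 u x = 7 \<and> e x = - e u"
      "W 3 u y = 6 \<and> e y = e u \<or> W 3 u y = 7 \<and> e y = - e u"
      "W 3 u w = 6 \<and> e w = e u \<or> W 3 u w = 7 \<and> e w = - e u"
      using edge[OF u] xyw(1) by blast+
    have ne: "e u \<noteq> - e u" using e[OF u] by auto
    consider "e x = - e u" "e y = e u" "e w = e u" | "e x = e u" "e y = - e u" "e w = e u"
      | "e x = e u" "e y = e u" "e w = - e u"
      using c s by linarith
    then show ?thesis
    proof cases
      case 1
      then have "R u = {y, w}" using xyw(1) ne by (auto simp: R_def)
      moreover have "N u = {y, w, x}" using xyw(1) by auto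
      ultimately show ?thesis using 1 xyw by blast
    next
      case 2
      then have "R u = {x, w}" using xyw(1) ne by (auto simp: R_def)
      moreover have "N u = {x, w, y}" using xyw(1) by auto
      ultimately show ?thesis using 2 xyw by blast
    next
      case 3
      then have "R u = {x, y}" using xyw(1) ne by (auto simp: R_def)
      then show ?thesis using 3 xyw by blast
    qed
  qed
  then obtain rg where rg: "\<And>u. u \<in> V \<Longrightarrow> rg u \<in> N u \<and> e (rg u) = - e u \<and>
      (\<exists>a b. a \<noteq> b \<and> a \<noteq> rg u \<and> b \<noteq> rg u \<and> R u = {a, b} \<and> N u = {a, b, rg u})"
    by metis
  have rgE: thesis
    if "u \<in> V" "\<And>a b. a \<noteq> b \<Longrightarrow> a \<noteq> rg u \<Longrightarrow> b \<noteq> rg u \<Longrightarrow> R u = {a, b} \<Longrightarrow> N u = {a, b, rg u} \<Longrightarrow> thesis"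
    for u thesis
    using rg[OF that(1)] by (elim conjE exE) (rule that(2))
  have rgN: "rg u \<in> N u" "e (rg u) = - e u" if "u \<in> V" for u using rg[OF that] by simp_all
  have rgV: "rg u \<in> V" if "u \<in> V" for u using rgN[OF that] N_in_V[OF that] by blast
  have rg_unique: "y = rg u" if uy: "u \<in> V" "y \<in> N u" "e y = - e u" for u y
  proof -
    obtain a b where ab: "a \<noteq> b" "a \<noteq> rg u" "b \<noteq> rg u" "R u = {a, b}" "N u = {a, b, rg u}" by (rule rgE[OF uy(1)])
    have "e u \<noteq> - e u" using e[OF uy(1)] by auto
    then have "y \<notin> R u" using uy(3) by (simp add: R_def)
    then show ?thesis using uy(2) unfolding ab(4,5) by simp
  qed
  have rgrg: "rg (rg u) = u" if "u \<in> V" for u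
  proof (rule rg_unique[OF rgV[OF that], symmetric])
    show "u \<in> N (rg u)" by (rule N_sym[OF that rgN(1)[OF that]])
    show "e u = - e (rg u)" by (simp add: rgN(2)[OF that])
  qed
  have common: "1 \<le> W 2 x y" if "z \<in> N x" "z \<in> N y" "x \<in> V" "y \<in> V" for x y z
  proof -
    have "z \<in> N x \<inter> N y" using that by simp
    then have "card (N x \<inter> N y) \<noteq> 0" using finite_N[OF that(3)] by (metis card_0_eq empty_iff finite_Int)
    then show ?thesis using W_2[OF that(3,4)] by simp
  qed
  \<comment> \<open>Counting 3-walks from u to each of its neighbours gives three linear equations
    that determine the three numbers of common neighbours.\<close>
  have rails: "W 2 a (rg u) = 2 \<and> W 2 b (rg u) = 2 \<and> W 2 a b = 1"
    if u: "u \<in> V" and ab: "a \<noteq> b" "a \<noteq> rg u" "b \<noteq> rg u" "R u = {a, b}" "N u = {a, b, rg u}" for u a b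
  proof -
    have abN: "a \<in> N u" "b \<in> N u" unfolding ab(5) by simp_all
    have V: "a \<in> V" "b \<in> V" by (rule N_in_V[OF u abN(1)], rule N_in_V[OF u abN(2)])
    have uN: "u \<in> N a" "u \<in> N b" by (rule N_sym[OF u abN(1)], rule N_sym[OF u abN(2)])
    have eab: "e a = e u" "e b = e u" using R_e[of a u] R_e[of b u] unfolding ab(4) by simp_all
    have ne: "e u \<noteq> - e u" using e[OF u] by auto
    have "W 3 u (rg u) = 7" using edge[OF u rgN(1)[OF u]] rgN(2)[OF u] ne by simp
    moreover have "W 3 u a = 6" "W 3 u b = 6" using edge[OF u abN(1)] edge[OF u abN(2)] eab ne by simp_all
    moreover have exp: "W 3 u y = W 2 a y + W 2 b y + W 2 (rg u) y" for y
    proof -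
      have "W 3 u y = (\<Sum>w\<in>N u. W 2 w y)" using W_Suc[OF u, of 2 y] by simp
      then show ?thesis unfolding ab(5) using ab(1-3) by simp
    qed
    moreover have "W 2 (rg u) (rg u) = 3" "W 2 a a = 3" "W 2 b b = 3"
      by (rule W_2_refl[OF rgV[OF u]], rule W_2_refl[OF V(1)], rule W_2_refl[OF V(2)])
    moreover have "W 2 b a = W 2 a b" "W 2 (rg u) a = W 2 a (rg u)" "W 2 (rg u) b = W 2 b (rg u)"
      by (rule W_sym[OF V(2,1)], rule W_sym[OF rgV[OF u] V(1)], rule W_sym[OF rgV[OF u] V(2)])
    moreover have "1 \<le> W 2 a b" using common[OF uN V] .
    ultimately show ?thesis using exp[of a] exp[of b] exp[of "rg u"] by linarith
  qed
  \<comment> \<open>a and \<open>rg u\<close> have a common neighbour besides u, and its sign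
    identifies it as \<open>rg a\<close>.\<close>
  have rung_rail: "rg a \<in> N (rg u)" if u: "u \<in> V" and a: "a \<in> N u" "e a = e u" for u a
  proof -
    obtain x y where xy: "x \<noteq> y" "x \<noteq> rg u" "y \<noteq> rg u" "R u = {x, y}" "N u = {x, y, rg u}" by (rule rgE[OF u])
    have aV: "a \<in> V" using N_in_V[OF u a(1)] .
    have "a \<in> R u" using a by (simp add: R_def)
    then have "W 2 a (rg u) = 2" using rails[OF u xy] xy(4) by auto
    then have c: "card (N a \<inter> N (rg u)) = 2" using W_2[OF aV rgV[OF u]] by simp
    have "\<not> N a \<inter> N (rg u) \<subseteq> {u}"
    proof
      assume "N a \<inter> N (rg u) \<subseteq> {u}"
      then show False using card_mono[of "{u}" "N a \<inter> N (rg u)"] c by simp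
    qed
    then obtain y' where y': "y' \<in> N a" "y' \<in> N (rg u)" "y' \<noteq> u" by blast
    have "e y' \<noteq> - e (rg u)" using rg_unique[OF rgV[OF u] y'(2)] rgrg[OF u] y'(3) by metis
    then have "e y' = e (rg u)" using edge[OF rgV[OF u] y'(2)] by blast
    then have "e y' = - e a" using rgN(2)[OF u] a(2) by simp
    then have "y' = rg a" by (rule rg_unique[OF aV y'(1)])
    then show ?thesis using y'(2) by simp
  qed
  have disj: "Ev i \<inter> Od i = {}" if "i \<in> V" for i using bip_disjoint[OF assms(1) that] .
  \<comment> \<open>The three vertices with the class and sign of i are i itself and the vertices
    two rail steps away, one in each direction.\<close>
  have one_common: "card (R i \<inter> N j) = 1" if ij: "i \<in> V" "j \<in> Ev i" "j \<noteq> i" "e j = e i" for i j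
  proof -
    obtain a b where ab: "a \<noteq> b" "a \<noteq> rg i" "b \<noteq> rg i" "R i = {a, b}" "N i = {a, b, rg i}" by (rule rgE[OF ij(1)])
    have other: "\<exists>c. c \<in> N x \<and> c \<noteq> i \<and> e c = e i \<and> c \<in> Ev i" if x: "x \<in> R i" for x
    proof -
      have xN: "x \<in> N i" "e x = e i" using x by (rule R_N, rule R_e)
      have xV: "x \<in> V" using N_in_V[OF ij(1) xN(1)] .
      obtain p q where pq: "p \<noteq> q" "p \<noteq> rg x" "q \<noteq> rg x" "R x = {p, q}" "N x = {p, q, rg x}" by (rule rgE[OF xV])
      then obtain c where "c \<in> R x" "c \<noteq> i" by (metis insertCI)
      then have c: "c \<in> N x" "e c = e x" "c \<noteq> i" using R_N R_e by simp_all
      then show ?thesis using Ev_step[OF ij(1) Ev_refl xN(1) c(1)] xN(2) by auto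
    qed
    obtain c where c: "c \<in> N a" "c \<noteq> i" "e c = e i" "c \<in> Ev i" using other[of a] ab(4) by blast
    obtain c' where c': "c' \<in> N b" "c' \<noteq> i" "e c' = e i" "c' \<in> Ev i" using other[of b] ab(4) by blast
    have V: "a \<in> V" "b \<in> V" "c \<in> V" using N_in_V[OF ij(1)] ab(5) c Ev_subset[OF ij(1)] by auto
    have iab: "i \<in> N a" "i \<in> N b" using N_sym[OF ij(1), of a] N_sym[OF ij(1), of b] ab(5) by simp_all
    have W2ab: "card (N a \<inter> N b) = 1" using rails[OF ij(1) ab] W_2[OF V(1,2)] by simp
    have only_i: "y = i" if "y \<in> N a" "y \<in> N b" for y
    proof -
      obtain t where t: "N a \<inter> N b = {t}" using W2ab by (auto simp: card_1_singleton_iff)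
      have "y \<in> N a \<inter> N b" "i \<in> N a \<inter> N b" using that iab by simp_all
      then show ?thesis unfolding t by simp
    qed
    have "c \<noteq> c'" using only_i c c' by blast
    have "finite {x \<in> Ev i. e x = e i}" using Ev_subset[OF ij(1)] finite_V finite_subset by (metis (no_types, lifting) mem_Collect_eq subsetI)
    moreover have "{i, c, c'} \<subseteq> {x \<in> Ev i. e x = e i}" using c c' Ev_refl by simp
    moreover have "card {i, c, c'} = 3" using c c' \<open>c \<noteq> c'\<close> by simp
    ultimately have "{i, c, c'} = {x \<in> Ev i. e x = e i}"
      using card_subset_eq[of "{x \<in> Ev i. e x = e i}" "{i, c, c'}"] card3[OF ij(1)] by simp
    then have "j = c \<or> j = c'" using ij by auto
    then show ?thesis
    proof
      assume j: "j = c"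
      have "a \<in> N j" "b \<notin> N j"
        using c j N_sym[OF V(1)] N_sym[OF V(3)] only_i[of j] ij by blast+
      then have "R i \<inter> N j = {a}" unfolding ab(4) by auto
      then show ?thesis by simp
    next
      assume j: "j = c'"
      have jV: "j \<in> V" using ij Ev_subset by blast
      have "b \<in> N j" "a \<notin> N j"
        using c' j N_sym[OF V(2)] N_sym[OF jV] only_i[of j] ij by blast+
      then have "R i \<inter> N j = {b}" unfolding ab(4) by auto
      then show ?thesis by simp
    qed
  qed
  \<comment> \<open>For points on one hexagon \<open>h1\<close>, \<open>h2\<close> and
    \<open>h3\<close> are the values at distance 1, 2 and 3.\<close>
  define h :: "int \<Rightarrow> int \<Rightarrow> int \<Rightarrow> 'a \<Rightarrow> 'a \<Rightarrow> int" where
    "h = (\<lambda>h1 h2 h3 i j. if j \<in> N i then h1 else if j \<in> Ev i then h2 else h3)"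
  define K :: "int \<Rightarrow> int \<Rightarrow> int \<Rightarrow> 'a \<Rightarrow> 'a \<Rightarrow> int" where
    "K = (\<lambda>h1 h2 h3 i j. if e i = e j then e i * h h1 h2 h3 i j else 0)"
  have notEv: "j \<notin> Ev i" if "i \<in> V" "j \<in> N i" for i j
    using disj[OF that(1)] N_Ev[OF Ev_refl that(2)] by blast
  have h_sym: "h h1 h2 h3 i j = h h1 h2 h3 j i" if "i \<in> V" "j \<in> V" for h1 h2 h3 i j
    using N_commute[OF that] Ev_commute[OF that] by (simp add: h_def)
  have K_sym: "K h1 h2 h3 i j = K h1 h2 h3 j i" if "i \<in> V" "j \<in> V" for h1 h2 h3 i j
    using h_sym[OF that] by (simp add: K_def)
  have K_rung: "(\<Sum>k\<in>N i. K h1 h2 h3 k j) = (if e i = e j then \<Sum>k\<in>R i. e i * h h1 h2 h3 k j else e j * h h1 h2 h3 (rg i) j)"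
    if ij: "i \<in> V" "j \<in> V" for h1 h2 h3 i j
  proof -
    obtain a b where ab: "a \<noteq> b" "a \<noteq> rg i" "b \<noteq> rg i" "R i = {a, b}" "N i = {a, b, rg i}" by (rule rgE[OF ij(1)])
    have "e a = e i" "e b = e i" using R_e[of a i] R_e[of b i] unfolding ab(4) by simp_all
    moreover have "e i \<noteq> - e i" using e[OF ij(1)] by auto
    moreover have "e i = e j \<or> e j = - e i" using e[OF ij(1)] e[OF ij(2)] by auto
    ultimately show ?thesis using ab rgN(2)[OF ij(1)] by (auto simp: K_def)
  qed
  have rail_sum: "(\<Sum>k\<in>R i. e i * h h1 h2 h3 k j) = e i * (if j \<in> Ev i then h1 + h3 else 2 * h2)"
    if ij: "i \<in> V" "j \<in> V" "i \<noteq> j" "e i = e j" for h1 h2 h3 i j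
  proof -
    obtain a b where ab: "a \<noteq> b" "a \<noteq> rg i" "b \<noteq> rg i" "R i = {a, b}" "N i = {a, b, rg i}" by (rule rgE[OF ij(1)])
    have abN: "a \<in> N i" "b \<in> N i" using R_N[of a i] R_N[of b i] unfolding ab(4) by simp_all
    have V: "a \<in> V" "b \<in> V" using N_in_V[OF ij(1)] abN by blast+
    show ?thesis
    proof (cases "j \<in> Ev i")
      case True
      have "x \<notin> Ev j" if "x \<in> N i" for x
        using N_Ev[of i j x] Ev_sym[OF ij(1) True] that disj[OF ij(2)] by blast
      then have "h h1 h2 h3 x j = (if x \<in> N j then h1 else h3)" if "x \<in> N i" for x
        unfolding h_sym[OF N_in_V[OF ij(1) that] ij(2)] using that by (simp add: h_def)
      moreover have "a \<in> N j \<and> b \<notin> N j \<or> a \<notin> N j \<and> b \<in> N j"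
      proof -
        have "card (R i \<inter> N j) = 1" using one_common[OF ij(1) True] ij(3,4) by simp
        then show ?thesis
          unfolding ab(4) using ab(1) by (cases "a \<in> N j"; cases "b \<in> N j") simp_all
      qed
      ultimately show ?thesis unfolding ab(4) using ab(1) abN True by (elim disjE conjE) (simp_all add: algebra_simps)
    next
      case False
      then have "j \<in> Od i" using Ev_Un_Od[OF ij(1)] ij(2) by blast
      then have "i \<in> Od j" using Od_commute[OF ij(1,2)] by blast
      then have "x \<in> Ev j" if "x \<in> N i" for x using N_Od[OF ij(2)] that by blast
      moreover have "x \<notin> N j" if "x \<in> Ev j" for x using notEv[OF ij(2)] that by blast
      ultimately have "h h1 h2 h3 x j = h2" if "x \<in> N i" for x
        unfolding h_sym[OF N_in_V[OF ij(1) that] ij(2)] using that by (simp add: h_def)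
      then show ?thesis unfolding ab(4) using ab(1) abN False by (simp add: algebra_simps)
    qed
  qed
  have L2K: "L2 (K h1 h2 h3) i j = K (4 * h1 - 2 * h2) (6 * h2 - 2 * h1 - 2 * h3) (6 * h3 - 4 * h2) i j"
    if ij: "i \<in> V" "j \<in> V" "i \<noteq> j" for h1 h2 h3 i j
  proof -
    have flip: "(\<Sum>k\<in>N j. K h1 h2 h3 i k) = (\<Sum>k\<in>N j. K h1 h2 h3 k i)"
      using N_in_V[OF ij(2)] by (intro sum.cong refl K_sym[OF ij(1)])
    have diag: "K h1 h2 h3 v v = e v * h2" if "v \<in> V" for v
      using N_irrefl[OF that] Ev_refl by (simp add: K_def h_def)
    show ?thesis
    proof (cases "e i = e j")
      case True
      then have K_same: "K a b c i j = e i * (if j \<in> N i then a else if j \<in> Ev i then b else c)" for a b c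
        by (simp add: K_def h_def)
      show ?thesis
        unfolding L2_formula[OF ij] flip K_rung[OF ij(1,2)] K_rung[OF ij(2,1)] diag[OF ij(1)] diag[OF ij(2)] K_same
        using True rail_sum[OF ij True, of h1 h2 h3] rail_sum[OF ij(2,1) ij(3)[symmetric] True[symmetric], of h1 h2 h3]
          Ev_commute[OF ij(1,2)] notEv[OF ij(1), of j]
        by (auto simp: algebra_simps)
    next
      case False
      then have ej: "e j = - e i" using e[OF ij(1)] e[OF ij(2)] by auto
      have K0: "K a b c i j = 0" for a b c using False by (simp add: K_def)
      have "j \<in> N (rg i) \<longleftrightarrow> i \<in> N (rg j)"
      proof
        assume j: "j \<in> N (rg i)"
        have "rg j \<in> N (rg (rg i))"
          by (rule rung_rail[OF rgV[OF ij(1)] j]) (simp add: ej rgN(2)[OF ij(1)])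
        then show "i \<in> N (rg j)" using rgrg[OF ij(1)] N_sym[OF ij(1)] by simp
      next
        assume i: "i \<in> N (rg j)"
        have "rg i \<in> N (rg (rg j))"
          by (rule rung_rail[OF rgV[OF ij(2)] i]) (simp add: ej rgN(2)[OF ij(2)])
        then show "j \<in> N (rg i)" using rgrg[OF ij(2)] N_sym[OF ij(2)] by simp
      qed
      moreover have "j \<in> Ev (rg i) \<longleftrightarrow> i \<in> Ev (rg j)"
      proof -
        have "j \<in> Ev (rg i) \<longleftrightarrow> rg i \<in> Ev j" by (rule Ev_commute[OF rgV[OF ij(1)] ij(2)])
        also have "\<dots> \<longleftrightarrow> i \<in> Od j" by (rule N_Od_iff[OF ij(2,1) rgN(1)[OF ij(1)]])
        also have "\<dots> \<longleftrightarrow> j \<in> Od i" by (rule Od_commute[OF ij(2,1)])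
        also have "\<dots> \<longleftrightarrow> rg j \<in> Ev i" by (rule N_Od_iff[OF ij(1,2) rgN(1)[OF ij(2)], symmetric])
        also have "\<dots> \<longleftrightarrow> i \<in> Ev (rg j)" by (rule Ev_commute[OF ij(1) rgV[OF ij(2)]])
        finally show ?thesis .
      qed
      ultimately have "h h1 h2 h3 (rg i) j = h h1 h2 h3 (rg j) i" by (simp add: h_def)
      then show ?thesis
        unfolding L2_formula[OF ij] flip K_rung[OF ij(1,2)] K_rung[OF ij(2,1)] diag[OF ij(1)] diag[OF ij(2)] K0
        using False ej by simp
    qed
  qed
  obtain u where u: "u \<in> V" using V_nonempty by blast
  obtain a b where ab: "a \<noteq> b" "a \<noteq> rg u" "b \<noteq> rg u" "R u = {a, b}" "N u = {a, b, rg u}" by (rule rgE[OF u])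
  then have "a \<in> R u" by simp
  then have a: "a \<in> N u" "e a = e u" by (rule R_N, rule R_e)
  have aV: "a \<in> V" "u \<noteq> a" using N_in_V[OF u a(1)] N_irrefl[OF u] a(1) by blast+
  \<comment> \<open>(1, -1, 0) lies in the invariant plane complementary to (1, 1, 1), which has the
    integer eigenvalue 2. On the plane the eigenvalues are 7 plus or minus sqrt 5.\<close>
  show False
  proof (rule L2_no_irrational_pair[of "K 1 (-1) 0" u a "K 6 (-8) 4" 0 14 44 0])
    show "K 6 (-8) 4 u a + 0 \<noteq> 0" using a e[OF u] by (auto simp: K_def h_def)
    show "L2 (K 1 (-1) 0) i j = K 6 (-8) 4 i j + 0" if "i \<in> V" "j \<in> V" "i \<noteq> j" for i j
      using L2K[OF that, of 1 "-1" 0] by simp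
    show "L2 (K 6 (-8) 4) i j = 14 * K 6 (-8) 4 i j - 44 * K 1 (-1) 0 i j + 0" if "i \<in> V" "j \<in> V" "i \<noteq> j" for i j
      unfolding L2K[OF that] by (simp add: K_def h_def)
    show "poly [:44, - 14, 1:] z \<noteq> 0" for z :: int
      by (rule no_int_root_mod[of 3]) code_simp+
  qed (use u aV K_sym in auto)
qed

end

section \<open>Ten vertices, not bipartite: the Petersen graph\<close>

context cubic_graph
begin

lemma sum_W_1: "j \<in> V \<Longrightarrow> (\<Sum>w\<in>V. W 1 j w * f w) = (\<Sum>w\<in>N j. f w)"
proof -
  assume j: "j \<in> V"
  have "(\<Sum>w\<in>V. W 1 j w * f w) = (\<Sum>w\<in>V. if w \<in> N j then f w else 0)"
    using W_1[OF j] by (intro sum.cong refl) simp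
  then show ?thesis using adj_conv_sum[OF j, of f] j by (simp add: adj_def)
qed

text \<open>With the vertices numbered along \<open>vs\<close>, \<open>L2\<close> becomes arithmetic
  on index lists that can be evaluated.\<close>

lemma L2_index:
  fixes G :: "nat \<Rightarrow> nat \<Rightarrow> int"
  assumes vs: "distinct vs" "set vs = V"
    and nb: "\<And>i. i < length vs \<Longrightarrow> N (vs ! i) = (\<lambda>k. vs ! k) ` set (nb i)"
      "\<And>i. i < length vs \<Longrightarrow> distinct (nb i) \<and> set (nb i) \<subseteq> {..<length vs}"
    and pos: "\<And>i. i < length vs \<Longrightarrow> pos (vs ! i) = i"
    and ij: "i < length vs" "j < length vs" "i \<noteq> j"
  shows "L2 (\<lambda>x y. G (pos x) (pos y)) (vs ! i) (vs ! j) =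
    6 * G i j - sum_list (map (\<lambda>k. G k j) (nb i)) - sum_list (map (\<lambda>k. G i k) (nb j))
    + (if j \<in> set (nb i) then G i i + G j j - 2 * G i j else 0)"
proof -
  have V: "vs ! i \<in> V" "vs ! j \<in> V" using vs(2) ij nth_mem by blast+
  have ne: "vs ! i \<noteq> vs ! j" using ij vs(1) by (simp add: nth_eq_iff_index_eq)
  have sum: "(\<Sum>x\<in>N (vs ! a). g (pos x)) = sum_list (map g (nb a))" if a: "a < length vs" for a and g :: "nat \<Rightarrow> int"
  proof -
    have inj: "inj_on (\<lambda>k. vs ! k) (set (nb a))"
    proof (rule inj_onI)
      fix x y assume xy: "x \<in> set (nb a)" "y \<in> set (nb a)" "vs ! x = vs ! y"
      then have "x < length vs" "y < length vs" using nb(2)[OF a] by auto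
      then show "x = y" using xy(3) vs(1) by (simp add: nth_eq_iff_index_eq)
    qed
    have "(\<Sum>x\<in>N (vs ! a). g (pos x)) = (\<Sum>k\<in>set (nb a). g (pos (vs ! k)))"
      unfolding nb(1)[OF a] by (simp add: sum.reindex[OF inj])
    also have "\<dots> = (\<Sum>k\<in>set (nb a). g k)"
      using nb(2)[OF a] pos by (intro sum.cong refl) auto
    also have "\<dots> = sum_list (map g (nb a))"
      using nb(2)[OF a] by (simp add: sum_list_distinct_conv_sum_set)
    finally show ?thesis .
  qed
  have "vs ! j \<in> N (vs ! i) \<longleftrightarrow> j \<in> set (nb i)"
  proof
    assume "vs ! j \<in> N (vs ! i)"
    then obtain k where k: "k \<in> set (nb i)" "vs ! j = vs ! k" unfolding nb(1)[OF ij(1)] by blast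
    then have "k < length vs" using nb(2)[OF ij(1)] by auto
    then have "j = k" using k(2) ij(2) vs(1) by (simp add: nth_eq_iff_index_eq)
    then show "j \<in> set (nb i)" using k(1) by simp
  qed (simp add: nb(1)[OF ij(1)])
  then show ?thesis
    unfolding L2_formula[OF V ne] pos[OF ij(1)] pos[OF ij(2)]
    using sum[OF ij(1), of "\<lambda>k. G k j"] sum[OF ij(2), of "\<lambda>k. G i k"] by simp
qed

end

context integral_cubic
begin

text \<open>Without triangles and 4-cycles, u shares exactly one neighbour with each of its six
  non-neighbours, so A^2 = J - A + 2 I. For an eigenfunction h and D = diag h, the space spanned by
  A D A, A D + D A and h i + h j is preserved by \<open>L2\<close>.\<close>

lemma no_petersen:
  assumes "\<not> bip" "sz = 10" and t: "\<And>v. v \<in> V \<Longrightarrow> W 3 v v = 0"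
  shows False
proof -
  have k4: "W 4 v v = 15" if "v \<in> V" for v using sz_cases[OF that] assms by simp
  have nV: "card V = 10" using assms by (simp add: sz_def)
  have edge: "W 2 u k = 0" if "u \<in> V" "k \<in> N u" for u k
  proof -
    have "(\<Sum>k\<in>N u. W 2 u k) = 0" using sum_N_W[OF that(1,1), of 2] t[OF that(1)] by simp
    moreover have "0 \<le> W 2 u k" if "k \<in> N u" for k using W_nonneg[OF \<open>u \<in> V\<close> N_in_V[OF \<open>u \<in> V\<close> that]] .
    ultimately have "\<forall>k\<in>N u. W 2 u k = 0"
      by (intro sum_nonneg_eq_0_iff[OF finite_N[OF that(1)], THEN iffD1])
    then show ?thesis using that(2) by (rule bspec)
  qed
  have W2: "W 2 u w = 1 - W 1 u w + 2 * W 0 u w" if uw: "u \<in> V" "w \<in> V" for u w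
  proof -
    consider "u = w" | "w \<in> N u" | "u \<noteq> w" "w \<notin> N u" by blast
    then show ?thesis
    proof cases
      case 1
      then show ?thesis using W_2_refl[OF uw(1)] W_1[OF uw(1), of u] N_irrefl[OF uw(1)] by (simp add: W_0)
    next
      case 2
      then have "u \<noteq> w" using N_irrefl[OF uw(1)] by blast
      then show ?thesis using edge[OF uw(1) 2] W_1[OF uw(1), of w] 2 by (simp add: W_0)
    next
      case 3
      have fN: "finite (insert u (N u))" using finite_N[OF uw(1)] by simp
      have sub: "insert u (N u) \<subseteq> V" using N_subset uw(1) by blast
      have "card (insert u (N u)) = 4" using card_N[OF uw(1)] fN N_irrefl[OF uw(1)] by simp
      then have c: "card (V - insert u (N u)) = 6" using card_Diff_subset[OF fN sub] nV by simp
      have "(\<Sum>w\<in>V. W 2 u w) = 9"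
        using W_row_sum[OF uw(1), of "monom 1 2"] by (simp add: W_def poly_monom)
      moreover have "(\<Sum>w\<in>V - insert u (N u). W 2 u w) = (\<Sum>w\<in>V. W 2 u w) - (\<Sum>w\<in>insert u (N u). W 2 u w)"
        by (rule sum_diff[OF finite_V sub])
      moreover have "(\<Sum>w\<in>insert u (N u). W 2 u w) = 3 + W 3 u u"
        using N_irrefl[OF uw(1)] fN W_2_refl[OF uw(1)] sum_N_W[OF uw(1,1), of 2] by simp
      ultimately have s: "(\<Sum>w\<in>V - insert u (N u). W 2 u w) = 6" using t[OF uw(1)] by simp
      have "- W 2 u w = - 1"
      proof (rule all_eq_of_sum[of "V - insert u (N u)"])
        show "- 1 \<le> - W 2 u x" if "x \<in> V - insert u (N u)" for x
          using W_2_le_1_of_W_4[OF uw(1) _ _ k4[OF uw(1)], of x] that by auto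
        show "(\<Sum>w\<in>V - insert u (N u). - W 2 u w) = - 1 * int (card (V - insert u (N u)))"
          unfolding sum_negf s c by simp
      qed (use finite_V uw 3 in auto)
      then show ?thesis using W_1[OF uw(1), of w] 3 by (simp add: W_0)
    qed
  qed
  obtain v a where va: "v \<in> V" "a \<in> N v" "a \<in> V" "v \<noteq> a" by (rule obtain_edge)
  \<comment> \<open>A multiple of the projection of \<open>v\<close> to the eigenvalue 1, with value
    -3 at v, -1 at its neighbours and 1 elsewhere.\<close>
  define h where "h = (\<lambda>k. 1 - 2 * W 1 v k - 4 * W 0 v k)"
  have Ah: "(\<Sum>k\<in>N i. h k) = h i" if i: "i \<in> V" for i
  proof -
    have "(\<Sum>k\<in>N i. W 1 v k) = W 2 v i" "(\<Sum>k\<in>N i. W 0 v k) = W 1 v i"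
      using sum_N_W[OF i va(1), of 1] sum_N_W[OF i va(1), of 0] by (simp_all add: numeral_2_eq_2)
    then show ?thesis
      using card_N[OF i] W2[OF va(1) i] by (simp add: h_def sum_subtractf flip: sum_distrib_left)
  qed
  define K1 where "K1 = (\<lambda>i j. \<Sum>w\<in>V. W 1 i w * (h w * W 1 w j))"
  define K2 where "K2 = (\<lambda>i j. W 1 i j * (h i + h j))"
  define S where "S = (\<lambda>i j. h i + h j)"
  have K1_sym: "K1 i j = K1 j i" if "i \<in> V" "j \<in> V" for i j
    unfolding K1_def using W_sym[OF that(1), of _ 1] W_sym[OF that(2), of _ 1] by (intro sum.cong refl) simp
  have K2_sym: "K2 i j = K2 j i" if "i \<in> V" "j \<in> V" for i j
    using W_sym[OF that, of 1] by (simp add: K2_def)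
  have NK1: "(\<Sum>k\<in>N i. K1 k j) = h j - K1 i j + 2 * h i * W 1 i j" if ij: "i \<in> V" "j \<in> V" for i j
  proof -
    have "(\<Sum>k\<in>N i. K1 k j) = (\<Sum>w\<in>V. (\<Sum>k\<in>N i. W 1 k w) * (h w * W 1 w j))"
      unfolding K1_def sum_distrib_right by (rule sum.swap)
    also have "\<dots> = (\<Sum>w\<in>V. (1 - W 1 i w + 2 * W 0 i w) * (h w * W 1 w j))"
    proof (rule sum.cong[OF refl])
      fix w assume "w \<in> V"
      then show "(\<Sum>k\<in>N i. W 1 k w) * (h w * W 1 w j) = (1 - W 1 i w + 2 * W 0 i w) * (h w * W 1 w j)"
        using W2[OF ij(1)] W_Suc[OF ij(1), of 1 w] by (simp add: numeral_2_eq_2)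
    qed
    also have "\<dots> = (\<Sum>w\<in>V. h w * W 1 w j) - K1 i j + 2 * (\<Sum>w\<in>V. W 0 i w * (h w * W 1 w j))"
      unfolding K1_def by (simp add: algebra_simps sum.distrib sum_subtractf sum_distrib_left)
    also have "(\<Sum>w\<in>V. h w * W 1 w j) = (\<Sum>w\<in>V. W 1 j w * h w)"
      using W_sym[OF ij(2), of _ 1] by (intro sum.cong refl) simp
    also have "\<dots> = h j" using sum_W_1[OF ij(2), of h] Ah[OF ij(2)] by simp
    also have "(\<Sum>w\<in>V. W 0 i w * (h w * W 1 w j)) = (\<Sum>w\<in>V. if w = i then h w * W 1 w j else 0)"
      by (intro sum.cong refl) (simp add: W_0)
    also have "\<dots> = h i * W 1 i j" using finite_V ij(1) by simp
    finally show ?thesis by simp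
  qed
  have NK2: "(\<Sum>k\<in>N i. K2 k j) = K1 i j + h j * W 2 i j" if ij: "i \<in> V" "j \<in> V" for i j
  proof -
    have "(\<Sum>k\<in>N i. K2 k j) = (\<Sum>k\<in>N i. h k * W 1 k j) + (\<Sum>k\<in>N i. W 1 k j) * h j"
      by (simp add: K2_def algebra_simps sum.distrib sum_distrib_left)
    then show ?thesis
      using sum_W_1[OF ij(1), of "\<lambda>w. h w * W 1 w j"] W_Suc[OF ij(1), of 1 j]
      by (simp add: K1_def numeral_2_eq_2)
  qed
  have K1_diag: "K1 i i = h i" if i: "i \<in> V" for i
  proof -
    have "K1 i i = (\<Sum>w\<in>N i. h w * W 1 w i)" unfolding K1_def by (rule sum_W_1[OF i])
    also have "\<dots> = (\<Sum>w\<in>N i. h w)"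
    proof (rule sum.cong[OF refl])
      fix w assume "w \<in> N i"
      then show "h w * W 1 w i = h w" using W_1[OF N_in_V[OF i], of w i] N_sym[OF i] by simp
    qed
    finally show ?thesis using Ah[OF i] by simp
  qed
  have K1_edge: "K1 i j = 0" if ij: "i \<in> V" "j \<in> N i" for i j
  proof -
    have jV: "j \<in> V" using N_in_V[OF ij] .
    have "card (N i \<inter> N j) = 0" using edge[OF ij] W_2[OF ij(1) jV] by simp
    then have e: "N i \<inter> N j = {}" using finite_N[OF ij(1)] by simp
    have "K1 i j = (\<Sum>w\<in>N i. h w * W 1 w j)" unfolding K1_def by (rule sum_W_1[OF ij(1)])
    also have "\<dots> = 0"
    proof (rule sum.neutral, rule ballI)
      fix w assume w: "w \<in> N i"
      then have "j \<notin> N w" using e N_sym[OF N_in_V[OF ij(1) w]] by blast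
      then show "h w * W 1 w j = 0" using W_1[OF N_in_V[OF ij(1) w], of j] by simp
    qed
    finally show ?thesis .
  qed
  have L: "L2 K1 i j = 8 * K1 i j - K2 i j - S i j" "L2 K2 i j = 5 * K2 i j - 2 * K1 i j - S i j"
    "L2 S i j = 2 * S i j" if ij: "i \<in> V" "j \<in> V" "i \<noteq> j" for i j
  proof -
    have flip: "(\<Sum>k\<in>N j. K1 i k) = (\<Sum>k\<in>N j. K1 k i)" "(\<Sum>k\<in>N j. K2 i k) = (\<Sum>k\<in>N j. K2 k i)"
      using N_in_V[OF ij(2)] by (auto intro!: sum.cong K1_sym[OF ij(1)] K2_sym[OF ij(1)])
    have W1: "W 1 j i = W 1 i j" "W 2 j i = W 2 i j" using W_sym[OF ij(2,1)] by blast+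
    have A: "W 1 i j = (if j \<in> N i then 1 else 0)" by (rule W_1[OF ij(1)])
    have B: "W 2 i j = 1 - W 1 i j" using W2[OF ij(1,2)] ij(3) by (simp add: W_0)
    show "L2 K1 i j = 8 * K1 i j - K2 i j - S i j"
      unfolding L2_formula[OF ij] flip NK1[OF ij(1,2)] NK1[OF ij(2,1)] K1_diag[OF ij(1)] K1_diag[OF ij(2)]
        K1_sym[OF ij(2,1)] W1 using K1_edge[OF ij(1), of j] A by (simp add: K2_def S_def algebra_simps)
    have K2d: "K2 i i = 0" "K2 j j = 0"
      using W_1[OF ij(1), of i] W_1[OF ij(2), of j] N_irrefl[OF ij(1)] N_irrefl[OF ij(2)] by (simp_all add: K2_def)
    show "L2 K2 i j = 5 * K2 i j - 2 * K1 i j - S i j"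
      unfolding L2_formula[OF ij] K2d flip NK2[OF ij(1,2)] NK2[OF ij(2,1)] K1_sym[OF ij(2,1)] W1 B
      using A by (simp add: K2_def S_def algebra_simps)
    have "(\<Sum>k\<in>N i. S k j) = h i + 3 * h j" "(\<Sum>k\<in>N j. S i k) = 3 * h i + h j"
      using Ah[OF ij(1)] Ah[OF ij(2)] card_N[OF ij(1)] card_N[OF ij(2)] by (simp_all add: S_def sum.distrib)
    then show "L2 S i j = 2 * S i j"
      unfolding L2_formula[OF ij] by (simp add: S_def)
  qed
  \<comment> \<open>\<open>?f\<close> is (L2 - 2) K1. This splits off \<open>S\<close>, which
    belongs to the integer 2, and leaves the matrix with rows 8, -1 and -2, 5, of discriminant
    17.\<close>
  let ?f = "\<lambda>i j. 6 * K1 i j - K2 i j - S i j" and ?g = "\<lambda>i j. 50 * K1 i j - 11 * K2 i j - 7 * S i j"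
  show False
  proof (rule L2_no_irrational_pair[of ?f v a ?g 0 13 38 0])
    have "h v = - 3" "h a = - 1"
      using W_1[OF va(1), of v] W_1[OF va(1), of a] N_irrefl[OF va(1)] va by (simp_all add: h_def W_0)
    then show "?g v a + 0 \<noteq> 0"
      using K1_edge[OF va(1,2)] W_1[OF va(1), of a] va(2) by (simp add: K2_def S_def)
    show "?f i j = ?f j i" if "i \<in> V" "j \<in> V" for i j
      using K1_sym[OF that] K2_sym[OF that] by (simp add: S_def)
    show "L2 ?f i j = ?g i j + 0" if "i \<in> V" "j \<in> V" "i \<noteq> j" for i j
      unfolding L2_diff L2_scale L[OF that] by simp
    show "L2 ?g i j = 13 * ?g i j - 38 * ?f i j + 0" if "i \<in> V" "j \<in> V" "i \<noteq> j" for i j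
      unfolding L2_diff L2_scale L[OF that] by simp
    show "poly [:38, - 13, 1:] z \<noteq> 0" for z :: int
      by (rule no_int_root_mod[of 3]) code_simp+
  qed (use va in auto)
qed

end

text \<open>Vertices 0, 1, 2 and 6, 7, 8 span the two triangles, 9 is adjacent to 3, 4, 5.\<close>

definition ten_nbs :: "nat \<Rightarrow> nat list" where
  "ten_nbs i = [[1,2,3],[0,2,4],[0,1,5],[0,9,6],[1,9,7],[2,9,8],[3,7,8],[4,6,8],[5,6,7],[3,4,5]] ! i"

text \<open>\<open>s\<close> separates the two triangles and the middle vertices, \<open>t\<close>
  numbers the three legs. The function is odd under exchanging the triangles and invariant under
  permuting the legs. For a vertex of a triangle, \<open>\<alpha>\<close> is the weight at the
  middle vertex of its own leg and at vertex 9, \<open>\<beta>\<close> that at the other two, and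
  \<open>\<gamma>\<close> that within the triangle.\<close>

definition ten_fun :: "int \<Rightarrow> int \<Rightarrow> int \<Rightarrow> nat \<Rightarrow> nat \<Rightarrow> int" where
  "ten_fun \<alpha> \<beta> \<gamma> i j =
    (let s = (\<lambda>k. [1,1,1,0,0,0,-1,-1,-1,0] ! k);
         t = (\<lambda>k. [1,2,3,1,2,3,1,2,3,0] ! k :: nat);
         r = (\<lambda>i j. if t j = 0 \<or> t i = t j then \<alpha> else \<beta>)
     in if s i = s j then \<gamma> * s i else if s j = 0 then s i * r i j else if s i = 0 then s j * r j i else 0)"

text \<open>The graph is explicit here, so both identities for \<open>L2\<close> are verified at all
  pairs by evaluation. The polynomial x^2 - 9 x + 16 has discriminant 17.\<close>

lemma (in integral_cubic) ten_vertex_contradiction: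
  assumes vs: "distinct vs" "set vs = V" "length vs = 10"
    and nb: "\<And>i. i < 10 \<Longrightarrow> N (vs ! i) = (\<lambda>k. vs ! k) ` set (ten_nbs i)"
  shows False
proof -
  define pos where "pos = the_inv_into {..<10} (\<lambda>i. vs ! i)"
  have inj: "inj_on (\<lambda>i. vs ! i) {..<10}"
    using vs by (intro inj_onI) (simp add: nth_eq_iff_index_eq)
  have pos: "pos (vs ! i) = i" if "i < length vs" for i
    unfolding pos_def using that vs(3) by (intro the_inv_into_f_f[OF inj]) simp
  have all10: "P i" if "\<forall>i\<in>set [0..<10]. P i" "i < length vs" for P and i :: nat
    using that vs(3) by simp
  have nb': "N (vs ! i) = (\<lambda>k. vs ! k) ` set (ten_nbs i)" if "i < length vs" for i
    using nb that vs(3) by simp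
  have ok: "distinct (ten_nbs i) \<and> set (ten_nbs i) \<subseteq> {..<length vs}" if "i < length vs" for i
  proof -
    have "\<forall>i\<in>set [0..<10]. distinct (ten_nbs i) \<and> (\<forall>x\<in>set (ten_nbs i). x < 10)" by code_simp
    from all10[OF this that] show ?thesis using vs(3) by auto
  qed
  let ?F = "\<lambda>\<alpha> \<beta> \<gamma> x y. ten_fun \<alpha> \<beta> \<gamma> (pos x) (pos y)"
  let ?L = "\<lambda>G i j. 6 * G i j - sum_list (map (\<lambda>k. G k j) (ten_nbs i)) - sum_list (map (\<lambda>k. G i k) (ten_nbs j))
    + (if j \<in> set (ten_nbs i) then G i i + G j j - 2 * G i j else (0 :: int))"
  have V: "\<exists>i<length vs. x = vs ! i" if "x \<in> V" for x
    using that vs(2) by (metis in_set_conv_nth)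
  have L2F: "L2 (?F \<alpha> \<beta> \<gamma>) x y = ?F \<alpha>' \<beta>' \<gamma>' x y"
    if xy: "x \<in> V" "y \<in> V" "x \<noteq> y"
    and *: "\<forall>i\<in>set [0..<10]. \<forall>j\<in>set [0..<10]. i \<noteq> j \<longrightarrow> ?L (ten_fun \<alpha> \<beta> \<gamma>) i j = ten_fun \<alpha>' \<beta>' \<gamma>' i j"
    for \<alpha> \<beta> \<gamma> \<alpha>' \<beta>' \<gamma>' x y
  proof -
    obtain i where i: "i < length vs" "x = vs ! i" using V[OF xy(1)] by blast
    obtain j where j: "j < length vs" "y = vs ! j" using V[OF xy(2)] by blast
    have ij: "i \<noteq> j" using xy(3) i j by blast
    have "L2 (?F \<alpha> \<beta> \<gamma>) x y = ?L (ten_fun \<alpha> \<beta> \<gamma>) i j"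
      unfolding i(2) j(2) by (rule L2_index[OF vs(1,2) nb' ok pos i(1) j(1) ij])
    also have "\<dots> = ten_fun \<alpha>' \<beta>' \<gamma>' i j" using * i(1) j(1) ij vs(3) by simp
    finally show ?thesis unfolding i(2) j(2) pos[OF i(1)] pos[OF j(1)] .
  qed
  have in_V: "vs ! 0 \<in> V" "vs ! 1 \<in> V" using vs nth_mem[of 0 vs] nth_mem[of 1 vs] by simp_all
  have ne: "vs ! 0 \<noteq> vs ! 1" using vs by (simp add: nth_eq_iff_index_eq)
  have F_sym: "?F \<alpha> \<beta> \<gamma> x y = ?F \<alpha> \<beta> \<gamma> y x" for \<alpha> \<beta> \<gamma> x y
    by (auto simp: ten_fun_def Let_def)
  show False
  proof (rule L2_no_irrational_pair[of "?F 0 (-1) 1" "vs ! 0" "vs ! 1" "?F 2 (-6) 4" 0 9 16 0])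
    show "?F 2 (-6) 4 (vs ! 0) (vs ! 1) + 0 \<noteq> 0"
      using pos[of 0] pos[of 1] vs(3) by (simp add: ten_fun_def)
    show "L2 (?F 0 (-1) 1) i j = ?F 2 (-6) 4 i j + 0" if "i \<in> V" "j \<in> V" "i \<noteq> j" for i j
      unfolding add_0_right by (rule L2F[OF that]) code_simp
    have 2: "9 * ten_fun 2 (-6) 4 i j - 16 * ten_fun 0 (-1) 1 i j = ten_fun 18 (-38) 20 i j" for i j
      by (simp add: ten_fun_def Let_def)
    show "L2 (?F 2 (-6) 4) i j = 9 * ?F 2 (-6) 4 i j - 16 * ?F 0 (-1) 1 i j + 0"
      if "i \<in> V" "j \<in> V" "i \<noteq> j" for i j
      unfolding add_0_right 2 by (rule L2F[OF that]) code_simp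
    show "poly [:16, - 9, 1:] z \<noteq> 0" for z :: int
      by (rule no_int_root_mod[of 3]) code_simp+
  qed (use in_V ne F_sym in auto)
qed

section \<open>Ten vertices with a triangle, and the summary of all cases\<close>

context integral_cubic
begin

text \<open>There are no 4-cycles, and a triangle determines the graph: the outer neighbours of its
  vertices lie on no triangle, one vertex is adjacent to all three of them, and the last three
  vertices form the second triangle.\<close>

lemma no_ten_with_triangle:
  assumes "\<not> bip" "sz = 10" "a1 \<in> V" "W 3 a1 a1 \<noteq> 0"
  shows False
proof -
  have em: "em = 12" using em_unique assms by simp
  have k4: "W 4 v v = 15" if "v \<in> V" for v using sz_cases[OF that] assms by simp
  have nV: "card V = 10" using assms by (simp add: sz_def)
  have Ev: "u \<in> Ev v" "u \<in> Od v" if "u \<in> V" "v \<in> V" for u v using not_bip[OF assms(1) that(2)] that by auto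
  have t: "W 3 v v = 0 \<or> W 3 v v = 2" if "v \<in> V" for v
    using W_3_diag_of_nonbip[OF assms(1) that] even_W_3_diag[OF that]
    unfolding diag_values(1)[OF that] k4[OF that] em by presburger
  have W1d: "W 1 v v = 0" if "v \<in> V" for v using W_1[OF that, of v] N_irrefl[OF that] by simp
  have W4: "W 4 u w = 5 * W 2 u w - 4 * W 0 u w + 4" if uw: "u \<in> V" "w \<in> V" for u w
  proof -
    \<comment> \<open>(x^2 - 1)(x^2 - 4). For em = 12 the diagonal of Xp(A) vanishes, so 0 is not an
      eigenvalue, and neither is -3 as the graph is not bipartite. So the rows are constant, with
      entry 40 / 10 = 4.\<close>
    define p :: "int poly" where "p = [:4, 0, -5, 0, 1:]"
    define p2 :: "int poly" where "p2 = [:16, 0, -4, 0, -16, 0, 4:]"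
    have "PA (p * p) u u = PA p2 u u"
      by (rule PA_mod_mu[OF uw(1,1), of _ _ "[:0, 1:]"]) (simp add: p_def p2_def mu_def)
    also have "\<dots> = 16 * W 0 u u - 4 * W 2 u u - 16 * W 4 u u + 4 * W 6 u u"
      unfolding p2_def by (simp add: W_expand eval_nat_numeral)
    finally have "PA (p * p) u u = 160"
      using W_6[OF uw(1,1)] Ev[OF uw(1,1)] k4[OF uw(1)] W_2_refl[OF uw(1)] em by (simp add: W_0)
    then have "PA p u w = 4"
      using nV by (intro constant_row[OF uw(1) _ uw(2)]) (simp add: p_def)
    then show ?thesis unfolding p_def by (simp add: W_expand eval_nat_numeral)
  qed
  have quad: "x = y" if "u \<in> V" "w \<in> V" "u \<noteq> w" "x \<in> N u" "x \<in> N w" "y \<in> N u" "y \<in> N w" for u w x y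
  proof -
    have "card (N u \<inter> N w) \<le> 1"
      using W_2_le_1_of_W_4[OF that(1-3) k4[OF that(1)]] W_2[OF that(1,2)] by simp
    moreover have "finite (N u \<inter> N w)" using finite_N[OF that(1)] by simp
    ultimately show ?thesis using that(4-7) card_le_Suc0_iff_eq[of "N u \<inter> N w"] by simp
  qed
  text \<open>The projection to the eigenvalue \<open>-2\<close> rules out two triangles joined by an edge.\<close>
  have outer: "W 3 p p = 0" if a: "a \<in> V" "W 3 a a = 2" and p: "p \<in> N a" "W 2 a p = 0" for a p
  proof (rule ccontr)
    assume "W 3 p p \<noteq> 0"
    have pV: "p \<in> V" using N_in_V[OF a(1) p(1)] .
    then have p3: "W 3 p p = 2" using t \<open>W 3 p p \<noteq> 0\<close> by blast
    \<comment> \<open>x (x - 2)(x^2 - 1)(x^2 - 9), which is -120 at -2 and 0 at the other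
      eigenvalues. Diagonal entries -28 with an off-diagonal entry 32 contradict
      semidefiniteness.\<close>
    define zp :: "int poly" where "zp = [:0, -18, 9, 20, -10, -2, 1:]"
    have z: "PA zp u v = W 6 u v - 2 * W 5 u v - 10 * W 4 u v + 20 * W 3 u v + 9 * W 2 u v - 18 * W 1 u v" for u v
      unfolding zp_def by (simp add: W_expand eval_nat_numeral)
    have zz: "PA (zp * zp) u v = - 120 * PA zp u v" if "u \<in> V" "v \<in> V" for u v
    proof -
      have "PA (zp * zp) u v = PA (Polynomial.smult (- 120) zp) u v"
        by (rule PA_mod_mu[OF that, of _ _ "[:60, -39, 24, -2, -4, 1:]"]) (simp add: zp_def mu_def)
      then show ?thesis by (simp add: PA_smult PA_minus)
    qed
    have d: "PA zp v v = - 28" if "v \<in> V" "W 3 v v = 2" for v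
      unfolding z using W_6[OF that(1,1)] W_5[OF that(1,1)] k4[OF that(1)] W_2_refl[OF that(1)] that(2) W1d[OF that(1)] Ev[OF that(1,1)] em
      by simp
    have "a \<noteq> p" using p N_irrefl a by blast
    then have "PA zp a p = 32"
      unfolding z using W_6[OF a(1) pV] W_5[OF a(1) pV] W4[OF a(1) pV] W_3_edge_of_W_4[OF a(1) p(1) k4[OF a(1)]]
        p W_1[OF a(1), of p] Ev[OF a(1) pV] em by (simp add: W_0)
    then have "(\<Sum>w\<in>V. (PA zp a w + 1 * PA zp p w)\<^sup>2) = - 960"
      unfolding gram[OF a(1) pV] zz[OF a(1,1)] zz[OF a(1) pV] zz[OF pV pV] d[OF a] d[OF pV p3] by simp
    moreover have "0 \<le> (\<Sum>w\<in>V. (PA zp a w + 1 * PA zp p w)\<^sup>2)" by (intro sum_nonneg) simp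
    ultimately show False by simp
  qed
  have t_of_triangle: "W 3 x x = 2" if "x \<in> V" "y \<in> N x" "w \<in> N x" "w \<in> N y" for x y w
  proof -
    have yV: "y \<in> V" using N_in_V that by blast
    have "w \<in> N x \<inter> N y" using that by simp
    then have "card (N x \<inter> N y) \<noteq> 0" using finite_N[OF that(1)] by (metis card_0_eq empty_iff finite_Int)
    then have 1: "1 \<le> W 2 x y" using W_2[OF that(1) yV] by simp
    have "W 2 x y \<le> (\<Sum>k\<in>N x. W 2 x k)"
      using that(2) finite_N[OF that(1)] W_nonneg[OF that(1) N_in_V[OF that(1)], of _ 2]
      by (intro member_le_sum) auto
    then have "W 3 x x \<noteq> 0" using sum_N_W[OF that(1,1), of 2] 1 by simp
    then show ?thesis using t[OF that(1)] by blast
  qed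
  obtain a2 a3 where a23: "a2 \<in> N a1" "a3 \<in> N a1" "a3 \<in> N a2"
  proof -
    have "\<exists>k\<in>N a1. W 2 a1 k \<noteq> 0"
    proof (rule ccontr)
      assume "\<not> ?thesis"
      then have "(\<Sum>k\<in>N a1. W 2 a1 k) = 0" by (intro sum.neutral) blast
      then show False using sum_N_W[OF assms(3,3), of 2] assms(4) by simp
    qed
    then obtain k where k: "k \<in> N a1" "W 2 a1 k \<noteq> 0" by blast
    then have "card (N a1 \<inter> N k) \<noteq> 0" using W_2[OF assms(3) N_in_V[OF assms(3) k(1)]] by simp
    then have "N a1 \<inter> N k \<noteq> {}" by (metis card.empty)
    then obtain l where "l \<in> N a1" "l \<in> N k" by blast
    then show thesis using that k(1) by blast
  qed
  have aV: "a1 \<in> V" "a2 \<in> V" "a3 \<in> V" using assms(3) a23 N_in_V by blast+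
  have sym: "x \<in> N y" if "y \<in> V" "x \<in> V" "y \<in> N x" for x y using N_sym that by blast
  have aN: "a1 \<in> N a2" "a1 \<in> N a3" "a2 \<in> N a3" using a23 aV sym by blast+
  have ane: "a1 \<noteq> a2" "a1 \<noteq> a3" "a2 \<noteq> a3" using a23 aN aV N_irrefl by blast+
  have third: "\<exists>p. N x = {y, w, p} \<and> p \<noteq> y \<and> p \<noteq> w"
    if "x \<in> V" "y \<in> N x" "w \<in> N x" "y \<noteq> w" for x y w
  proof -
    have sub: "{y, w} \<subseteq> N x" using that by simp
    have "card (N x - {y, w}) = 1" using card_Diff_subset[OF _ sub] card_N[OF that(1)] that(4) by simp
    then obtain p where p: "N x - {y, w} = {p}" by (auto simp: card_1_singleton_iff)
    have "p \<in> N x - {y, w}" unfolding p by simp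
    moreover have "N x = {y, w} \<union> (N x - {y, w})" using sub by auto
    then have "N x = {y, w, p}" unfolding p by auto
    ultimately show ?thesis by blast
  qed
  obtain p1 where p1: "N a1 = {a2, a3, p1}" "p1 \<noteq> a2" "p1 \<noteq> a3"
    using third[OF aV(1) a23(1,2) ane(3)] by (elim exE conjE)
  obtain p2 where p2: "N a2 = {a1, a3, p2}" "p2 \<noteq> a1" "p2 \<noteq> a3"
    using third[OF aV(2) aN(1) a23(3) ane(2)] by (elim exE conjE)
  obtain p3 where p3: "N a3 = {a1, a2, p3}" "p3 \<noteq> a1" "p3 \<noteq> a2"
    using third[OF aV(3) aN(2,3) ane(1)] by (elim exE conjE)
  have pN: "p1 \<in> N a1" "p2 \<in> N a2" "p3 \<in> N a3" using p1 p2 p3 by simp_all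
  have pV: "p1 \<in> V" "p2 \<in> V" "p3 \<in> V" using pN aV N_in_V by blast+
  have apN: "a1 \<in> N p1" "a2 \<in> N p2" "a3 \<in> N p3" using pN aV pV sym by blast+
  have pa: "p1 \<noteq> a1" "p2 \<noteq> a2" "p3 \<noteq> a3" using pN aV N_irrefl by blast+
  have pp: "p1 \<noteq> p2" "p1 \<noteq> p3" "p2 \<noteq> p3"
  proof -
    show "p1 \<noteq> p2" using quad[OF aV(1,2) ane(1) a23(2,3), of p1] pN p1(3) by auto
    show "p1 \<noteq> p3" using quad[OF aV(1,3) ane(2) a23(1) aN(3), of p1] pN p1(2) by auto
    show "p2 \<noteq> p3" using quad[OF aV(2,3) ane(3) aN(1,2), of p2] pN p2(2) by auto
  qed
  have tp: "W 3 p p = 0" if "a \<in> V" "b \<in> V" "c \<in> V" "N a = {b, c, p}" "c \<in> N b" "p \<noteq> b" "p \<noteq> c" "b \<noteq> c"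
    "p \<notin> N b" "p \<notin> N c" for a b c p
  proof (rule outer[OF that(1)])
    show pa': "p \<in> N a" using that(4) by simp
    show "W 3 a a = 2" using t_of_triangle[OF that(1), of b c] that(4,5) by simp
    have "N a \<inter> N p = {}"
    proof -
      have "b \<notin> N p" "c \<notin> N p" using that N_sym[OF N_in_V[OF that(1) pa']] by blast+
      moreover have "p \<notin> N p" using N_irrefl[OF N_in_V[OF that(1) pa']] .
      ultimately show ?thesis unfolding that(4) by simp
    qed
    then show "W 2 a p = 0" using W_2[OF that(1) N_in_V[OF that(1) pa']] by simp
  qed
  have pt: "W 3 p1 p1 = 0" "W 3 p2 p2 = 0" "W 3 p3 p3 = 0"
  proof -
    show "W 3 p1 p1 = 0"
      by (rule tp[OF aV p1(1) a23(3) p1(2,3) ane(3)]) (use p1 p2 p3 pa pp in simp_all)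
    show "W 3 p2 p2 = 0"
      by (rule tp[OF aV(2,1,3) p2(1) a23(2) p2(2,3) ane(2)]) (use p1 p2 p3 pa pp in simp_all)
    show "W 3 p3 p3 = 0"
      by (rule tp[OF aV(3,1,2) p3(1) a23(1) p3(2,3) ane(1)]) (use p1 p2 p3 pa pp in simp_all)
  qed
  \<comment> \<open>The triangle \<open>A\<close>, its outer neighbours \<open>P\<close> and the
    four other vertices \<open>R\<close>. Each vertex of \<open>P\<close> has two neighbours in
    \<open>R\<close>.\<close>
  define P where "P = {p1, p2, p3}"
  define A where "A = {a1, a2, a3}"
  define R where "R = V - (A \<union> P)"
  have cP: "card P = 3" using pp by (simp add: P_def)
  have PV: "P \<subseteq> V" and AV: "A \<subseteq> V" using pV aV by (auto simp: P_def A_def)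
  have AP: "A \<inter> P = {}" using p1 p2 p3 pa by (auto simp: A_def P_def)
  have cAP: "card (A \<union> P) = 6"
  proof -
    have "card A = 3" using ane by (simp add: A_def)
    then show ?thesis using cP AP by (subst card_Un_disjoint) (auto simp: A_def P_def)
  qed
  have cR: "card R = 4" unfolding R_def
    using card_Diff_subset[of "A \<union> P" V] cAP nV PV AV finite_V by (simp add: finite_subset)
  have finR: "finite R" using finite_V by (simp add: R_def)
  have R_V: "r \<in> V" "r \<notin> A" "r \<notin> P" if "r \<in> R" for r using that by (auto simp: R_def)
  have no_tri: "w \<notin> N x" if "p \<in> P" "x \<in> N p" "w \<in> N p" for p x w
  proof
    assume "w \<in> N x"
    have "p \<in> V" using that PV by blast
    then have "W 3 p p = 2" by (rule t_of_triangle[OF _ that(2,3) \<open>w \<in> N x\<close>])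
    then show False using pt that(1) by (auto simp: P_def)
  qed
  have foot: "\<exists>a\<in>A. a \<in> N p \<and> N p - {a} \<subseteq> R" if p: "p \<in> P" for p
  proof -
    have pnp: "q \<notin> N p" if "q \<in> P" for q
    proof -
      have *: "y \<notin> N x" if "b \<in> V" "c \<in> V" "x \<in> N b" "y \<in> N c" "c \<in> N b" "x \<in> V" "y \<in> V" "x \<noteq> c" "y \<noteq> b" for b c x y
      proof
        assume "y \<in> N x"
        then have "x \<in> N y" "c \<in> N y" "b \<in> N c" using N_sym that by blast+
        then have "x = c" using quad[of b y x c] that by blast
        then show False using that by blast
      qed
      have irr: "p \<notin> N p" using p PV N_irrefl by blast
      have 12: "p2 \<notin> N p1" by (rule *[OF aV(1,2) pN(1,2) a23(1) pV(1,2) p1(2) p2(2)])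
      have 13: "p3 \<notin> N p1" by (rule *[OF aV(1,3) pN(1,3) a23(2) pV(1,3) p1(3) p3(2)])
      have 23: "p3 \<notin> N p2" by (rule *[OF aV(2,3) pN(2,3) a23(3) pV(2,3) p2(3) p3(3)])
      have "p1 \<notin> N p2" "p1 \<notin> N p3" "p2 \<notin> N p3" using 12 13 23 sym pV by blast+
      with 12 13 23 irr p that show ?thesis by (auto simp: P_def)
    qed
    have na: "a \<notin> N p" if "a \<in> V" "p \<notin> N a" for a using that N_sym p PV by blast
    have NpV: "N p \<subseteq> V" using N_subset p PV by blast
    from p consider "p = p1" | "p = p2" | "p = p3" by (auto simp: P_def)
    then show ?thesis
    proof cases
      case 1
      have "a2 \<notin> N p" "a3 \<notin> N p" using na aV p1 p2 p3 pp pa 1 by simp_all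
      then have "N p - {a1} \<subseteq> R" using pnp NpV by (auto simp: R_def A_def)
      then show ?thesis using apN 1 by (auto simp: A_def)
    next
      case 2
      have "a1 \<notin> N p" "a3 \<notin> N p" using na aV p1 p2 p3 pp pa 2 by simp_all
      then have "N p - {a2} \<subseteq> R" using pnp NpV by (auto simp: R_def A_def)
      then show ?thesis using apN 2 by (auto simp: A_def)
    next
      case 3
      have "a1 \<notin> N p" "a2 \<notin> N p" using na aV p1 p2 p3 pp pa 3 by simp_all
      then have "N p - {a3} \<subseteq> R" using pnp NpV by (auto simp: R_def A_def)
      then show ?thesis using apN 3 by (auto simp: A_def)
    qed
  qed
  have NR2: "card (N p \<inter> R) = 2" if p: "p \<in> P" for p
  proof -
    obtain a where a: "a \<in> A" "a \<in> N p" "N p - {a} \<subseteq> R" using foot[OF p] by blast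
    then have "N p \<inter> R = N p - {a}" by (auto simp: R_def)
    then show ?thesis using a(2) card_N p PV finite_N by (metis One_nat_def Suc_1 card_Diff_singleton diff_Suc_1 numeral_3_eq_3 subsetD)
  qed
  have NR: "N r \<subseteq> P \<union> R" if r: "r \<in> R" for r
  proof
    fix x assume x: "x \<in> N r"
    have "x \<in> V" "r \<in> N x" using x R_V[OF r] N_in_V N_sym by blast+
    moreover have "x \<notin> A"
    proof
      assume "x \<in> A"
      then have "r \<in> A \<union> P" using \<open>r \<in> N x\<close> p1 p2 p3 by (auto simp: A_def P_def)
      then show False using R_V[OF r] by blast
    qed
    ultimately show "x \<in> P \<union> R" by (auto simp: R_def)
  qed
  have "\<exists>c\<in>R. N c = P"
  proof -
    have double: "(\<Sum>r\<in>R. card (N r \<inter> P)) = 6"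
    proof -
      have "(\<Sum>r\<in>R. card (N r \<inter> P)) = (\<Sum>r\<in>R. \<Sum>p\<in>P. if p \<in> N r then 1 else 0)"
        by (intro sum.cong refl) (simp add: P_def sum.If_cases Int_commute)
      also have "\<dots> = (\<Sum>p\<in>P. \<Sum>r\<in>R. if p \<in> N r then 1 else 0)" by (rule sum.swap)
      also have "\<dots> = (\<Sum>p\<in>P. card (N p \<inter> R))"
      proof (rule sum.cong[OF refl])
        fix p assume p: "p \<in> P"
        have "(\<Sum>r\<in>R. if p \<in> N r then 1 else 0) = (\<Sum>r\<in>R. if r \<in> N p then 1 else (0::nat))"
          using N_commute R_V(1) p PV by (intro sum.cong refl) (auto simp: subset_eq)
        then show "(\<Sum>r\<in>R. if p \<in> N r then 1 else 0) = card (N p \<inter> R)"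
          using finR by (simp add: sum.If_cases Int_commute)
      qed
      also have "\<dots> = 6" using NR2 cP by simp
      finally show ?thesis .
    qed
    \<comment> \<open>Six edges between \<open>P\<close> and \<open>R\<close> are spread over four
      vertices of \<open>R\<close>.\<close>
    have "\<exists>r\<in>R. card (N r \<inter> P) \<le> 1"
    proof (rule ccontr)
      assume "\<not> ?thesis"
      then have "(\<Sum>r\<in>R. 2) \<le> (\<Sum>r\<in>R. card (N r \<inter> P))" by (intro sum_mono) (simp add: not_le numeral_2_eq_2 Suc_le_eq)
      then show False using double cR by simp
    qed
    then obtain r where r: "r \<in> R" "card (N r \<inter> P) \<le> 1" by blast
    have rV: "r \<in> V" using R_V[OF r(1)] by blast
    have split: "card (N r \<inter> P) + card (N r \<inter> R) = 3"
    proof -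
      have "N r = (N r \<inter> P) \<union> (N r \<inter> R)" using NR[OF r(1)] by blast
      moreover have "(N r \<inter> P) \<inter> (N r \<inter> R) = {}" by (auto simp: R_def)
      ultimately show ?thesis using card_Un_disjoint[of "N r \<inter> P" "N r \<inter> R"] finite_N[OF rV] card_N[OF rV] by simp
    qed
    have rirr: "r \<notin> N r" using N_irrefl[OF rV] .
    have cRr: "card (R - {r}) = 3" using r(1) cR finR by simp
    \<comment> \<open>Otherwise r is adjacent to all of the rest of \<open>R\<close> and forms a
      4-cycle with p1 and its two neighbours there.\<close>
    have "card (N r \<inter> P) \<noteq> 0"
    proof
      assume "card (N r \<inter> P) = 0"
      then have "N r \<inter> R = R - {r}"
        using split cRr rirr finR by (intro card_subset_eq) auto
      moreover have "p1 \<in> P" by (simp add: P_def)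
      moreover have "r \<notin> N p1"
      proof
        assume "r \<in> N p1"
        then have "p1 \<in> N r \<inter> P" using N_sym pV by (auto simp: P_def)
        then show False using \<open>card (N r \<inter> P) = 0\<close> finite_N[OF rV] by auto
      qed
      moreover obtain x y where "x \<in> N p1 \<inter> R" "y \<in> N p1 \<inter> R" "x \<noteq> y"
        using NR2[OF \<open>p1 \<in> P\<close>] by (auto simp: card_2_iff)
      ultimately have "x \<in> N r" "y \<in> N r" "x \<in> N p1" "y \<in> N p1" by auto
      moreover have "r \<noteq> p1" using R_V[OF r(1)] by (auto simp: P_def)
      ultimately show False using quad[OF rV pV(1)] \<open>x \<noteq> y\<close> by blast
    qed
    then have "card (N r \<inter> P) = 1" using r(2) by simp
    then obtain p where p: "N r \<inter> P = {p}" by (auto simp: card_1_singleton_iff)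
    have "p \<in> N r \<inter> P" unfolding p by simp
    then have pp': "p \<in> N r" "p \<in> P" by simp_all
    have rp: "r \<in> N p" using N_sym[OF rV pp'(1)] .
    have "card ((N p \<inter> R) - {r}) = 1" using NR2[OF pp'(2)] rp r(1) finR by simp
    then obtain c where c: "(N p \<inter> R) - {r} = {c}" by (auto simp: card_1_singleton_iff)
    have "c \<in> (N p \<inter> R) - {r}" unfolding c by simp
    then have cc: "c \<in> N p" "c \<in> R" "c \<noteq> r" by simp_all
    have cV: "c \<in> V" using R_V[OF cc(2)] by blast
    have "c \<notin> N r" using no_tri[OF pp'(2) rp cc(1)] .
    have "card (N r \<inter> R) = 2" using split \<open>card (N r \<inter> P) = 1\<close> by simp
    moreover have "card (R - {r, c}) = 2" using card_Diff_subset[of "{r, c}" R] cR r(1) cc finR by simp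
    ultimately have NrR: "N r \<inter> R = R - {r, c}"
      using rirr \<open>c \<notin> N r\<close> finR by (intro card_subset_eq) auto
    \<comment> \<open>A neighbour of c in \<open>R\<close> would also be a neighbour of r and close
      a 4-cycle through p.\<close>
    have "N c \<subseteq> P"
    proof
      fix s assume s: "s \<in> N c"
      show "s \<in> P"
      proof (rule ccontr)
        assume "s \<notin> P"
        then have sR: "s \<in> R" using NR[OF cc(2)] s by blast
        have "s \<noteq> c" using s N_irrefl[OF cV] by blast
        moreover have "s \<noteq> r" using s \<open>c \<notin> N r\<close> N_sym[OF cV] by blast
        ultimately have "s \<in> N r \<inter> R" unfolding NrR using sR by simp
        then have "s \<in> N r" by simp
        moreover have "p \<in> N c" using N_sym[of p c] cc(1) pp'(2) PV by blast
        ultimately have "s = p" using quad[OF rV cV, of s p] s pp'(1) cc(3) by blast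
        then show False using \<open>s \<notin> P\<close> pp'(2) by blast
      qed
    qed
    then have "N c = P" using card_subset_eq[of P "N c"] cP card_N[OF cV] by (simp add: P_def)
    then show ?thesis using cc(2) by blast
  qed
  then obtain c where c: "c \<in> R" "N c = P" by blast
  have cV: "c \<in> V" "c \<notin> A" "c \<notin> P" using R_V[OF c(1)] by blast+
  have cp: "c \<in> N p1" "c \<in> N p2" "c \<in> N p3"
    using N_sym[OF cV(1), of p1] N_sym[OF cV(1), of p2] N_sym[OF cV(1), of p3] c(2) by (simp_all add: P_def)
  have ca: "a1 \<noteq> c" "a2 \<noteq> c" "a3 \<noteq> c" using cV(2) by (auto simp: A_def)
  obtain x1 where x1: "N p1 = {a1, c, x1}" "x1 \<noteq> a1" "x1 \<noteq> c"
    using third[OF pV(1) apN(1) cp(1) ca(1)] by (elim exE conjE)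
  obtain x2 where x2: "N p2 = {a2, c, x2}" "x2 \<noteq> a2" "x2 \<noteq> c"
    using third[OF pV(2) apN(2) cp(2) ca(2)] by (elim exE conjE)
  obtain x3 where x3: "N p3 = {a3, c, x3}" "x3 \<noteq> a3" "x3 \<noteq> c"
    using third[OF pV(3) apN(3) cp(3) ca(3)] by (elim exE conjE)
  have inR: "x \<in> R" if p: "p \<in> P" and N: "N p = {a, c, x}" and "a \<in> A" "x \<noteq> a" for p a x
  proof -
    obtain b where b: "b \<in> A" "b \<in> N p" "N p - {b} \<subseteq> R" using foot[OF p] by blast
    have "a = b"
    proof (rule ccontr)
      assume "a \<noteq> b"
      then have "a \<in> N p - {b}" unfolding N by simp
      then show False using b(3) \<open>a \<in> A\<close> R_V(2) by blast
    qed
    then have "x \<in> N p - {b}" unfolding N using that(4) by simp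
    then show ?thesis using b(3) by blast
  qed
  have xR: "x1 \<in> R" "x2 \<in> R" "x3 \<in> R"
    using inR[OF _ x1(1)] inR[OF _ x2(1)] inR[OF _ x3(1)] x1(2) x2(2) x3(2) by (auto simp: P_def A_def)
  have xN: "x1 \<in> N p1" "x2 \<in> N p2" "x3 \<in> N p3" using x1 x2 x3 by simp_all
  have xx: "x1 \<noteq> x2" "x1 \<noteq> x3" "x2 \<noteq> x3"
  proof -
    show "x1 \<noteq> x2" using quad[OF pV(1,2) pp(1) cp(1,2), of x1] xN x1(3) by auto
    show "x1 \<noteq> x3" using quad[OF pV(1,3) pp(2) cp(1,3), of x1] xN x1(3) by auto
    show "x2 \<noteq> x3" using quad[OF pV(2,3) pp(3) cp(2,3), of x2] xN x2(3) by auto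
  qed
  have Req: "R = {c, x1, x2, x3}"
  proof -
    have "{c, x1, x2, x3} \<subseteq> R" using c(1) xR by simp
    moreover have "card {c, x1, x2, x3} = 4" using xx x1(3) x2(3) x3(3) by auto
    ultimately have "{c, x1, x2, x3} = R" using card_subset_eq[OF finR] cR by metis
    then show ?thesis by simp
  qed
  have xa: "x \<noteq> a1" "x \<noteq> a2" "x \<noteq> a3" "x \<noteq> p1" "x \<noteq> p2" "x \<noteq> p3" if "x \<in> R" for x
    using R_V[OF that] by (auto simp: A_def P_def)
  have Nx: "N x = {p, y, w}"
    if x: "x \<in> R" "x \<in> N p" "R = {c, x, y, w}" "P = {p, q, q'}" "x \<notin> N q" "x \<notin> N q'" "y \<noteq> w"
      "y \<in> R" "w \<in> R" "x \<noteq> c" for x y w p q q'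
  proof -
    have xV: "x \<in> V" using R_V x(1) by blast
    have PV': "p \<in> V" "q \<in> V" "q' \<in> V" using PV x(4) by auto
    have "q \<notin> N x" "q' \<notin> N x" using N_sym[OF xV] x(5,6) by blast+
    moreover have "c \<notin> N x"
    proof
      assume "c \<in> N x"
      then have "x \<in> N c" using N_sym[OF xV] by blast
      then show False using c(2) R_V(3)[OF x(1)] by simp
    qed
    moreover have "x \<notin> N x" using N_irrefl[OF xV] .
    ultimately have sub: "N x \<subseteq> {p, y, w}" using NR[OF x(1)] unfolding x(4) x(3) by auto
    have "p \<in> P" unfolding x(4) by simp
    then have "p \<noteq> y" "p \<noteq> w" using R_V(3) x(8,9) by blast+
    then have "card {p, y, w} = 3" using x(7) by simp
    then show ?thesis using card_subset_eq[OF _ sub] card_N[OF xV] by simp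
  qed
  have Nx1: "N x1 = {p1, x2, x3}"
    by (rule Nx[OF xR(1) xN(1), of _ _ p2 p3]) (use Req xx xR xa x1 x2 x3 in \<open>auto simp: P_def\<close>)
  have Nx2: "N x2 = {p2, x1, x3}"
    by (rule Nx[OF xR(2) xN(2), of _ _ p1 p3]) (use Req xx xR xa x1 x2 x3 in \<open>auto simp: P_def\<close>)
  have Nx3: "N x3 = {p3, x1, x2}"
    by (rule Nx[OF xR(3) xN(3), of _ _ p1 p2]) (use Req xx xR xa x1 x2 x3 in \<open>auto simp: P_def\<close>)
  let ?vs = "[a1, a2, a3, p1, p2, p3, x1, x2, x3, c]"
  have "set ?vs = A \<union> P \<union> R" unfolding Req by (auto simp: A_def P_def)
  also have "\<dots> = V" using AV PV by (auto simp: R_def)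
  finally have setV: "set ?vs = V" .
  have dist: "distinct ?vs"
    by (rule card_distinct) (use setV nV in simp)
  show False
  proof (rule ten_vertex_contradiction[OF dist setV])
    show "N (?vs ! i) = (\<lambda>k. ?vs ! k) ` set (ten_nbs i)" if "i < 10" for i
    proof -
      from that have "i \<in> {0, 1, 2, 3, 4, 5, 6, 7, 8, 9}" by auto
      then show ?thesis
        by (elim insertE) (auto simp: ten_nbs_def p1(1) p2(1) p3(1) x1(1) x2(1) x3(1) Nx1 Nx2 Nx3 c(2) P_def)
    qed
  qed simp
qed

lemma sz_4_or_3:
  "sz = 4 \<and> \<not> bip \<or> sz = 3"
proof -
  obtain v where v: "v \<in> V" using V_nonempty by blast
  have nb: "\<not> bip \<Longrightarrow> even sz" using even_card_V by (simp add: sz_def)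
  have k15: "W 4 v v = 15" if "sz = 15 \<or> sz = 12 \<or> sz = 10" "v \<in> V" for v using sz_cases[OF that(2)] that(1) by auto
  have ten: "\<not> (\<not> bip \<and> sz = 10)"
    using no_petersen no_ten_with_triangle by blast
  have bip_big: "\<not> (bip \<and> (sz = 15 \<or> sz = 12 \<or> sz = 10))"
    using no_bip_without_4_cycles k15 em_unique by blast
  show ?thesis
    using sz_cases[OF v] nb ten bip_big no_truncated_tetrahedron sz_not_8 no_prism no_hexagonal_prism no_sz_5 no_cube
    by (cases bip) auto
qed

end

section \<open>Sums of transpositions with integral eigenvalues\<close>

text \<open>Adjacency operator of the Cayley graph for a set of transpositions, where the neighbours
  of g are the products of some t in \<open>T\<close> with g.\<close>

definition perm_op :: "(nat \<Rightarrow> nat) set \<Rightarrow> ((nat \<Rightarrow> nat) \<Rightarrow> complex) \<Rightarrow> (nat \<Rightarrow> nat) \<Rightarrow> complex" where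
  "perm_op T F g = (\<Sum>t\<in>T. F (t \<circ> g))"

definition supp_on :: "'x set \<Rightarrow> ('x \<Rightarrow> complex) \<Rightarrow> bool" where
  "supp_on D F \<longleftrightarrow> (\<forall>x. x \<notin> D \<longrightarrow> F x = 0)"

text \<open>Functions supported on \<open>D\<close> play the role of the vector space over
  \<open>D\<close>; preservation of the support keeps eigenvectors in it.\<close>

definition integral_op :: "'x set \<Rightarrow> (('x \<Rightarrow> complex) \<Rightarrow> 'x \<Rightarrow> complex) \<Rightarrow> bool" where
  "integral_op D L \<longleftrightarrow> linear_op L \<and> (\<forall>F. supp_on D F \<longrightarrow> supp_on D (L F)) \<and>
     (\<forall>F k. supp_on D F \<longrightarrow> F \<noteq> (\<lambda>_. 0) \<longrightarrow> L F = (\<lambda>x. k * F x) \<longrightarrow> k \<in> \<int>)"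

lemma integral_opI:
  assumes "linear_op L" "\<And>F. supp_on D F \<Longrightarrow> supp_on D (L F)"
    "\<And>F k. supp_on D F \<Longrightarrow> F \<noteq> (\<lambda>_. 0) \<Longrightarrow> L F = (\<lambda>x. k * F x) \<Longrightarrow> k \<in> \<int>"
  shows "integral_op D L"
  using assms unfolding integral_op_def by blast

lemma integral_opD:
  assumes "integral_op D L"
  shows "linear_op L" "\<And>F. supp_on D F \<Longrightarrow> supp_on D (L F)"
    "\<And>F k. supp_on D F \<Longrightarrow> F \<noteq> (\<lambda>_. 0) \<Longrightarrow> L F = (\<lambda>x. k * F x) \<Longrightarrow> k \<in> \<int>"
  using assms unfolding integral_op_def by blast+

text \<open>\<open>a\<close> preserves the eigenspace of \<open>B\<close> for
  \<open>\<beta>\<close>, so an eigenvector of \<open>a\<close> that has the form q(a) F stays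
  inside it.\<close>

lemma common_eigenvector:
  fixes a B :: "('x \<Rightarrow> complex) \<Rightarrow> 'x \<Rightarrow> complex"
  assumes a: "linear_op a" "\<And>F. supp_on D F \<Longrightarrow> supp_on D (a F)" and B: "linear_op B"
    and fin: "finite D" and comm: "\<And>F. a (B F) = B (a F)"
    and F: "supp_on D F" "F \<noteq> (\<lambda>_. 0)" "B F = (\<lambda>x. \<beta> * F x)"
  obtains G \<alpha> where "supp_on D G" "G \<noteq> (\<lambda>_. 0)" "B G = (\<lambda>x. \<beta> * G x)" "a G = (\<lambda>x. \<alpha> * G x)"
proof -
  interpret a: linear_op a by (rule a(1))
  interpret B: linear_op B by (rule B)
  obtain p where p: "p \<noteq> 0" "polyop a p F = (\<lambda>_. 0)"
    using exists_annihilating_poly[OF a(1) fin, of F] a(2) F(1) unfolding supp_on_def by blast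
  obtain \<alpha> q where q: "polyop a q F \<noteq> (\<lambda>_. 0)" "a (polyop a q F) = (\<lambda>x. \<alpha> * polyop a q F x)"
    using eigenvector_of_annihilating_poly[OF a(1) p F(2)] by blast
  have "B (polyop a q F) = (\<lambda>x. \<beta> * polyop a q F x)"
  proof (induction q)
    case (pCons c q)
    have "B (polyop a (pCons c q) F) = (\<lambda>x. c * B F x + a (B (polyop a q F)) x)"
      by (simp add: B.op_add B.op_scale comm)
    also have "\<dots> = (\<lambda>x. \<beta> * polyop a (pCons c q) F x)"
      unfolding pCons.IH F(3) a.op_scale by (simp add: algebra_simps)
    finally show ?case .
  qed simp
  moreover have "supp_on D (polyop a q F)"
    by (rule a.polyop_closed) (use F(1) a(2) in \<open>auto simp: supp_on_def\<close>)
  ultimately show thesis using that q by blast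
qed

lemma linear_op_add:
  "linear_op a \<Longrightarrow> linear_op b \<Longrightarrow> linear_op (\<lambda>F x. a F x + b F x)"
  unfolding linear_op_def by (simp add: fun_eq_iff algebra_simps)

text \<open>\<open>a\<close> commutes with the sum, so an eigenvector of the sum can be replaced by
  one that is also an eigenvector of \<open>a\<close>, hence of \<open>b\<close>. The eigenvalue is
  then a sum of two integers.\<close>

lemma integral_op_add:
  assumes fin: "finite D" and a: "integral_op D a" and b: "integral_op D b"
    and comm: "\<And>F. a (b F) = b (a F)"
  shows "integral_op D (\<lambda>F x. a F x + b F x)"
proof (rule integral_opI)
  interpret a: linear_op a by (rule integral_opD(1)[OF a])
  show lin: "linear_op (\<lambda>F x. a F x + b F x)"
    using linear_op_add integral_opD(1) a b by blast
  show "supp_on D (\<lambda>x. a F x + b F x)" if "supp_on D F" for F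
    using integral_opD(2)[OF a that] integral_opD(2)[OF b that] by (simp add: supp_on_def)
  show "k \<in> \<int>" if F: "supp_on D F" "F \<noteq> (\<lambda>_. 0)" "(\<lambda>x. a F x + b F x) = (\<lambda>x. k * F x)" for F k
  proof -
    have "a (\<lambda>x. a F x + b F x) = (\<lambda>x. a (a F) x + b (a F) x)" for F
      by (simp add: a.op_add comm)
    then obtain G \<alpha> where G: "supp_on D G" "G \<noteq> (\<lambda>_. 0)" "(\<lambda>x. a G x + b G x) = (\<lambda>x. k * G x)"
        "a G = (\<lambda>x. \<alpha> * G x)"
      using common_eigenvector[OF integral_opD(1,2)[OF a] lin fin _ F] by blast
    then have "b G = (\<lambda>x. (k - \<alpha>) * G x)" by (simp add: fun_eq_iff algebra_simps)
    then have "k - \<alpha> \<in> \<int>" "\<alpha> \<in> \<int>" using integral_opD(3)[OF b G(1,2)] integral_opD(3)[OF a G(1,2,4)] by blast+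
    then show ?thesis by (metis Ints_add diff_add_cancel)
  qed
qed

lemma integral_op_diff:
  assumes fin: "finite D" and a: "integral_op D a" and b: "integral_op D b"
    and comm: "\<And>F. a (b F) = b (a F)"
  shows "integral_op D (\<lambda>F x. a F x - b F x)"
proof -
  interpret a: linear_op a by (rule integral_opD(1)[OF a])
  interpret b: linear_op b by (rule integral_opD(1)[OF b])
  have neg: "integral_op D (\<lambda>F x. - 1 * b F x)"
  proof (rule integral_opI)
    show "linear_op (\<lambda>F x. - 1 * b F x)"
      by unfold_locales (simp_all add: b.op_add b.op_scale fun_eq_iff)
    show "supp_on D (\<lambda>x. - 1 * b F x)" if "supp_on D F" for F
      using integral_opD(2)[OF b that] by (simp add: supp_on_def)
    show "k \<in> \<int>" if F: "supp_on D F" "F \<noteq> (\<lambda>_. 0)" "(\<lambda>x. - 1 * b F x) = (\<lambda>x. k * F x)" for F k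
    proof -
      have "b F = (\<lambda>x. - k * F x)"
      proof
        fix x
        have "- b F x = k * F x" using fun_cong[OF F(3), of x] by simp
        then show "b F x = - k * F x" by (metis minus_minus minus_mult_left)
      qed
      then have "- k \<in> \<int>" using integral_opD(3)[OF b F(1,2)] by blast
      then show ?thesis by simp
    qed
  qed
  have "integral_op D (\<lambda>F x. a F x + - 1 * b F x)"
    by (rule integral_op_add[OF fin a neg]) (simp only: a.op_scale comm)
  then show ?thesis by simp
qed

lemma linear_op_perm_op: "linear_op (perm_op T)"
  by unfold_locales (auto simp: perm_op_def fun_eq_iff sum.distrib sum_distrib_left)

lemma perm_op_supp:
  assumes T: "\<And>t. t \<in> T \<Longrightarrow> t permutes V" and F: "supp_on {g. g permutes V} F"
  shows "supp_on {g. g permutes V} (perm_op T F)"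
  unfolding supp_on_def
proof (intro allI impI)
  fix g assume g: "g \<notin> {g. g permutes V}"
  have "F (t \<circ> g) = 0" if "t \<in> T" for t
  proof -
    have "\<not> t \<circ> g permutes V"
    proof
      assume "t \<circ> g permutes V"
      then have "inv_into UNIV t \<circ> (t \<circ> g) permutes V"
        using permutes_compose permutes_inv T[OF that] by blast
      then show False using g permutes_inj[OF T[OF that]] by (simp add: o_assoc)
    qed
    then show ?thesis using F by (simp add: supp_on_def)
  qed
  then show "perm_op T F g = 0" by (simp add: perm_op_def)
qed

text \<open>Conjugation by an element of \<open>T\<close> permutes \<open>U\<close>, so reindexing
  the inner sum moves it past \<open>U\<close>.\<close>

lemma perm_op_commute:
  assumes conj: "\<And>t. t \<in> T \<Longrightarrow> \<exists>h. bij_betw h U U \<and> (\<forall>u\<in>U. t \<circ> u = h u \<circ> t)"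
  shows "perm_op T (perm_op U F) = perm_op U (perm_op T F)"
proof
  fix g
  have "(\<Sum>u\<in>U. F (u \<circ> (t \<circ> g))) = (\<Sum>u\<in>U. F (t \<circ> (u \<circ> g)))" if "t \<in> T" for t
  proof -
    obtain h where h: "bij_betw h U U" "\<And>u. u \<in> U \<Longrightarrow> t \<circ> u = h u \<circ> t" using conj[OF \<open>t \<in> T\<close>] by blast
    have "(\<Sum>u\<in>U. F (u \<circ> (t \<circ> g))) = (\<Sum>u\<in>U. F (h u \<circ> (t \<circ> g)))"
      by (rule sum.reindex_bij_betw[OF h(1), symmetric])
    also have "\<dots> = (\<Sum>u\<in>U. F (t \<circ> (u \<circ> g)))"
      using h(2) by (intro sum.cong refl) (metis o_assoc)
    finally show ?thesis .
  qed
  then have "(\<Sum>t\<in>T. \<Sum>u\<in>U. F (u \<circ> (t \<circ> g))) = (\<Sum>t\<in>T. \<Sum>u\<in>U. F (t \<circ> (u \<circ> g)))" by simp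
  also have "\<dots> = (\<Sum>u\<in>U. \<Sum>t\<in>T. F (t \<circ> (u \<circ> g)))" by (rule sum.swap)
  finally show "perm_op T (perm_op U F) g = perm_op U (perm_op T F) g" by (simp add: perm_op_def)
qed

lemma inj_comp_transpose:
  assumes "inj t"
  shows "t \<circ> transpose i j = transpose (t i) (t j) \<circ> t"
  using assms by (auto simp: fun_eq_iff transpose_def inj_eq)

section \<open>Jucys-Murphy elements and sums over all transpositions of a set\<close>

definition star :: "nat set \<Rightarrow> nat \<Rightarrow> (nat \<Rightarrow> nat) set" where
  "star S q = (\<lambda>i. transpose i q) ` S"

definition transps_on :: "nat set \<Rightarrow> (nat \<Rightarrow> nat) set" where
  "transps_on S = {transpose i j | i j. i \<in> S \<and> j \<in> S \<and> i \<noteq> j}"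

lemma inj_on_star: "q \<notin> S \<Longrightarrow> inj_on (\<lambda>i. transpose i q) S"
proof (rule inj_onI)
  fix i j assume "q \<notin> S" "i \<in> S" "j \<in> S" "transpose i q = transpose j q"
  then have "transpose i q q = transpose j q q" by simp
  then show "i = j" by simp
qed

lemma conj_star:
  assumes "t permutes S" "q \<notin> S"
  shows "\<exists>h. bij_betw h (star S q) (star S q) \<and> (\<forall>u\<in>star S q. t \<circ> u = h u \<circ> t)"
proof -
  have inj: "inj t" by (rule permutes_inj[OF assms(1)])
  have tq: "t q = q" using permutes_not_in[OF assms] .
  define h where "h = (\<lambda>u. t \<circ> u \<circ> inv_into UNIV t)"
  have h: "h (transpose i q) = transpose (t i) q" for i
    unfolding h_def inj_comp_transpose[OF inj] tq
    by (simp add: o_assoc[symmetric] surj_iff[THEN iffD1, OF permutes_surj[OF assms(1)]])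
  have "h ` star S q = (\<lambda>i. transpose (t i) q) ` S"
    unfolding star_def image_image h ..
  also have "\<dots> = (\<lambda>i. transpose i q) ` (t ` S)" by (simp add: image_image)
  finally have "h ` star S q = star S q" by (simp add: star_def permutes_image[OF assms(1)])
  moreover have "inj_on h (star S q)"
  proof (rule inj_onI)
    fix u v assume "h u = h v"
    then have "inv_into UNIV t \<circ> (t \<circ> u \<circ> inv_into UNIV t) \<circ> t = inv_into UNIV t \<circ> (t \<circ> v \<circ> inv_into UNIV t) \<circ> t" by (simp add: h_def)
    then show "u = v" using inj by (simp add: fun_eq_iff)
  qed
  moreover have "t \<circ> u = h u \<circ> t" if "u \<in> star S q" for u
    using inj by (simp add: h_def fun_eq_iff)
  ultimately show ?thesis unfolding bij_betw_def by blast
qed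

lemma conj_transps_on:
  assumes "t permutes V" "t ` S = S"
  shows "\<exists>h. bij_betw h (transps_on S) (transps_on S) \<and> (\<forall>u\<in>transps_on S. t \<circ> u = h u \<circ> t)"
proof -
  have inj: "inj t" by (rule permutes_inj[OF assms(1)])
  have surj: "t \<circ> inv_into UNIV t = id" using permutes_surj[OF assms(1)] by (simp add: surj_iff)
  define h where "h = (\<lambda>u. t \<circ> u \<circ> inv_into UNIV t)"
  have h: "h (transpose i j) = transpose (t i) (t j)" for i j
    unfolding h_def inj_comp_transpose[OF inj] by (simp add: o_assoc[symmetric] surj)
  have "h ` transps_on S = transps_on S"
  proof
    show "h ` transps_on S \<subseteq> transps_on S"
    proof
      fix u assume "u \<in> h ` transps_on S"
      then obtain i j where ij: "i \<in> S" "j \<in> S" "i \<noteq> j" "u = transpose (t i) (t j)"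
        by (auto simp: transps_on_def h)
      then have "t i \<in> S" "t j \<in> S" "t i \<noteq> t j" using assms(2) inj by (auto simp: inj_eq)
      then show "u \<in> transps_on S" using ij(4) unfolding transps_on_def by blast
    qed
    show "transps_on S \<subseteq> h ` transps_on S"
    proof
      fix u assume "u \<in> transps_on S"
      then obtain i j where ij: "i \<in> S" "j \<in> S" "i \<noteq> j" "u = transpose i j" by (auto simp: transps_on_def)
      then have "i \<in> t ` S" "j \<in> t ` S" using assms(2) by simp_all
      then obtain a b where ab: "a \<in> S" "b \<in> S" "i = t a" "j = t b" by blast
      then have "u = h (transpose a b)" "a \<noteq> b" using ij h by auto
      then show "u \<in> h ` transps_on S" using ab unfolding transps_on_def by blast
    qed
  qed
  moreover have "inj_on h (transps_on S)"
  proof (rule inj_onI)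
    fix u v assume "h u = h v"
    then have "inv_into UNIV t \<circ> (t \<circ> u \<circ> inv_into UNIV t) \<circ> t = inv_into UNIV t \<circ> (t \<circ> v \<circ> inv_into UNIV t) \<circ> t" by (simp add: h_def)
    then show "u = v" using inj by (simp add: fun_eq_iff)
  qed
  moreover have "t \<circ> u = h u \<circ> t" for u
    using inj by (simp add: h_def fun_eq_iff)
  ultimately show ?thesis unfolding bij_betw_def by blast
qed

lemma finite_star: "finite S \<Longrightarrow> finite (star S q)"
  by (simp add: star_def)

lemma finite_transps_on: "finite S \<Longrightarrow> finite (transps_on S)"
proof -
  assume "finite S"
  moreover have "transps_on S \<subseteq> (\<lambda>(i, j). transpose i j) ` (S \<times> S)" by (auto simp: transps_on_def)
  ultimately show ?thesis by (meson finite_SigmaI finite_imageI finite_subset)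
qed

text \<open>
  The sum over \<^term>\<open>star S q\<close> is a Jucys-Murphy element. If \<open>a\<close> and \<open>B\<close> are two consecutive ones and
  \<open>s\<close> is the transposition of their base points, then \<open>a s = s B - 1\<close>. So for a common eigenvector \<open>F\<close> with
  eigenvalues \<open>\<alpha>\<close> and \<open>\<beta>\<close> the vector \<open>(\<alpha> - \<beta>) s F + F\<close> is zero, which forces \<open>(\<alpha> - \<beta>)\<^sup>2 = 1\<close>, or an eigenvector
  of \<open>a\<close> for \<open>\<beta>\<close>.
\<close>

lemma integral_op_star:
  assumes "finite S" "finite V" "S \<subseteq> V" "q \<in> V" "q \<notin> S"
  shows "integral_op {g. g permutes V} (perm_op (star S q))"
  using assms(1,3-5)
proof (induction S arbitrary: q rule: finite_induct)
  case empty
  have "k \<in> \<int>" if nz: "F \<noteq> (\<lambda>_. 0)" and eq: "(\<lambda>_. 0) = (\<lambda>x. k * F x)" for F :: "(nat \<Rightarrow> nat) \<Rightarrow> complex" and k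
  proof -
    obtain x where "F x \<noteq> 0" using nz by auto
    then have "k = 0" using fun_cong[OF eq, of x] by simp
    then show ?thesis by simp
  qed
  then show ?case
    by (intro integral_opI linear_op_perm_op) (auto simp: perm_op_def star_def supp_on_def)
next
  case (insert r S)
  let ?D = "{g. g permutes V}"
  let ?a = "perm_op (star S r)" and ?B = "perm_op (star (insert r S) q)"
  define s where "s = (\<lambda>F :: (nat \<Rightarrow> nat) \<Rightarrow> complex. \<lambda>g. F (transpose r q \<circ> g))"
  have V: "r \<in> V" "q \<in> V" "S \<subseteq> V" "q \<noteq> r" "q \<notin> S" using insert.prems by auto
  have star_perm: "t permutes V" if "t \<in> star S' x" "S' \<subseteq> V" "x \<in> V" for t S' x
    using that by (auto simp: star_def intro!: permutes_swap_id)
  have a: "integral_op ?D ?a" by (rule insert.IH) (use V insert.hyps in auto)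
  have fin: "finite ?D" using finite_permutations[OF assms(2)] .
  have suppB: "supp_on ?D (?B F)" if "supp_on ?D F" for F
    by (rule perm_op_supp[OF _ that]) (use star_perm[of _ "insert r S" q] V in auto)
  have comm: "?a (?B F) = ?B (?a F)" for F
  proof (rule perm_op_commute)
    fix t assume "t \<in> star S r"
    then have "t permutes insert r S" by (auto simp: star_def intro!: permutes_swap_id)
    then show "\<exists>h. bij_betw h (star (insert r S) q) (star (insert r S) q) \<and> (\<forall>u\<in>star (insert r S) q. t \<circ> u = h u \<circ> t)"
      by (rule conj_star) (use V in auto)
  qed
  have ss: "s (s F) = F" for F
    by (simp add: s_def fun_eq_iff flip: o_assoc) (simp add: o_assoc)
  have s_scale: "s (\<lambda>x. c * F x) = (\<lambda>x. c * s F x)" for c F by (simp add: s_def)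
  have as: "?a (s F) g = s (?B F) g - F g" for F g
  proof -
    have "s (?B F) g = (\<Sum>i\<in>insert r S. F (transpose i q \<circ> (transpose r q \<circ> g)))"
      unfolding s_def perm_op_def star_def
      using sum.reindex[OF inj_on_star[of q "insert r S"], of "\<lambda>t. F (t \<circ> (transpose r q \<circ> g))"] V
      by (simp add: o_def)
    also have "\<dots> = F (transpose r q \<circ> (transpose r q \<circ> g)) + (\<Sum>i\<in>S. F (transpose i q \<circ> (transpose r q \<circ> g)))"
      using insert.hyps by simp
    also have "F (transpose r q \<circ> (transpose r q \<circ> g)) = F g" by (simp add: o_assoc)
    also have "(\<Sum>i\<in>S. F (transpose i q \<circ> (transpose r q \<circ> g))) = (\<Sum>i\<in>S. F (transpose r q \<circ> (transpose i r \<circ> g)))"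
    proof (rule sum.cong[OF refl])
      fix i assume i: "i \<in> S"
      then have "i \<noteq> q" "i \<noteq> r" using V insert.hyps by auto
      then have "transpose i q \<circ> transpose r q = transpose r q \<circ> transpose i r"
        using \<open>q \<noteq> r\<close> by (auto simp: fun_eq_iff transpose_def)
      then show "F (transpose i q \<circ> (transpose r q \<circ> g)) = F (transpose r q \<circ> (transpose i r \<circ> g))"
        by (simp add: o_assoc)
    qed
    also have "\<dots> = ?a (s F) g"
      unfolding s_def perm_op_def star_def
      using sum.reindex[OF inj_on_star[of r S], of "\<lambda>t. F (transpose r q \<circ> (t \<circ> g))"] insert.hyps
      by (simp add: o_def)
    finally show ?thesis by simp
  qed
  interpret a: linear_op ?a by (rule linear_op_perm_op)
  show ?case
  proof (rule integral_opI)
    show "k \<in> \<int>" if F0: "supp_on ?D F" "F \<noteq> (\<lambda>_. 0)" "?B F = (\<lambda>x. k * F x)" for F k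
    proof -
      obtain F \<alpha> where F: "supp_on ?D F" "F \<noteq> (\<lambda>_. 0)" "?B F = (\<lambda>x. k * F x)" "?a F = (\<lambda>x. \<alpha> * F x)"
        using common_eigenvector[OF integral_opD(1,2)[OF a] linear_op_perm_op fin comm F0] by blast
      have \<alpha>: "\<alpha> \<in> \<int>" using integral_opD(3)[OF a F(1,2,4)] .
      define G where "G = (\<lambda>x. (\<alpha> - k) * s F x + F x)"
      have "?a G = (\<lambda>x. k * G x)"
      proof
        fix x
        have "?a G x = (\<alpha> - k) * ?a (s F) x + ?a F x"
          unfolding G_def a.op_add a.op_scale ..
        also have "\<dots> = (\<alpha> - k) * (k * s F x - F x) + \<alpha> * F x"
          unfolding as F(3,4) s_scale ..
        also have "\<dots> = k * G x" by (simp add: G_def algebra_simps)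
        finally show "?a G x = k * G x" .
      qed
      moreover have "supp_on ?D G"
      proof -
        have "s F = perm_op {transpose r q} F" by (simp add: s_def perm_op_def fun_eq_iff)
        moreover have "supp_on ?D (perm_op {transpose r q} F)"
          by (rule perm_op_supp[OF _ F(1)]) (use V in \<open>auto intro!: permutes_swap_id\<close>)
        ultimately show ?thesis using F(1) by (simp add: G_def supp_on_def)
      qed
      ultimately have "G \<noteq> (\<lambda>_. 0) \<Longrightarrow> k \<in> \<int>" using integral_opD(3)[OF a] by blast
      moreover have "k \<in> \<int>" if "G = (\<lambda>_. 0)"
      proof -
        have Feq: "F = (\<lambda>x. (k - \<alpha>) * s F x)"
        proof
          fix x show "F x = (k - \<alpha>) * s F x" using fun_cong[OF that, of x] by (simp add: G_def algebra_simps)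
        qed
        have "s F = (\<lambda>x. (k - \<alpha>) * F x)" using arg_cong[OF Feq, of s] unfolding s_scale ss .
        then have sq: "F x = (k - \<alpha>)\<^sup>2 * F x" for x
          using fun_cong[OF Feq, of x] by (simp add: power2_eq_square)
        obtain x where "F x \<noteq> 0" using F(2) by auto
        then have "(k - \<alpha>)\<^sup>2 = 1" using sq[of x] by simp
        then have "k - \<alpha> = 1 \<or> k - \<alpha> = - 1" by (simp add: power2_eq_1_iff)
        then have "k - \<alpha> \<in> \<int>" by auto
        then show ?thesis using \<alpha> by (metis Ints_add diff_add_cancel)
      qed
      ultimately show ?thesis by blast
    qed
  qed (use suppB linear_op_perm_op in auto)
qed

text \<open>Adding a point q to S adds precisely \<open>star S q\<close>, and conjugation by
  permutations of S preserves this star.\<close>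

lemma integral_op_transps_on:
  assumes "finite V" "S \<subseteq> V"
  shows "integral_op {g. g permutes V} (perm_op (transps_on S))"
proof -
  have "finite S" using assms finite_subset by blast
  then show ?thesis using assms(2)
  proof (induction S rule: finite_induct)
    case empty
    have "k \<in> \<int>" if nz: "F \<noteq> (\<lambda>_. 0)" and eq: "(\<lambda>_. 0) = (\<lambda>x. k * F x)" for F :: "(nat \<Rightarrow> nat) \<Rightarrow> complex" and k
    proof -
      obtain x where "F x \<noteq> 0" using nz by auto
      then have "k = 0" using fun_cong[OF eq, of x] by simp
      then show ?thesis by simp
    qed
    then show ?case
      by (intro integral_opI linear_op_perm_op) (auto simp: perm_op_def transps_on_def supp_on_def)
  next
    case (insert q S)
    have un: "transps_on (insert q S) = transps_on S \<union> star S q"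
    proof
      show "transps_on (insert q S) \<subseteq> transps_on S \<union> star S q"
      proof
        fix u assume "u \<in> transps_on (insert q S)"
        then obtain i j where u: "u = transpose i j" "i \<in> insert q S" "j \<in> insert q S" "i \<noteq> j"
          unfolding transps_on_def by blast
        then consider "i \<in> S" "j \<in> S" | "i \<in> S" "j = q" | "i = q" "j \<in> S" by blast
        then show "u \<in> transps_on S \<union> star S q"
        proof cases
          case 3
          then have "u = transpose j q" unfolding u(1) using transpose_commute by metis
          then show ?thesis using 3 by (simp add: star_def)
        qed (use u in \<open>auto simp: transps_on_def star_def\<close>)
      qed
      show "transps_on S \<union> star S q \<subseteq> transps_on (insert q S)"
        using insert.hyps(2) unfolding transps_on_def star_def by blast
    qed
    have disj: "transps_on S \<inter> star S q = {}"
    proof -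
      have "u q = q" if "u \<in> transps_on S" for u
        using that insert.hyps(2) by (auto simp: transps_on_def transpose_def)
      moreover have "u q \<noteq> q" if "u \<in> star S q" for u
        using that insert.hyps(2) by (auto simp: star_def)
      ultimately show ?thesis by blast
    qed
    have eq: "perm_op (transps_on (insert q S)) = (\<lambda>F x. perm_op (transps_on S) F x + perm_op (star S q) F x)"
      unfolding perm_op_def un
      by (intro ext sum.union_disjoint[OF finite_transps_on[OF insert.hyps(1)] finite_star[OF insert.hyps(1)] disj])
    show ?case unfolding eq
    proof (rule integral_op_add)
      show "finite {g. g permutes V}" by (rule finite_permutations[OF assms(1)])
      show "integral_op {g. g permutes V} (perm_op (transps_on S))" by (rule insert.IH) (use insert.prems in auto)
      show "integral_op {g. g permutes V} (perm_op (star S q))"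
        by (rule integral_op_star[OF insert.hyps(1) assms(1)]) (use insert.prems insert.hyps in auto)
      show "perm_op (transps_on S) (perm_op (star S q) F) = perm_op (star S q) (perm_op (transps_on S) F)" for F
      proof (rule perm_op_commute)
        fix t assume "t \<in> transps_on S"
        then have "t permutes S" by (auto simp: transps_on_def intro!: permutes_swap_id)
        then show "\<exists>h. bij_betw h (star S q) (star S q) \<and> (\<forall>u\<in>star S q. t \<circ> u = h u \<circ> t)"
          by (rule conj_star[OF _ insert.hyps(2)])
      qed
    qed
  qed
qed

lemma integral_op_bipartite:
  assumes fin: "finite P" "finite Q" and disj: "P \<inter> Q = {}"
  shows "integral_op {g. g permutes P \<union> Q} (perm_op {transpose i j | i j. i \<in> P \<and> j \<in> Q})"
proof -
  let ?D = "{g. g permutes P \<union> Q}"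
  let ?T = "{transpose i j | i j. i \<in> P \<and> j \<in> Q}"
  have finD: "finite ?D" using finite_permutations fin by blast
  have perm: "t permutes S" if "t \<in> transps_on S" for t S
    using that by (auto simp: transps_on_def intro!: permutes_swap_id)
  have fix_disj: "u ` S' = S'" if "u \<in> transps_on S" "S \<inter> S' = {}" for u S S'
  proof -
    have "u x = x" if "x \<in> S'" for x
      using permutes_not_in[OF perm[OF \<open>u \<in> transps_on S\<close>], of x] that \<open>S \<inter> S' = {}\<close> by blast
    then show ?thesis by simp
  qed
  \<comment> \<open>An element t either moves no point of \<open>S'\<close> or permutes
    \<open>S'\<close>, so in both cases conjugation by t preserves the transpositions on
    \<open>S'\<close>.\<close>
  have comm: "perm_op (transps_on S) (perm_op (transps_on S') F) = perm_op (transps_on S') (perm_op (transps_on S) F)"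
    if "S \<inter> S' = {} \<or> S \<subseteq> S'" for S S' F
  proof (rule perm_op_commute)
    fix t assume t: "t \<in> transps_on S"
    have "t ` S' = S'"
    proof (cases "S \<subseteq> S'")
      case True
      then have "t permutes S'" using permutes_subset[OF perm[OF t]] by blast
      then show ?thesis by (rule permutes_image)
    qed (use that fix_disj[OF t] in blast)
    then show "\<exists>h. bij_betw h (transps_on S') (transps_on S') \<and> (\<forall>u\<in>transps_on S'. t \<circ> u = h u \<circ> t)"
      by (rule conj_transps_on[OF perm[OF t]])
  qed
  have un: "transps_on (P \<union> Q) = (transps_on P \<union> transps_on Q) \<union> ?T"
  proof
    show "transps_on (P \<union> Q) \<subseteq> (transps_on P \<union> transps_on Q) \<union> ?T"
    proof
      fix u assume "u \<in> transps_on (P \<union> Q)"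
      then obtain i j where u: "u = transpose i j" "i \<in> P \<union> Q" "j \<in> P \<union> Q" "i \<noteq> j"
        unfolding transps_on_def by blast
      then consider "i \<in> P \<and> j \<in> P \<or> i \<in> Q \<and> j \<in> Q" | "i \<in> P" "j \<in> Q" | "i \<in> Q" "j \<in> P" by blast
      then show "u \<in> (transps_on P \<union> transps_on Q) \<union> ?T"
      proof cases
        case 1
        then show ?thesis using u unfolding transps_on_def by blast
      next
        case 2
        then show ?thesis using u(1) by blast
      next
        case 3
        have "u = transpose j i" unfolding u(1) by (rule transpose_commute)
        then show ?thesis using 3 by blast
      qed
    qed
    show "(transps_on P \<union> transps_on Q) \<union> ?T \<subseteq> transps_on (P \<union> Q)"
      unfolding transps_on_def using disj by blast
  qed
  have d1: "transps_on P \<inter> transps_on Q = {}"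
  proof -
    have "u ` P = P \<and> (\<exists>x\<in>P. u x \<noteq> x)" if "u \<in> transps_on P" for u
      using that permutes_image[OF perm[OF that]] by (auto simp: transps_on_def intro!: bexI)
    moreover have "\<forall>x\<in>P. u x = x" if "u \<in> transps_on Q" for u
      using permutes_not_in[OF perm[OF that]] disj by blast
    ultimately show ?thesis by blast
  qed
  have d2: "(transps_on P \<union> transps_on Q) \<inter> ?T = {}"
  proof -
    have "u ` P = P" if "u \<in> transps_on P \<union> transps_on Q" for u
      using that permutes_image[OF perm] fix_disj[of u Q P] disj by blast
    moreover have "u ` P \<noteq> P" if u: "u \<in> ?T" for u
    proof -
      obtain i j where ij: "u = transpose i j" "i \<in> P" "j \<in> Q" using u by blast
      then have "u i = j" by simp
      then show ?thesis using ij disj by blast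
    qed
    ultimately show ?thesis by blast
  qed
  have finT: "finite ?T"
    by (rule finite_subset[OF _ finite_transps_on[of "P \<union> Q"]]) (use un fin in auto)
  have eq: "perm_op ?T = (\<lambda>F x. perm_op (transps_on (P \<union> Q)) F x - (perm_op (transps_on P) F x + perm_op (transps_on Q) F x))"
  proof (intro ext)
    fix F g
    have "perm_op (transps_on (P \<union> Q)) F g = (\<Sum>t\<in>transps_on P \<union> transps_on Q. F (t \<circ> g)) + perm_op ?T F g"
      unfolding perm_op_def un using fin by (intro sum.union_disjoint finT d2) (simp add: finite_transps_on)
    also have "(\<Sum>t\<in>transps_on P \<union> transps_on Q. F (t \<circ> g)) = perm_op (transps_on P) F g + perm_op (transps_on Q) F g"
      unfolding perm_op_def using fin by (intro sum.union_disjoint d1) (simp_all add: finite_transps_on)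
    finally show "perm_op ?T F g = perm_op (transps_on (P \<union> Q)) F g - (perm_op (transps_on P) F g + perm_op (transps_on Q) F g)"
      by simp
  qed
  interpret A: linear_op "perm_op (transps_on (P \<union> Q))" by (rule linear_op_perm_op)
  show ?thesis unfolding eq
  proof (rule integral_op_diff[OF finD])
    show "integral_op ?D (perm_op (transps_on (P \<union> Q)))"
      by (rule integral_op_transps_on) (use fin in auto)
    show "integral_op ?D (\<lambda>F x. perm_op (transps_on P) F x + perm_op (transps_on Q) F x)"
    proof (rule integral_op_add[OF finD])
      show "integral_op ?D (perm_op (transps_on P))" by (rule integral_op_transps_on) (use fin in auto)
      show "integral_op ?D (perm_op (transps_on Q))" by (rule integral_op_transps_on) (use fin in auto)
      show "perm_op (transps_on P) (perm_op (transps_on Q) F) = perm_op (transps_on Q) (perm_op (transps_on P) F)" for F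
        by (rule comm[OF disjI1[OF disj]])
    qed
    show "perm_op (transps_on (P \<union> Q)) (\<lambda>x. perm_op (transps_on P) F x + perm_op (transps_on Q) F x) =
      (\<lambda>x. perm_op (transps_on P) (perm_op (transps_on (P \<union> Q)) F) x + perm_op (transps_on Q) (perm_op (transps_on (P \<union> Q)) F) x)" for F
      unfolding A.op_add comm[of P "P \<union> Q", OF disjI2[OF Un_upper1]] comm[of Q "P \<union> Q", OF disjI2[OF Un_upper2]] ..
  qed
qed

section \<open>Transposition graphs and their Cayley graphs\<close>

definition tnbs :: "nat \<Rightarrow> (nat \<Rightarrow> nat) set \<Rightarrow> nat \<Rightarrow> nat set" where
  "tnbs n T x = {y \<in> {1..n}. y \<noteq> x \<and> transpose x y \<in> T}"

lemma transpositionsE: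
  assumes "T \<subseteq> transpositions n" "t \<in> T"
  obtains i j where "t = transpose i j" "i \<in> {1..n}" "j \<in> {1..n}" "i \<noteq> j"
  using assms unfolding transpositions_def by blast

lemma transposition_permutes:
  "T \<subseteq> transpositions n \<Longrightarrow> t \<in> T \<Longrightarrow> t permutes {1..n}"
  by (erule (1) transpositionsE) (auto intro!: permutes_swap_id)

lemma finite_transposition_set: "T \<subseteq> transpositions n \<Longrightarrow> finite T"
proof -
  assume T: "T \<subseteq> transpositions n"
  have "T \<subseteq> {p. p permutes {1..n}}" using transposition_permutes[OF T] by blast
  then show ?thesis using finite_permutations[of "{1..n}"] finite_subset by blast
qed

lemma transposition_moves:
  assumes T: "T \<subseteq> transpositions n" and t: "t \<in> T" "t x \<noteq> x"
  shows "t = transpose x (t x)" "t x \<in> tnbs n T x" "x \<in> {1..n}"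
proof -
  obtain i j where ij: "t = transpose i j" "i \<in> {1..n}" "j \<in> {1..n}" "i \<noteq> j"
    by (rule transpositionsE[OF T t(1)])
  then have "x = i \<or> x = j" using t(2) by (auto simp: transpose_def split: if_splits)
  then show e: "t = transpose x (t x)" using ij(1) by (auto simp: transpose_commute)
  show "x \<in> {1..n}" using \<open>x = i \<or> x = j\<close> ij by blast
  have "t x \<in> {1..n}" using \<open>x = i \<or> x = j\<close> ij by auto
  moreover have "transpose x (t x) \<in> T" unfolding e[symmetric] by (rule t(1))
  ultimately show "t x \<in> tnbs n T x" using t(2) by (simp add: tnbs_def)
qed

text \<open>A transposition that moves x is determined by the image of x, which runs through the
  neighbours of x.\<close>

lemma sum_moves:
  fixes f :: "nat \<Rightarrow> complex"
  assumes T: "T \<subseteq> transpositions n"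
  shows "(\<Sum>t\<in>{t \<in> T. t x \<noteq> x \<and> t x \<noteq> y}. f (t x)) = (\<Sum>k\<in>tnbs n T x - {y}. f k)"
proof (rule sum.reindex_bij_witness[of _ "\<lambda>k. transpose x k" "\<lambda>t. t x"])
  fix t assume "t \<in> {t \<in> T. t x \<noteq> x \<and> t x \<noteq> y}"
  then have t: "t \<in> T" "t x \<noteq> x" "t x \<noteq> y" by simp_all
  show "transpose x (t x) = t" by (rule transposition_moves(1)[OF T t(1,2), symmetric])
  show "t x \<in> tnbs n T x - {y}" using transposition_moves(2)[OF T t(1,2)] t(3) by simp
next
  fix k assume "k \<in> tnbs n T x - {y}"
  then show "transpose x k \<in> {t \<in> T. t x \<noteq> x \<and> t x \<noteq> y}" "transpose x k x = k"
    by (auto simp: tnbs_def)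
qed simp

text \<open>The elements of \<open>T\<close> are involutions, so the quotient of g and h equals t
  exactly if h is t composed with g.\<close>

lemma parcs_Cay:
  assumes T: "T \<subseteq> transpositions n"
  shows "(g, h) \<in> parcs (Cay (sym_group n) T) \<longleftrightarrow> g permutes {1..n} \<and> (\<exists>t\<in>T. h = t \<circ> g)"
proof -
  have inv: "t \<circ> t = id" if t: "t \<in> T" for t
    by (rule transpositionsE[OF T t]) simp
  have "g \<circ> inv_into UNIV h \<in> T \<longleftrightarrow> (\<exists>t\<in>T. h = t \<circ> g)" if "g permutes {1..n}" "h permutes {1..n}"
  proof
    have gg: "inv_into UNIV g \<circ> g = id" "g \<circ> inv_into UNIV g = id" "inv_into UNIV h \<circ> h = id"
      using that permutes_inv_o by blast+
    {
      assume gh: "g \<circ> inv_into UNIV h \<in> T"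
      have "(g \<circ> inv_into UNIV h) \<circ> h = g" by (simp add: o_assoc[symmetric] gg)
      then have "(g \<circ> inv_into UNIV h) \<circ> ((g \<circ> inv_into UNIV h) \<circ> h) = (g \<circ> inv_into UNIV h) \<circ> g" by simp
      then have "h = (g \<circ> inv_into UNIV h) \<circ> g" unfolding o_assoc[of _ _ h] inv[OF gh] by simp
      then show "\<exists>t\<in>T. h = t \<circ> g" using gh by blast
    next
      assume "\<exists>t\<in>T. h = t \<circ> g"
      then obtain t where t: "t \<in> T" "h = t \<circ> g" by blast
      have "g = t \<circ> h" unfolding t(2) o_assoc inv[OF t(1)] by simp
      then have "g \<circ> inv_into UNIV h = t"
        using permutes_inv_o(1)[OF that(2)] by (metis o_assoc comp_id)
      then show "g \<circ> inv_into UNIV h \<in> T" using t(1) by simp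
    }
  qed
  moreover have "t \<circ> g permutes {1..n}" if "t \<in> T" "g permutes {1..n}" for t
    using permutes_compose[OF that(2) transposition_permutes[OF T that(1)]] .
  ultimately show ?thesis
    unfolding Cay_def by (auto simp: sym_group_carrier sym_group_mult)
qed

lemma adjacency_mat_Cay:
  fixes v :: "complex vec"
  assumes T: "T \<subseteq> transpositions n" and vs: "distinct vs" "set vs = {g. g permutes {1..n}}"
    and F: "\<And>i. i < length vs \<Longrightarrow> F (vs ! i) = v $ i" and v: "v \<in> carrier_vec (length vs)"
    and i: "i < length vs"
  shows "(adjacency_mat (Cay (sym_group n) T) vs *\<^sub>v v) $ i = perm_op T F (vs ! i)"
proof -
  let ?g = "vs ! i"
  have g: "?g permutes {1..n}" using vs(2) i nth_mem by blast
  have "(adjacency_mat (Cay (sym_group n) T) vs *\<^sub>v v) $ i =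
      (\<Sum>j<length vs. (if \<exists>t\<in>T. vs ! j = t \<circ> ?g then F (vs ! j) else 0))"
    using i v g by (auto simp: adjacency_mat_def scalar_prod_def parcs_Cay[OF T] F atLeast0LessThan intro!: sum.cong)
  also have "\<dots> = (\<Sum>h\<in>(\<lambda>j. vs ! j) ` {..<length vs}. if \<exists>t\<in>T. h = t \<circ> ?g then F h else 0)"
    using vs(1) by (subst sum.reindex) (auto simp: inj_on_def nth_eq_iff_index_eq)
  also have "(\<lambda>j. vs ! j) ` {..<length vs} = set vs" by (auto simp: in_set_conv_nth)
  also have "(\<Sum>h\<in>set vs. if \<exists>t\<in>T. h = t \<circ> ?g then F h else 0) = (\<Sum>h\<in>(\<lambda>t. t \<circ> ?g) ` T. F h)"
  proof (rule sum.mono_neutral_cong_right)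
    show "(\<lambda>t. t \<circ> ?g) ` T \<subseteq> set vs"
      unfolding vs(2) using permutes_compose[OF g] transposition_permutes[OF T] by blast
  qed auto
  also have "\<dots> = perm_op T F ?g"
  proof -
    have "inj_on (\<lambda>t. t \<circ> ?g) T"
    proof (rule inj_onI)
      fix s t assume "s \<circ> ?g = t \<circ> ?g"
      then have "s \<circ> ?g \<circ> inv_into UNIV ?g = t \<circ> ?g \<circ> inv_into UNIV ?g" by simp
      then show "s = t" by (simp add: o_assoc[symmetric] permutes_inv_o(1)[OF g])
    qed
    then show ?thesis by (simp add: sum.reindex perm_op_def)
  qed
  finally show ?thesis .
qed

text \<open>Vectors along an enumeration correspond to functions supported on the permutations,
  which makes the enumeration disappear.\<close>

lemma integral_Cay_iff:
  assumes T: "T \<subseteq> transpositions n"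
  shows "integral_graph (Cay (sym_group n) T) \<longleftrightarrow>
    (\<forall>F k. supp_on {g. g permutes {1..n}} F \<longrightarrow> F \<noteq> (\<lambda>_. 0) \<longrightarrow> perm_op T F = (\<lambda>g. k * F g) \<longrightarrow> k \<in> \<int>)"
    (is "?L \<longleftrightarrow> ?R")
proof -
  let ?D = "{g. g permutes {1..n}}"
  have pv: "pverts (Cay (sym_group n) T) = ?D" by (auto simp: Cay_def sym_group_def)
  have dim: "dim_row (adjacency_mat G vs) = length vs" for G :: "(nat \<Rightarrow> nat) pair_pre_digraph" and vs
    by (simp add: adjacency_mat_def)
  show ?thesis
  proof
    assume L: ?L
    show ?R
    proof (intro allI impI)
      fix F k
      assume F: "supp_on ?D F" "F \<noteq> (\<lambda>_. 0)" "perm_op T F = (\<lambda>g. k * F g)"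
      obtain vs where vs: "distinct vs" "set vs = ?D"
        using finite_distinct_list[OF finite_permutations[of "{1..n}"]] by auto
      define v where "v = vec (length vs) (\<lambda>i. F (vs ! i))"
      have v: "v \<in> carrier_vec (length vs)" "\<And>i. i < length vs \<Longrightarrow> F (vs ! i) = v $ i" by (simp_all add: v_def)
      have "adjacency_mat (Cay (sym_group n) T) vs *\<^sub>v v = k \<cdot>\<^sub>v v"
      proof (rule eq_vecI)
        fix i assume "i < dim_vec (k \<cdot>\<^sub>v v)"
        then have i: "i < length vs" using v(1) by simp
        show "(adjacency_mat (Cay (sym_group n) T) vs *\<^sub>v v) $ i = (k \<cdot>\<^sub>v v) $ i"
          using adjacency_mat_Cay[OF T vs v(2,1) i] i v F(3) by simp
      qed (simp add: v_def dim)
      moreover have "v \<noteq> 0\<^sub>v (length vs)"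
      proof
        assume 0: "v = 0\<^sub>v (length vs)"
        have "F g = 0" for g
        proof (cases "g \<in> ?D")
          case True
          then obtain i where "i < length vs" "g = vs ! i" using vs(2) by (metis in_set_conv_nth)
          then show ?thesis using v(2)[of i] 0 by simp
        qed (use F(1) in \<open>simp add: supp_on_def\<close>)
        then show False using F(2) by auto
      qed
      ultimately have "eigenvalue (adjacency_mat (Cay (sym_group n) T) vs) k"
        unfolding eigenvalue_def eigenvector_def dim using v(1) by blast
      then show "k \<in> \<int>" using L vs unfolding integral_graph_def pv by blast
    qed
  next
    assume R: ?R
    show ?L unfolding integral_graph_def pv
    proof (intro conjI allI impI)
      show "pair_graph (Cay (sym_group n) T)" by (rule pair_graph_Cay_transpositions[OF T])
      fix vs k assume vs: "distinct vs \<and> set vs = ?D" and ev: "eigenvalue (adjacency_mat (Cay (sym_group n) T) vs) k"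
      obtain v where v: "v \<in> carrier_vec (length vs)" "v \<noteq> 0\<^sub>v (length vs)"
        "adjacency_mat (Cay (sym_group n) T) vs *\<^sub>v v = k \<cdot>\<^sub>v v"
        using ev unfolding eigenvalue_def eigenvector_def dim by blast
      define idx where "idx = the_inv_into {..<length vs} (\<lambda>i. vs ! i)"
      have inj: "inj_on (\<lambda>i. vs ! i) {..<length vs}" using vs by (simp add: inj_on_def nth_eq_iff_index_eq)
      define F where "F = (\<lambda>g. if g \<in> ?D then v $ idx g else 0)"
      have F: "F (vs ! i) = v $ i" if "i < length vs" for i
        using that vs nth_mem[OF that] the_inv_into_f_f[OF inj, of i] by (simp add: F_def idx_def)
      have supp: "supp_on ?D F" by (simp add: F_def supp_on_def)
      have "perm_op T F g = k * F g" for g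
      proof (cases "g \<in> ?D")
        case True
        then obtain i where i: "i < length vs" "g = vs ! i" using vs by (metis in_set_conv_nth)
        then show ?thesis
          using adjacency_mat_Cay[OF T _ _ F v(1) i(1)] vs v(1,3) F[OF i(1)] by simp
      next
        case False
        have "supp_on ?D (perm_op T F)" by (rule perm_op_supp[OF transposition_permutes[OF T] supp])
        then show ?thesis using False supp by (simp add: supp_on_def)
      qed
      moreover have "F \<noteq> (\<lambda>_. 0)"
      proof
        assume 0: "F = (\<lambda>_. 0)"
        have "v = 0\<^sub>v (length vs)"
        proof (rule eq_vecI)
          fix i assume "i < dim_vec (0\<^sub>v (length vs))"
          then show "v $ i = 0\<^sub>v (length vs) $ i" using F[of i] 0 by simp
        qed (use v(1) in simp)
        then show False using v(2) by simp
      qed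
      ultimately show "k \<in> \<int>" using R supp by blast
    qed
  qed
qed

text \<open>An arc of a pair digraph is the pair of its ends, so the arc map of an isomorphism is
  forced by its vertex map.\<close>

lemma digraph_iso_with_proj_iff:
  assumes G: "pair_wf_digraph G" and H: "parcs H \<subseteq> pverts H \<times> pverts H"
  shows "digraph_iso (with_proj G) (with_proj H) \<longleftrightarrow>
    (\<exists>\<phi>. bij_betw \<phi> (pverts G) (pverts H) \<and>
      (\<forall>u\<in>pverts G. \<forall>v\<in>pverts G. (u, v) \<in> parcs G \<longleftrightarrow> (\<phi> u, \<phi> v) \<in> parcs H))"
proof -
  interpret G: pair_wf_digraph G by (rule G)
  have arcs: "u \<in> pverts G \<and> v \<in> pverts G" if "(u, v) \<in> parcs G" for u v
    using G.in_arcsD1 G.in_arcsD2 that by blast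
  show ?thesis
  proof
    assume "digraph_iso (with_proj G) (with_proj H)"
    then obtain f where f: "pre_digraph.digraph_isomorphism (with_proj G) f" "with_proj H = app_iso f (with_proj G)"
      unfolding digraph_iso_def by blast
    define \<phi> where "\<phi> = iso_verts f"
    have V: "pverts H = \<phi> ` pverts G" using arg_cong[OF f(2), of verts] by (simp add: verts_app_iso \<phi>_def)
    have A: "parcs H = iso_arcs f ` parcs G" using arg_cong[OF f(2), of arcs] by (simp add: arcs_app_iso)
    have T: "fst = iso_tail f" "snd = iso_head f"
      using arg_cong[OF f(2), of tail] arg_cong[OF f(2), of head] by (simp_all add: tail_app_iso head_app_iso)
    have inj: "inj_on \<phi> (pverts G)"
      using f(1) unfolding pre_digraph.digraph_isomorphism_def by (simp add: \<phi>_def)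
    have im: "iso_arcs f (u, v) = (\<phi> u, \<phi> v)" if "(u, v) \<in> parcs G" for u v
    proof -
      have "\<phi> u = fst (iso_arcs f (u, v))" "\<phi> v = snd (iso_arcs f (u, v))"
        using f(1) that unfolding pre_digraph.digraph_isomorphism_def T \<phi>_def by auto
      then show ?thesis by (metis prod.collapse)
    qed
    have "(u, v) \<in> parcs G \<longleftrightarrow> (\<phi> u, \<phi> v) \<in> parcs H" if uv: "u \<in> pverts G" "v \<in> pverts G" for u v
    proof
      assume "(u, v) \<in> parcs G"
      then show "(\<phi> u, \<phi> v) \<in> parcs H" unfolding A using im by (metis imageI)
    next
      assume "(\<phi> u, \<phi> v) \<in> parcs H"
      then obtain a b where ab: "(a, b) \<in> parcs G" "(\<phi> u, \<phi> v) = iso_arcs f (a, b)" unfolding A by auto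
      then have "\<phi> u = \<phi> a" "\<phi> v = \<phi> b" using im[OF ab(1)] by simp_all
      then have "u = a" "v = b" using inj uv arcs[OF ab(1)] by (auto dest: inj_onD)
      then show "(u, v) \<in> parcs G" using ab(1) by simp
    qed
    then show "\<exists>\<phi>. bij_betw \<phi> (pverts G) (pverts H) \<and>
      (\<forall>u\<in>pverts G. \<forall>v\<in>pverts G. (u, v) \<in> parcs G \<longleftrightarrow> (\<phi> u, \<phi> v) \<in> parcs H)"
      using inj V unfolding bij_betw_def by blast
  next
    assume "\<exists>\<phi>. bij_betw \<phi> (pverts G) (pverts H) \<and>
      (\<forall>u\<in>pverts G. \<forall>v\<in>pverts G. (u, v) \<in> parcs G \<longleftrightarrow> (\<phi> u, \<phi> v) \<in> parcs H)"
    then obtain \<phi> where \<phi>: "bij_betw \<phi> (pverts G) (pverts H)"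
      "\<And>u v. u \<in> pverts G \<Longrightarrow> v \<in> pverts G \<Longrightarrow> (u, v) \<in> parcs G \<longleftrightarrow> (\<phi> u, \<phi> v) \<in> parcs H" by blast
    have inj: "inj_on \<phi> (pverts G)" and im: "\<phi> ` pverts G = pverts H" using \<phi>(1) by (simp_all add: bij_betw_def)
    define f where "f = \<lparr>iso_verts = \<phi>, iso_arcs = map_prod \<phi> \<phi>, iso_head = snd, iso_tail = (fst :: 'b \<times> 'b \<Rightarrow> 'b)\<rparr>"
    have "inj_on (map_prod \<phi> \<phi>) (parcs G)"
    proof (rule inj_onI)
      fix x y assume "x \<in> parcs G" "y \<in> parcs G" "map_prod \<phi> \<phi> x = map_prod \<phi> \<phi> y"
      then show "x = y" using inj arcs by (cases x; cases y) (auto dest: inj_onD)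
    qed
    then have "pre_digraph.digraph_isomorphism (with_proj G) f"
      unfolding pre_digraph.digraph_isomorphism_def using inj G.wf_digraph_axioms by (auto simp: f_def)
    moreover have "map_prod \<phi> \<phi> ` parcs G = parcs H"
    proof
      show "map_prod \<phi> \<phi> ` parcs G \<subseteq> parcs H" using \<phi>(2) arcs by auto
      show "parcs H \<subseteq> map_prod \<phi> \<phi> ` parcs G"
      proof
        fix x assume x: "x \<in> parcs H"
        obtain a b where ab: "x = (a, b)" by (cases x)
        then have "a \<in> \<phi> ` pverts G" "b \<in> \<phi> ` pverts G" using H x im by auto
        then obtain u v where uv: "u \<in> pverts G" "v \<in> pverts G" "a = \<phi> u" "b = \<phi> v" by blast
        then have "(u, v) \<in> parcs G" using \<phi>(2) x ab by simp
        then show "x \<in> map_prod \<phi> \<phi> ` parcs G" using ab uv by (force simp: map_prod_def)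
      qed
    qed
    then have "with_proj H = app_iso f (with_proj G)"
      by (intro pre_digraph.equality) (simp_all add: f_def app_iso_def im)
    ultimately show "digraph_iso (with_proj G) (with_proj H)" unfolding digraph_iso_def by blast
  qed
qed

(* The locale is interpreted at {1..n}, which One_nat_def would rewrite in goals but not in the facts used. *)
declare One_nat_def [simp del]

lemma parcs_transposition_graph:
  "(u, v) \<in> parcs (transposition_graph n T) \<longleftrightarrow> u \<in> {1..n} \<and> v \<in> tnbs n T u"
  by (auto simp: transposition_graph_def tnbs_def)

lemma cubic_graph_tnbs:
  assumes conn: "connected (with_proj (transposition_graph n T))"
    and cubic: "cubic (transposition_graph n T)"
  shows "cubic_graph {1..n} (tnbs n T)"
proof
  let ?G = "transposition_graph n T" and ?H = "with_proj (mk_symmetric (with_proj (transposition_graph n T)))"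
  have V: "pverts ?G = {1..n}" by (simp add: transposition_graph_def)
  show "finite {1..n}" by simp
  show "{1..n} \<noteq> {}" using conn V unfolding connected_def strongly_connected_def by simp
  show "tnbs n T v \<subseteq> {1..n}" for v by (auto simp: tnbs_def)
  show "card (tnbs n T v) = 3" if "v \<in> {1..n}" for v
  proof -
    have "card {e \<in> parcs ?G. fst e = v} = 3"
      using cubic that V unfolding cubic_def by (simp add: out_degree_def out_arcs_def)
    moreover have "{e \<in> parcs ?G. fst e = v} = Pair v ` tnbs n T v"
      using that by (auto simp: parcs_transposition_graph)
    moreover have "inj_on (Pair v) (tnbs n T v)" by (auto intro!: inj_onI)
    ultimately show ?thesis by (simp add: card_image)
  qed
  show "u \<in> tnbs n T v" if "u \<in> {1..n}" "v \<in> tnbs n T u" for u v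
    using that transpose_commute[of u v] by (auto simp: tnbs_def)
  show "v \<notin> tnbs n T v" for v by (simp add: tnbs_def)
  show "S = {1..n}" if S: "S \<subseteq> {1..n}" "S \<noteq> {}" and closed: "\<And>v. v \<in> S \<Longrightarrow> tnbs n T v \<subseteq> S" for S
  proof -
    obtain u where u: "u \<in> S" using S by blast
    have "v \<in> S" if v: "v \<in> {1..n}" for v
    proof -
      have "u \<rightarrow>\<^sup>*\<^bsub>?H\<^esub> v"
        using conn u v S(1) V unfolding connected_def strongly_connected_def by auto
      then show ?thesis unfolding reachable_def
      proof (induction rule: rtrancl_on_induct)
        case (step x y)
        \<comment> \<open>\<open>connected\<close> speaks of the symmetric closure, which adds no
          arcs here.\<close>
        then have "(x, y) \<in> parcs ?G \<or> (y, x) \<in> parcs ?G"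
          by (auto simp: parcs_mk_symmetric)
        then have "y \<in> tnbs n T x"
          by (auto simp: parcs_transposition_graph tnbs_def transpose_commute)
        then show ?case using closed[OF step.IH] by blast
      qed (rule u)
    qed
    then show ?thesis using S(1) by blast
  qed
qed

lemma sum_transpositions_one:
  fixes f :: "nat \<Rightarrow> complex"
  assumes T: "T \<subseteq> transpositions n"
  shows "(\<Sum>t\<in>T. f (t x) - f x) = (\<Sum>k\<in>tnbs n T x. f k - f x)"
proof -
  have "(\<Sum>t\<in>T. f (t x) - f x) = (\<Sum>t\<in>{t \<in> T. t x \<noteq> x \<and> t x \<noteq> x}. f (t x) - f x)"
    using finite_transposition_set[OF T] by (intro sum.mono_neutral_right) auto
  also have "\<dots> = (\<Sum>k\<in>tnbs n T x - {x}. f k - f x)" by (rule sum_moves[OF T])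
  also have "tnbs n T x - {x} = tnbs n T x" by (auto simp: tnbs_def)
  finally show ?thesis .
qed

text \<open>Apart from the transpositions that move exactly one of x and y, each fixes both or
  exchanges them, and the symmetric \<open>G\<close> does not notice the exchange.\<close>

lemma sum_transpositions_two:
  fixes G :: "nat \<Rightarrow> nat \<Rightarrow> complex"
  assumes T: "T \<subseteq> transpositions n" and sym: "\<And>i j. G i j = G j i" and xy: "x \<noteq> y"
  shows "(\<Sum>t\<in>T. G (t x) (t y) - G x y) =
    (\<Sum>k\<in>tnbs n T x - {y}. G k y - G x y) + (\<Sum>k\<in>tnbs n T y - {x}. G x k - G x y)"
proof -
  let ?A = "\<lambda>x y. {t \<in> T. t x \<noteq> x \<and> t x \<noteq> y}"
  have fin: "finite T" by (rule finite_transposition_set[OF T])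
  have fixed: "t z = z" if "t \<in> T" "t w \<noteq> w" "z \<noteq> w" "z \<noteq> t w" for t w z
    using fun_cong[OF transposition_moves(1)[OF T that(1,2)], of z] transpose_apply_other[of z w "t w"] that(3,4)
    by auto
  have disj: "?A x y \<inter> ?A y x = {}" using fixed[of _ x y] xy by auto
  have rest: "G (t x) (t y) - G x y = 0" if t: "t \<in> T - (?A x y \<union> ?A y x)" for t
  proof -
    have inj: "t x \<noteq> t y"
      using permutes_inj[OF transposition_permutes[OF T, of t]] t xy by (auto simp: inj_eq)
    have "(t x = x \<or> t x = y) \<and> (t y = y \<or> t y = x)" using t by blast
    then show ?thesis using inj sym[of x y] by auto
  qed
  have "(\<Sum>t\<in>T. G (t x) (t y) - G x y) = (\<Sum>t\<in>?A x y \<union> ?A y x. G (t x) (t y) - G x y)"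
    using fin rest by (intro sum.mono_neutral_right) auto
  also have "\<dots> = (\<Sum>t\<in>?A x y. G (t x) (t y) - G x y) + (\<Sum>t\<in>?A y x. G (t x) (t y) - G x y)"
    using fin disj by (intro sum.union_disjoint) auto
  also have "(\<Sum>t\<in>?A x y. G (t x) (t y) - G x y) = (\<Sum>t\<in>?A x y. G (t x) y - G x y)"
  proof (rule sum.cong[OF refl])
    fix t assume "t \<in> ?A x y"
    then have "t y = y" using fixed[of t x y] xy by auto
    then show "G (t x) (t y) - G x y = G (t x) y - G x y" by simp
  qed
  also have "\<dots> = (\<Sum>k\<in>tnbs n T x - {y}. G k y - G x y)" by (rule sum_moves[OF T])
  also have "(\<Sum>t\<in>?A y x. G (t x) (t y) - G x y) = (\<Sum>t\<in>?A y x. G x (t y) - G x y)"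
  proof (rule sum.cong[OF refl])
    fix t assume "t \<in> ?A y x"
    then have "t x = x" using fixed[of t y x] xy by auto
    then show "G (t x) (t y) - G x y = G x (t y) - G x y" by simp
  qed
  also have "\<dots> = (\<Sum>k\<in>tnbs n T y - {x}. G x k - G x y)" by (rule sum_moves[OF T])
  finally show ?thesis .
qed

text \<open>
  Functions of the images of one or two points lift to functions on the group. So the spectrum of the
  Cayley graph contains, up to an integral shift, those of the graph itself and of its two-token Laplacian.
\<close>

lemma integral_cubic_tnbs:
  assumes T: "T \<subseteq> transpositions n" and cg: "cubic_graph {1..n} (tnbs n T)"
    and int: "integral_graph (Cay (sym_group n) T)"
  shows "integral_cubic {1..n} (tnbs n T)"
proof -
  interpret cubic_graph "{1..n}" "tnbs n T" by (rule cg)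
  let ?D = "{g. g permutes {1..n}}"
  have n4: "4 \<le> n" using V_nonempty four_le_card_V by auto
  have R: "k \<in> \<int>" if "supp_on ?D F" "F \<noteq> (\<lambda>_. 0)" "perm_op T F = (\<lambda>g. k * F g)" for F k
    using int that unfolding integral_Cay_iff[OF T] by blast
  have suppT: "supp_on ?D (perm_op T F)" if "supp_on ?D F" for F
    by (rule perm_op_supp[OF transposition_permutes[OF T] that])
  show ?thesis
  proof
    fix f :: "nat \<Rightarrow> complex" and k
    assume f: "adj f = (\<lambda>v. k * f v)" "f \<noteq> (\<lambda>_. 0)"
    obtain x where x: "f x \<noteq> 0" using f(2) by auto
    show "k \<in> \<int>"
    proof (cases "x \<in> {1..n}")
      case False
      then have "k * f x = 0" using adj_supp[of x f] f(1) by simp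
      then show ?thesis using x by simp
    next
      case True
      define F where "F = (\<lambda>g. if g \<in> ?D then f (g 1) else 0)"
      have supp: "supp_on ?D F" by (simp add: F_def supp_on_def)
      \<comment> \<open>Three transpositions move g 1 and the others fix it, whence the shift by
        card T - 3.\<close>
      have "perm_op T F g = (of_nat (card T) + k - 3) * F g" for g
      proof (cases "g \<in> ?D")
        case True
        then have g1: "g 1 \<in> {1..n}" using n4 permutes_in_image[of g "{1..n}" 1] by simp
        have "t \<circ> g \<in> ?D" if "t \<in> T" for t
          using True permutes_compose transposition_permutes[OF T that] by blast
        then have "perm_op T F g = (\<Sum>t\<in>T. (f (t (g 1)) - f (g 1)) + f (g 1))"
          unfolding perm_op_def by (intro sum.cong refl) (simp add: F_def)
        also have "\<dots> = (\<Sum>t\<in>T. f (t (g 1)) - f (g 1)) + of_nat (card T) * f (g 1)"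
          by (simp only: sum.distrib sum_constant)
        also have "(\<Sum>t\<in>T. f (t (g 1)) - f (g 1)) = adj f (g 1) - 3 * f (g 1)"
          unfolding sum_transpositions_one[OF T] using g1 card_N[OF g1] by (simp add: adj_def sum_subtractf)
        finally show ?thesis using True f(1) by (simp add: F_def algebra_simps)
      next
        case False
        then show ?thesis using suppT[OF supp] supp by (simp add: supp_on_def)
      qed
      moreover have "F (transpose 1 x) \<noteq> 0"
        using x True n4 permutes_swap_id[of 1 "{1..n}" x] by (simp add: F_def)
      ultimately have "of_nat (card T) + k - 3 \<in> \<int>"
        using R[OF supp, of "of_nat (card T) + k - 3"] by auto
      moreover have "k = (of_nat (card T) + k - 3) - of_nat (card T) + 3" by simp
      ultimately show ?thesis by (metis Ints_add Ints_diff Ints_of_nat Ints_numeral)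
    qed
  next
    fix G :: "nat \<Rightarrow> nat \<Rightarrow> complex" and k
    assume sym: "\<And>i j. G i j = G j i" and L: "\<And>i j. L2 G i j = k * G i j" and nz: "G \<noteq> (\<lambda>_ _. 0)"
    obtain i j where ij: "G i j \<noteq> 0" using nz by (auto simp: fun_eq_iff)
    show "k \<in> \<int>"
    proof (cases "i \<in> {1..n} \<and> j \<in> {1..n} \<and> i \<noteq> j")
      case False
      then have "L2 G i j = 0" using L2_outside[of i j G] by blast
      then have "k = 0" using L[of i j] ij by simp
      then show ?thesis by simp
    next
      case True
      define F where "F = (\<lambda>g. if g \<in> ?D then G (g 1) (g 2) else 0)"
      have supp: "supp_on ?D F" by (simp add: F_def supp_on_def)
      have "perm_op T F g = (of_nat (card T) - k) * F g" for g
      proof (cases "g \<in> ?D")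
        case True
        then have g: "g 1 \<in> {1..n}" "g 2 \<in> {1..n}" "g 1 \<noteq> g 2"
          using n4 permutes_in_image[of g "{1..n}"] permutes_inj[of g "{1..n}"] by (simp_all add: inj_eq)
        have "t \<circ> g \<in> ?D" if "t \<in> T" for t
          using True permutes_compose transposition_permutes[OF T that] by blast
        then have "perm_op T F g = (\<Sum>t\<in>T. (G (t (g 1)) (t (g 2)) - G (g 1) (g 2)) + G (g 1) (g 2))"
          unfolding perm_op_def by (intro sum.cong refl) (simp add: F_def)
        also have "\<dots> = (\<Sum>t\<in>T. G (t (g 1)) (t (g 2)) - G (g 1) (g 2)) + of_nat (card T) * G (g 1) (g 2)"
          by (simp only: sum.distrib sum_constant)
        also have "(\<Sum>t\<in>T. G (t (g 1)) (t (g 2)) - G (g 1) (g 2)) = - L2 G (g 1) (g 2)"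
        proof -
          have "(\<Sum>t\<in>T. G (t (g 1)) (t (g 2)) - G (g 1) (g 2)) =
            (\<Sum>k\<in>tnbs n T (g 1) - {g 2}. G k (g 2) - G (g 1) (g 2)) +
            (\<Sum>k\<in>tnbs n T (g 2) - {g 1}. G (g 1) k - G (g 1) (g 2))"
            by (rule sum_transpositions_two[OF T _ g(3)]) (rule sym)
          then show ?thesis using g by (simp add: L2_def sum_subtractf)
        qed
        finally show ?thesis using True L by (simp add: F_def algebra_simps)
      next
        case False
        then show ?thesis using suppT[OF supp] supp by (simp add: supp_on_def)
      qed
      moreover have "\<exists>g. F g \<noteq> 0"
      proof -
        \<comment> \<open>A permutation with 1 sent to i and 2 sent to j: the factor applied first
          sends 2 to h j and fixes 1, because j differs from i, and h is its own inverse.\<close>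
        define h where "h = transpose 1 i"
        have h: "h permutes {1..n}" unfolding h_def using True n4 by (intro permutes_swap_id) auto
        have hj: "h j \<in> {1..n}" using True permutes_in_image[OF h] by blast
        have hj1: "h j \<noteq> 1" using True by (auto simp: h_def transpose_def)
        have hh: "h (h j) = j" by (simp add: h_def)
        define g where "g = h \<circ> transpose 2 (h j)"
        have "transpose 2 (h j) permutes {1..n}" using hj n4 by (intro permutes_swap_id) auto
        then have "g permutes {1..n}" unfolding g_def using h by (rule permutes_compose)
        moreover have "g 1 = i" using hj1 by (simp add: g_def h_def)
        moreover have "g 2 = j" using hh by (simp add: g_def)
        ultimately show ?thesis using ij by (intro exI[of _ g]) (simp add: F_def)
      qed
      ultimately have "of_nat (card T) - k \<in> \<int>"
        using R[OF supp, of "of_nat (card T) - k"] by auto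
      moreover have "k = of_nat (card T) - (of_nat (card T) - k)" by simp
      ultimately show ?thesis by (metis Ints_diff Ints_of_nat)
    qed
  qed
qed

lemma integral_Cay_of_integral_op:
  assumes "T \<subseteq> transpositions n" "integral_op {g. g permutes {1..n}} (perm_op T)"
  shows "integral_graph (Cay (sym_group n) T)"
  unfolding integral_Cay_iff[OF assms(1)] using integral_opD(3)[OF assms(2)] by blast

lemma transpositions_conv: "transpositions n = transps_on {1..n}"
  by (simp add: transpositions_def transps_on_def)

lemma integral_if_complete:
  assumes T: "T \<subseteq> transpositions n"
    and iso: "digraph_iso (with_proj (transposition_graph n T)) (with_proj (complete_graph m))"
  shows "integral_graph (Cay (sym_group n) T)"
proof -
  interpret G: pair_graph "transposition_graph n T" by (rule pair_graph_transposition_graph)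
  have pv: "pverts (transposition_graph n T) = {1..n}" "pverts (complete_graph m) = {..<m}"
    by (simp_all add: transposition_graph_def complete_graph_def)
  have sub: "parcs (complete_graph m) \<subseteq> pverts (complete_graph m) \<times> pverts (complete_graph m)"
    by (auto simp: complete_graph_def)
  obtain \<phi> where \<phi>: "bij_betw \<phi> {1..n} {..<m}"
    "\<forall>u\<in>{1..n}. \<forall>v\<in>{1..n}. (u, v) \<in> parcs (transposition_graph n T) \<longleftrightarrow> (\<phi> u, \<phi> v) \<in> parcs (complete_graph m)"
    using iso unfolding digraph_iso_with_proj_iff[OF G.pair_wf_digraph_axioms sub] pv by (elim exE conjE)
  have "transpose i j \<in> T" if ij: "i \<in> {1..n}" "j \<in> {1..n}" "i \<noteq> j" for i j
  proof -
    have "\<phi> i \<noteq> \<phi> j" using \<phi>(1) ij by (auto simp: bij_betw_def dest: inj_onD)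
    moreover have "\<phi> i \<in> {..<m}" "\<phi> j \<in> {..<m}" using \<phi>(1) ij by (auto simp: bij_betw_def)
    ultimately have "(i, j) \<in> parcs (transposition_graph n T)"
      using \<phi>(2) ij by (auto simp: complete_graph_def)
    then show ?thesis by (simp add: parcs_transposition_graph tnbs_def)
  qed
  then have "transpositions n \<subseteq> T" unfolding transpositions_def by blast
  then have "T = transps_on {1..n}" using T transpositions_conv by blast
  then show ?thesis
    using integral_Cay_of_integral_op[OF T] integral_op_transps_on[of "{1..n}" "{1..n}"] by simp
qed

lemma integral_if_complete_bipartite:
  assumes T: "T \<subseteq> transpositions n"
    and iso: "digraph_iso (with_proj (transposition_graph n T)) (with_proj (complete_bipartite_graph a b))"
  shows "integral_graph (Cay (sym_group n) T)"
proof -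
  let ?K = "complete_bipartite_graph a b"
  interpret G: pair_graph "transposition_graph n T" by (rule pair_graph_transposition_graph)
  have pv: "pverts (transposition_graph n T) = {1..n}" "pverts ?K = Inl ` {..<a} \<union> Inr ` {..<b}"
    by (simp_all add: transposition_graph_def complete_bipartite_graph_def)
  have sub: "parcs ?K \<subseteq> pverts ?K \<times> pverts ?K" by (auto simp: complete_bipartite_graph_def)
  obtain \<phi> where \<phi>: "bij_betw \<phi> {1..n} (Inl ` {..<a} \<union> Inr ` {..<b})"
    "\<forall>u\<in>{1..n}. \<forall>v\<in>{1..n}. (u, v) \<in> parcs (transposition_graph n T) \<longleftrightarrow> (\<phi> u, \<phi> v) \<in> parcs ?K"
    using iso unfolding digraph_iso_with_proj_iff[OF G.pair_wf_digraph_axioms sub] pv by (elim exE conjE)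
  define P where "P = {x \<in> {1..n}. \<phi> x \<in> Inl ` {..<a}}"
  define Q where "Q = {x \<in> {1..n}. \<phi> x \<in> Inr ` {..<b}}"
  have "\<phi> x \<in> Inl ` {..<a} \<union> Inr ` {..<b}" if "x \<in> {1..n}" for x using \<phi>(1) that by (auto simp: bij_betw_def)
  then have "P \<union> Q = {1..n}" unfolding P_def Q_def by blast
  moreover have "P \<inter> Q = {}" by (auto simp: P_def Q_def)
  ultimately have PQ: "P \<union> Q = {1..n}" "P \<inter> Q = {}" .
  have arc: "transpose i j \<in> T \<longleftrightarrow> i \<in> P \<and> j \<in> Q \<or> i \<in> Q \<and> j \<in> P"
    if ij: "i \<in> {1..n}" "j \<in> {1..n}" "i \<noteq> j" for i j
  proof -
    have "transpose i j \<in> T \<longleftrightarrow> (i, j) \<in> parcs (transposition_graph n T)"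
      using ij by (auto simp: parcs_transposition_graph tnbs_def)
    also have "\<dots> \<longleftrightarrow> (\<phi> i, \<phi> j) \<in> parcs ?K" using \<phi>(2) ij by blast
    also have "\<dots> \<longleftrightarrow> i \<in> P \<and> j \<in> Q \<or> i \<in> Q \<and> j \<in> P"
      using ij by (auto simp: complete_bipartite_graph_def P_def Q_def)
    finally show ?thesis .
  qed
  have "T = {transpose i j | i j. i \<in> P \<and> j \<in> Q}"
  proof
    show "T \<subseteq> {transpose i j | i j. i \<in> P \<and> j \<in> Q}"
    proof
      fix t assume t: "t \<in> T"
      obtain i j where ij: "t = transpose i j" "i \<in> {1..n}" "j \<in> {1..n}" "i \<noteq> j"
        by (rule transpositionsE[OF T t])
      then consider "i \<in> P" "j \<in> Q" | "j \<in> P" "i \<in> Q" using arc[OF ij(2-4)] t by blast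
      then show "t \<in> {transpose i j | i j. i \<in> P \<and> j \<in> Q}"
      proof cases
        case 2
        have "t = transpose j i" unfolding ij(1) by (rule transpose_commute)
        then show ?thesis using 2 by blast
      qed (use ij in blast)
    qed
    show "{transpose i j | i j. i \<in> P \<and> j \<in> Q} \<subseteq> T"
    proof
      fix t assume "t \<in> {transpose i j | i j. i \<in> P \<and> j \<in> Q}"
      then obtain i j where ij: "t = transpose i j" "i \<in> P" "j \<in> Q" by blast
      then have "i \<in> {1..n}" "j \<in> {1..n}" "i \<noteq> j" using PQ by blast+
      then show "t \<in> T" using arc ij by blast
    qed
  qed
  moreover have "finite P" "finite Q" by (simp_all add: P_def Q_def)
  ultimately have "integral_op {g. g permutes {1..n}} (perm_op T)"
    using integral_op_bipartite[of P Q] PQ by simp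
  then show ?thesis by (rule integral_Cay_of_integral_op[OF T])
qed

theorem proposition5:
  fixes n :: nat and T :: "(nat \<Rightarrow> nat) set"
  assumes "T \<subseteq> transpositions n"
    and "connected (with_proj (transposition_graph n T))"
    and "cubic (transposition_graph n T)"
  shows "integral_graph (Cay (sym_group n) T) \<longleftrightarrow>
    digraph_iso (with_proj (transposition_graph n T)) (with_proj (complete_graph 4)) \<or>
    digraph_iso (with_proj (transposition_graph n T)) (with_proj (complete_bipartite_graph 3 3))"
proof
  let ?G = "transposition_graph n T"
  interpret G: pair_graph ?G by (rule pair_graph_transposition_graph)
  have pv: "pverts ?G = {1..n}" by (simp add: transposition_graph_def)
  assume "integral_graph (Cay (sym_group n) T)"
  then interpret integral_cubic "{1..n}" "tnbs n T"
    by (rule integral_cubic_tnbs[OF assms(1) cubic_graph_tnbs[OF assms(2,3)]])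
  obtain v where v: "v \<in> {1..n}" using V_nonempty by blast
  from sz_4_or_3 show "digraph_iso (with_proj ?G) (with_proj (complete_graph 4)) \<or>
    digraph_iso (with_proj ?G) (with_proj (complete_bipartite_graph 3 3))"
  proof (elim disjE conjE)
    assume "sz = 4" "\<not> bip"
    then have n: "n = 4" by (simp add: sz_def)
    have N: "tnbs n T u = {1..n} - {u}" if u: "u \<in> {1..n}" for u
    proof (rule card_subset_eq)
      show "tnbs n T u \<subseteq> {1..n} - {u}" by (auto simp: tnbs_def)
      show "card (tnbs n T u) = card ({1..n} - {u})" using card_N[OF u] u n by simp
    qed simp
    have bij: "bij_betw (\<lambda>x. x - 1) {1..n} {..<4}"
      unfolding n by (rule bij_betw_byWitness[where f' = Suc]) auto
    have sub: "parcs (complete_graph 4) \<subseteq> pverts (complete_graph 4) \<times> pverts (complete_graph 4)"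
      by (auto simp: complete_graph_def)
    have arcs: "(u, w) \<in> parcs ?G \<longleftrightarrow> (u - 1, w - 1) \<in> parcs (complete_graph 4)"
      if "u \<in> {1..n}" "w \<in> {1..n}" for u w
    proof -
      have "(u, w) \<in> parcs ?G \<longleftrightarrow> u \<noteq> w"
        unfolding parcs_transposition_graph N[OF that(1)] using that by auto
      moreover have "u - 1 \<noteq> w - 1 \<longleftrightarrow> u \<noteq> w" "u - 1 < 4" "w - 1 < 4" using that n by auto
      ultimately show ?thesis by (simp add: complete_graph_def)
    qed
    have "pverts (complete_graph 4) = {..<4}" by (simp add: complete_graph_def)
    with bij arcs have "digraph_iso (with_proj ?G) (with_proj (complete_graph 4))"
      unfolding digraph_iso_with_proj_iff[OF G.pair_wf_digraph_axioms sub] pv by metis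
    then show ?thesis ..
  next
    let ?K = "complete_bipartite_graph 3 3"
    assume sz: "sz = 3"
    \<comment> \<open>Otherwise \<open>sz\<close> would be the number of vertices, which is at least
      4.\<close>
    have bip: bip using sz four_le_card_V[OF v] by (auto simp: sz_def split: if_splits)
    have EO: "Ev v \<union> Od v = {1..n}" "Ev v \<inter> Od v = {}"
      by (rule Ev_Un_Od[OF v], rule bip_disjoint[OF bip v])
    have fin: "finite (Ev v)" "finite (Od v)" 
      by (rule finite_subset[OF Ev_subset[OF v] finite_V], rule finite_subset[OF Od_subset[OF v] finite_V])
    \<comment> \<open>A neighbourhood of size 3 inside a class of size 3 is the whole class.\<close>
    have NE: "tnbs n T u = Od v" if "u \<in> Ev v" for u
    proof (rule card_subset_eq[OF fin(2)])
      show "tnbs n T u \<subseteq> Od v" using N_Ev[OF that] by blast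
      have "u \<in> {1..n}" using that EO(1) by blast
      then show "card (tnbs n T u) = card (Od v)" using card_N[of u] class_card[OF v] sz by simp
    qed
    have NO: "tnbs n T u = Ev v" if "u \<in> Od v" for u
    proof (rule card_subset_eq[OF fin(1)])
      show "tnbs n T u \<subseteq> Ev v" using N_Od[OF v that] by blast
      have "u \<in> {1..n}" using that EO(1) by blast
      then show "card (tnbs n T u) = card (Ev v)" using card_N[of u] class_card[OF v] sz by simp
    qed
    obtain f :: "nat \<Rightarrow> nat" where f: "bij_betw f (Ev v) {0..<3}"
      using ex_bij_betw_finite_nat[OF fin(1)] class_card[OF v] sz by auto
    obtain g :: "nat \<Rightarrow> nat" where g: "bij_betw g (Od v) {0..<3}"
      using ex_bij_betw_finite_nat[OF fin(2)] class_card[OF v] sz by auto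
    define \<phi> :: "nat \<Rightarrow> nat + nat" where "\<phi> = (\<lambda>x. if x \<in> Ev v then Inl (f x) else Inr (g x))"
    have not_both: "x \<notin> Ev v" if "x \<in> Od v" for x using EO(2) that by blast
    have fx: "f x < 3" if "x \<in> Ev v" for x using bij_betwE[OF f] that by auto
    have gx: "g x < 3" if "x \<in> Od v" for x using bij_betwE[OF g] that by auto
    have "bij_betw \<phi> (Ev v \<union> Od v) (Inl ` {..<3} \<union> Inr ` {..<3})"
    proof (rule bij_betw_combine)
      have "\<phi> ` Ev v = Inl ` (f ` Ev v)" by (simp add: \<phi>_def image_image cong: image_cong)
      moreover have "inj_on \<phi> (Ev v)"
        using bij_betw_imp_inj_on[OF f] by (intro inj_onI) (simp add: \<phi>_def inj_on_eq_iff)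
      ultimately show "bij_betw \<phi> (Ev v) (Inl ` {..<3})"
        using bij_betw_imp_surj_on[OF f] by (simp add: bij_betw_def atLeast0LessThan)
      have "\<phi> ` Od v = Inr ` (g ` Od v)" by (simp add: \<phi>_def image_image not_both cong: image_cong)
      moreover have "inj_on \<phi> (Od v)"
        using bij_betw_imp_inj_on[OF g] by (intro inj_onI) (simp add: \<phi>_def not_both inj_on_eq_iff)
      ultimately show "bij_betw \<phi> (Od v) (Inr ` {..<3})"
        using bij_betw_imp_surj_on[OF g] by (simp add: bij_betw_def atLeast0LessThan)
    qed auto
    then have bij: "bij_betw \<phi> {1..n} (pverts ?K)" unfolding EO(1) by (simp add: complete_bipartite_graph_def)
    have sub: "parcs ?K \<subseteq> pverts ?K \<times> pverts ?K" by (auto simp: complete_bipartite_graph_def)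
    have "(u, w) \<in> parcs ?G \<longleftrightarrow> (\<phi> u, \<phi> w) \<in> parcs ?K" if uw: "u \<in> {1..n}" "w \<in> {1..n}" for u w
    proof -
      have "(u, w) \<in> parcs ?G \<longleftrightarrow> w \<in> tnbs n T u" using uw by (simp add: parcs_transposition_graph)
      moreover have "u \<in> Ev v \<or> u \<in> Od v" "w \<in> Ev v \<or> w \<in> Od v" using uw EO(1) by blast+
      moreover have "w \<in> tnbs n T u \<longleftrightarrow> u \<in> Ev v \<and> w \<in> Od v \<or> u \<in> Od v \<and> w \<in> Ev v"
        using calculation(2,3) NE NO not_both by metis
      moreover have "(\<phi> u, \<phi> w) \<in> parcs ?K \<longleftrightarrow> u \<in> Ev v \<and> w \<in> Od v \<or> u \<in> Od v \<and> w \<in> Ev v"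
        using calculation(2,3) not_both[of u] not_both[of w] fx[of u] fx[of w] gx[of u] gx[of w]
        by (elim disjE) (auto simp: \<phi>_def complete_bipartite_graph_def)
      ultimately show ?thesis by blast
    qed
    then have "digraph_iso (with_proj ?G) (with_proj ?K)"
      unfolding digraph_iso_with_proj_iff[OF G.pair_wf_digraph_axioms sub] pv
      using bij by blast
    then show ?thesis ..
  qed
next
  assume "digraph_iso (with_proj (transposition_graph n T)) (with_proj (complete_graph 4)) \<or>
    digraph_iso (with_proj (transposition_graph n T)) (with_proj (complete_bipartite_graph 3 3))"
  then show "integral_graph (Cay (sym_group n) T)"
    using integral_if_complete[OF assms(1)] integral_if_complete_bipartite[OF assms(1)] by blast
qed

end
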